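(* Let $\mathbf{K}$ be an algebraically closed field of characteristic zero. If the tree model $T(f)$ of a quasi-ordinary Weierstrass polynomial $f(Y)\in\mathbf{K}[[X_1,\dots,X_d]][Y]$ is of type $(h_1,h_2,\dots,h_g)$, then $f(Y)$ is irreducible in $\mathbf{K}[[X_1,\dots,X_d]][Y]$ and $h_1,h_2,\dots,h_g$ is the sequence of its characteristic exponents.
   Context: Write $\underline X=(X_1,\dots,X_d)$ and $\underline X^{\alpha}=X_1^{\alpha_1}\cdots X_d^{\alpha_d}$ for $\alpha\in\mathbf{Q}_{\ge 0}^d$. A polynomial $f(Y)=Y^n+a_1(\underline X)Y^{n-1}+\cdots+a_n(\underline X)\in\mathbf{K}[[\underline X]][Y]$ ($n\ge 1$) is a Weierstrass polynomial if $a_i(0)=0$ for all $i$. It is quasi-ordinary if its $Y$-discriminant equals $X_1^{\alpha_1}\cdots X_d^{\alpha_d}u(\underline X)$ with $\alpha_i\in\mathbf{N}$ (where $0\in\mathbf{N}$) and $u(0)\ne 0$. Contacts: by the Abhyankar-Jung theorem there is a positive integer $k$ such that all roots $\mathrm{Zer} f=\{Y_1,\dots,Y_n\}$ of $f$ lie in $\mathbf{K}[[X_1^{1/k},\dots,X_d^{1/k}]]$, and for $i\ne j$ one has $Y_i-Y_j=\underline X^{\lambda_{ij}}u_{ij}$ with $\lambda_{ij}\in\frac1k\mathbf{N}^d$, $u_{ij}\in\mathbf{K}[[X_1^{1/k},\dots,X_d^{1/k}]]$, $u_{ij}(0)\neq 0$. The contact is $O(Y_i,Y_j):=\lambda_{ij}$,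 and $O(Y_i,Y_i)=+\infty$. $\mathbf{Q}^d$ is partially ordered componentwise ($\alpha<\beta$ means $\alpha\le\beta$, $\alpha\ne\beta$), and $\alpha<+\infty$ for all $\alpha\in\mathbf{Q}^d$. For every nonempty $A\subset\mathrm{Zer} f$ the set of contacts between elements of $A$ has a smallest element. Tree model $T(f)$: it is the collection of subsets of $\mathrm{Zer} f$, called bars, obtained recursively as follows. $\mathrm{Zer} f$ is a bar (the bar of lowest height). The height $h(B)$ of a bar $B$ is the minimal contact between elements of $B$ (it is $+\infty$ iff $B$ is a singleton). If $h(B)$ is finite, the equivalence classes of $B$ under the relation $O(Y_i,Y_j)>h(B)$ are again bars, called the postbars of $B$. Bars of infinite height have no postbars; they are counted as bars and as postbars. Type: let $h_1,\dots,h_g\in\mathbf{Q}_{\ge0}^d$, $h_{g+1}=\infty$, $N_0=\mathbf{Z}^d$, $N_i=\mathbf{Z}^d+\mathbf{Z}h_1+\cdots+\mathbf{Z}h_i$. A tree model $T$ is of type $(h_1,\dots,h_g)$ if (i) the set of heights of bars of $T$ is $\{h_1,\dots,h_g,h_{g+1}\}$, and (ii) for $i=1,\dots,g$, every bar of height $h_i$ has $[N_i:N_{i-1}]$ postbars and all of them have height $h_{i+1}$. Characteristic exponents: if $f$ is irreducible, the set $\{O(Y_j,Y_i): j\ne i\}$ does not depend on the choice of $Y_i\in\mathrm{Zer} f$ and is totally ordered; listing its elements in increasing order $h_1<\dots<h_g$ gives the sequence of characteristic exponents of $f$. *)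

theory Defs
  imports
    "HOL-Computational_Algebra.Computational_Algebra"
    "HOL-Library.Function_Algebras"
    "HOL-Library.Extended"
    "Subresultants.Resultant_Prelim"
begin

text \<open>
  Exponents are functions \<^typ>\<open>'d \<Rightarrow> rat\<close> on a finite index type \<open>'d\<close>
  (so \<open>d = CARD('d)\<close>), with pointwise addition and the pointwise partial order.
\<close>

section \<open>Power series with fractional exponents\<close>

text \<open>The set \<open>(1/k) \<nat>\<^sup>d\<close>.\<close>

definition exp_grid :: "nat \<Rightarrow> ('d \<Rightarrow> rat) set" where
  "exp_grid k = range (\<lambda>(m :: 'd \<Rightarrow> nat) i. of_nat (m i) / of_nat k)"

text \<open>
  The type \<open>('a, 'd) fracps\<close> is the union over all \<open>k > 0\<close> of the rings
  \<open>'a[[X\<^sub>1\<^sup>1\<^sup>/\<^sup>k, \<dots>, X\<^sub>d\<^sup>1\<^sup>/\<^sup>k]]\<close>, an element being given by its coefficient function.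
\<close>

typedef (overloaded) ('a :: zero, 'd) fracps =
  "{c :: ('d \<Rightarrow> rat) \<Rightarrow> 'a. \<exists>k>0. {\<alpha>. c \<alpha> \<noteq> 0} \<subseteq> exp_grid k}"
  morphisms fracps_coeff Abs_fracps
  by (rule exI[of _ "\<lambda>_. 0"]) auto

setup_lifting type_definition_fracps

lemma fracps_eqI: "(\<And>\<alpha>. fracps_coeff f \<alpha> = fracps_coeff g \<alpha>) \<Longrightarrow> f = g"
  by (metis ext fracps_coeff_inject)

lemma exp_grid_mono:
  assumes "k dvd l" "l > 0"
  shows "exp_grid k \<subseteq> exp_grid l"
proof
  fix \<alpha> :: "'d \<Rightarrow> rat"
  assume "\<alpha> \<in> exp_grid k"
  then obtain m :: "'d \<Rightarrow> nat" where m: "\<alpha> = (\<lambda>i. of_nat (m i) / of_nat k)"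
    by (auto simp: exp_grid_def)
  from assms obtain c where c: "l = k * c" by (auto elim: dvdE)
  with assms have "k > 0" "c > 0" by auto
  then have "\<alpha> = (\<lambda>i. of_nat (m i * c) / of_nat l)"
    by (auto simp: m c)
  then show "\<alpha> \<in> exp_grid l" unfolding exp_grid_def by (intro image_eqI[of _ _ "\<lambda>i. m i * c"]) auto
qed

lemma fracps_supportE:
  fixes f :: "('a :: zero, 'd) fracps"
  obtains k where "k > 0" "{\<alpha>. fracps_coeff f \<alpha> \<noteq> 0} \<subseteq> exp_grid k"
  using fracps_coeff[of f] by auto

lemma exp_grid_zero: "(0 :: 'd \<Rightarrow> rat) \<in> exp_grid k"
  unfolding exp_grid_def by (intro image_eqI[of _ _ "\<lambda>_. 0"]) (auto simp: zero_fun_def)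

lemma exp_grid_add:
  assumes "\<alpha> \<in> exp_grid k" "\<beta> \<in> exp_grid k"
  shows "\<alpha> + \<beta> \<in> exp_grid k"
proof -
  from assms obtain m n where "\<alpha> = (\<lambda>i. of_nat (m i) / of_nat k)" "\<beta> = (\<lambda>i. of_nat (n i) / of_nat k)"
    by (auto simp: exp_grid_def)
  then have "\<alpha> + \<beta> = (\<lambda>i. of_nat (m i + n i) / of_nat k)"
    by (auto simp: fun_eq_iff add_divide_distrib)
  then show ?thesis unfolding exp_grid_def by (intro image_eqI[of _ _ "\<lambda>i. m i + n i"]) auto
qed

lemma exp_grid_nonneg: "\<alpha> \<in> exp_grid k \<Longrightarrow> 0 \<le> \<alpha>"
  by (auto simp: exp_grid_def le_fun_def)

lemma nonneg_in_exp_grid: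
  fixes \<alpha> :: "'d :: finite \<Rightarrow> rat"
  assumes "0 \<le> \<alpha>"
  shows "\<exists>k>0. \<alpha> \<in> exp_grid k"
proof -
  define q where "q i = nat (snd (quotient_of (\<alpha> i)))" for i
  define p where "p i = nat (fst (quotient_of (\<alpha> i)))" for i
  have q: "q i > 0" and \<alpha>: "\<alpha> i = of_nat (p i) / of_nat (q i)" for i
  proof -
    obtain a b where ab: "quotient_of (\<alpha> i) = (a, b)" by force
    have b: "b > 0" using ab by (rule quotient_of_denom_pos)
    have e: "\<alpha> i = of_int a / of_int b" using ab by (rule quotient_of_div)
    have "\<alpha> i \<ge> 0" using assms by (auto simp: le_fun_def)
    with e b have "a \<ge> 0" by (auto simp: zero_le_divide_iff)
    with ab b e show "q i > 0" "\<alpha> i = of_nat (p i) / of_nat (q i)"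
      by (auto simp: q_def p_def)
  qed
  define k where "k = prod q UNIV"
  have k: "k > 0" using q by (auto simp: k_def)
  have "\<alpha> i = of_nat (p i * (k div q i)) / of_nat k" for i
  proof -
    have "q i dvd k" unfolding k_def by (rule dvd_prodI) auto
    then obtain c where c: "k = q i * c" by (auto elim: dvdE)
    with k have "c > 0" by (cases c) auto
    with c q[of i] \<alpha>[of i] show ?thesis by auto
  qed
  then have "\<alpha> \<in> exp_grid k"
    unfolding exp_grid_def by (intro image_eqI[of _ _ "\<lambda>i. p i * (k div q i)"]) auto
  with k show ?thesis by blast
qed

text \<open>The decompositions of an exponent; there are finitely many of them on each grid.\<close>

definition exp_decomps :: "nat \<Rightarrow> ('d \<Rightarrow> rat) \<Rightarrow> (('d \<Rightarrow> rat) \<times> ('d \<Rightarrow> rat)) set" where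
  "exp_decomps k \<alpha> = {(\<beta>, \<gamma>). \<beta> \<in> exp_grid k \<and> \<gamma> \<in> exp_grid k \<and> \<beta> + \<gamma> = \<alpha>}"

lemma finite_exp_grid_le:
  fixes \<alpha> :: "'d :: finite \<Rightarrow> rat"
  assumes "k > 0"
  shows "finite {\<beta> \<in> exp_grid k. \<beta> \<le> \<alpha>}"
proof -
  define N where "N = nat \<lceil>Max (range \<alpha>) * of_nat k\<rceil>"
  define M where "M = {m :: 'd \<Rightarrow> nat. \<forall>i. m i \<le> N}"
  have "finite {m :: 'd \<Rightarrow> nat. \<forall>i. (i \<in> UNIV \<longrightarrow> m i \<in> {..N}) \<and> (i \<notin> UNIV \<longrightarrow> m i = 0)}"
    by (rule finite_set_of_finite_funs) auto
  then have "finite M" by (simp add: M_def)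
  moreover have "{\<beta> \<in> exp_grid k. \<beta> \<le> \<alpha>} \<subseteq> (\<lambda>m i. of_nat (m i) / of_nat k) ` M"
  proof
    fix \<beta> assume "\<beta> \<in> {\<beta> \<in> exp_grid k. \<beta> \<le> \<alpha>}"
    then obtain m where m: "\<beta> = (\<lambda>i. of_nat (m i) / of_nat k)" and le: "\<beta> \<le> \<alpha>"
      by (auto simp: exp_grid_def)
    have "m i \<le> N" for i
    proof -
      have "of_nat (m i) / of_nat k \<le> \<alpha> i" using le by (auto simp: m le_fun_def)
      also have "\<dots> \<le> Max (range \<alpha>)" by auto
      finally have "rat_of_nat (m i) \<le> Max (range \<alpha>) * of_nat k"
        using assms by (simp add: field_simps)
      also have "\<dots> \<le> of_int \<lceil>Max (range \<alpha>) * of_nat k\<rceil>" by (rule le_of_int_ceiling)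
      finally have "int (m i) \<le> \<lceil>Max (range \<alpha>) * of_nat k\<rceil>"
        by (metis of_int_le_iff of_int_of_nat_eq)
      then show ?thesis by (auto simp: N_def)
    qed
    then show "\<beta> \<in> (\<lambda>m i. of_nat (m i) / of_nat k) ` M" by (auto simp: M_def m)
  qed
  ultimately show ?thesis by (blast intro: finite_subset)
qed

lemma finite_exp_decomps:
  fixes \<alpha> :: "'d :: finite \<Rightarrow> rat"
  assumes "k > 0"
  shows "finite (exp_decomps k \<alpha>)"
proof (rule finite_subset)
  show "exp_decomps k \<alpha> \<subseteq> (\<lambda>\<beta>. (\<beta>, \<alpha> - \<beta>)) ` {\<beta> \<in> exp_grid k. \<beta> \<le> \<alpha>}"
  proof
    fix x assume "x \<in> exp_decomps k \<alpha>"
    then obtain \<beta> \<gamma> where x: "x = (\<beta>, \<gamma>)" "\<beta> \<in> exp_grid k" "\<gamma> \<in> exp_grid k" "\<beta> + \<gamma> = \<alpha>"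
      by (auto simp: exp_decomps_def)
    then have "\<gamma> = \<alpha> - \<beta>" "\<beta> \<le> \<alpha>" using exp_grid_nonneg[of \<gamma> k] by (auto simp: le_fun_def)
    with x show "x \<in> (\<lambda>\<beta>. (\<beta>, \<alpha> - \<beta>)) ` {\<beta> \<in> exp_grid k. \<beta> \<le> \<alpha>}" by auto
  qed
  show "finite ((\<lambda>\<beta>. (\<beta>, \<alpha> - \<beta>)) ` {\<beta> \<in> exp_grid k. \<beta> \<le> \<alpha>})"
    using finite_exp_grid_le[OF assms] by blast
qed

definition exp_conv :: "(('d \<Rightarrow> rat) \<Rightarrow> 'a :: semiring_0) \<Rightarrow> (('d \<Rightarrow> rat) \<Rightarrow> 'a) \<Rightarrow> ('d \<Rightarrow> rat) \<Rightarrow> 'a" where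
  "exp_conv f g \<alpha> = (\<Sum>(\<beta>, \<gamma>) | \<beta> + \<gamma> = \<alpha> \<and> f \<beta> \<noteq> 0 \<and> g \<gamma> \<noteq> 0. f \<beta> * g \<gamma>)"

lemma exp_conv_grid:
  fixes f g :: "('d :: finite \<Rightarrow> rat) \<Rightarrow> 'a :: semiring_0"
  assumes "k > 0" "{\<alpha>. f \<alpha> \<noteq> 0} \<subseteq> exp_grid k" "{\<alpha>. g \<alpha> \<noteq> 0} \<subseteq> exp_grid k"
  shows "exp_conv f g \<alpha> = (\<Sum>(\<beta>, \<gamma>)\<in>exp_decomps k \<alpha>. f \<beta> * g \<gamma>)"
  unfolding exp_conv_def
proof (rule sum.mono_neutral_left[OF finite_exp_decomps[OF assms(1)]])
  show "{(\<beta>, \<gamma>). \<beta> + \<gamma> = \<alpha> \<and> f \<beta> \<noteq> 0 \<and> g \<gamma> \<noteq> 0} \<subseteq> exp_decomps k \<alpha>"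
    using assms by (auto simp: exp_decomps_def)
qed (auto simp: exp_decomps_def)

lemma exp_conv_support:
  assumes "{\<alpha>. f \<alpha> \<noteq> 0} \<subseteq> exp_grid k" "{\<alpha>. g \<alpha> \<noteq> 0} \<subseteq> exp_grid k"
  shows "{\<alpha>. exp_conv f g \<alpha> \<noteq> 0} \<subseteq> exp_grid k"
proof
  fix \<alpha> assume "\<alpha> \<in> {\<alpha>. exp_conv f g \<alpha> \<noteq> 0}"
  then have "{(\<beta>, \<gamma>). \<beta> + \<gamma> = \<alpha> \<and> f \<beta> \<noteq> 0 \<and> g \<gamma> \<noteq> 0} \<noteq> {}"
    unfolding exp_conv_def by force
  then show "\<alpha> \<in> exp_grid k" using assms by (auto intro!: exp_grid_add)
qed

lemma exp_add_support:
  fixes f g :: "('d \<Rightarrow> rat) \<Rightarrow> 'a :: monoid_add"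
  assumes "{\<alpha>. f \<alpha> \<noteq> 0} \<subseteq> exp_grid k" "{\<alpha>. g \<alpha> \<noteq> 0} \<subseteq> exp_grid k"
  shows "{\<alpha>. f \<alpha> + g \<alpha> \<noteq> 0} \<subseteq> exp_grid k"
proof
  fix \<alpha> assume "\<alpha> \<in> {\<alpha>. f \<alpha> + g \<alpha> \<noteq> 0}"
  then have "f \<alpha> \<noteq> 0 \<or> g \<alpha> \<noteq> 0" by auto
  with assms show "\<alpha> \<in> exp_grid k" by blast
qed

lemma common_grid2:
  fixes f g :: "('d \<Rightarrow> rat) \<Rightarrow> 'a :: zero"
  assumes "\<exists>k>0. {\<alpha>. f \<alpha> \<noteq> 0} \<subseteq> exp_grid k" "\<exists>k>0. {\<alpha>. g \<alpha> \<noteq> 0} \<subseteq> exp_grid k"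
  obtains k where "k > 0" "{\<alpha>. f \<alpha> \<noteq> 0} \<subseteq> exp_grid k" "{\<alpha>. g \<alpha> \<noteq> 0} \<subseteq> exp_grid k"
proof -
  from assms obtain k l where kl: "k > 0" "l > 0" "{\<alpha>. f \<alpha> \<noteq> 0} \<subseteq> exp_grid k" "{\<alpha>. g \<alpha> \<noteq> 0} \<subseteq> exp_grid l"
    by auto
  moreover have "(exp_grid k :: ('d \<Rightarrow> rat) set) \<subseteq> exp_grid (k * l)"
    "(exp_grid l :: ('d \<Rightarrow> rat) set) \<subseteq> exp_grid (k * l)"
    using exp_grid_mono[of k "k * l"] exp_grid_mono[of l "k * l"] kl by simp_all
  ultimately show ?thesis by (intro that[of "k * l"]) auto
qed

lemma common_grid3:
  fixes f g h :: "('d \<Rightarrow> rat) \<Rightarrow> 'a :: zero"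
  assumes "\<exists>k>0. {\<alpha>. f \<alpha> \<noteq> 0} \<subseteq> exp_grid k" "\<exists>k>0. {\<alpha>. g \<alpha> \<noteq> 0} \<subseteq> exp_grid k"
    "\<exists>k>0. {\<alpha>. h \<alpha> \<noteq> 0} \<subseteq> exp_grid k"
  obtains k where "k > 0" "{\<alpha>. f \<alpha> \<noteq> 0} \<subseteq> exp_grid k" "{\<alpha>. g \<alpha> \<noteq> 0} \<subseteq> exp_grid k"
    "{\<alpha>. h \<alpha> \<noteq> 0} \<subseteq> exp_grid k"
proof -
  from common_grid2[OF assms(1,2)] obtain k where
    k: "k > 0" "{\<alpha>. f \<alpha> \<noteq> 0} \<subseteq> exp_grid k" "{\<alpha>. g \<alpha> \<noteq> 0} \<subseteq> exp_grid k" by blast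
  from assms(3) obtain l where l: "l > 0" "{\<alpha>. h \<alpha> \<noteq> 0} \<subseteq> exp_grid l" by blast
  have "(exp_grid k :: ('d \<Rightarrow> rat) set) \<subseteq> exp_grid (k * l)"
    "(exp_grid l :: ('d \<Rightarrow> rat) set) \<subseteq> exp_grid (k * l)"
    using exp_grid_mono[of k "k * l"] exp_grid_mono[of l "k * l"] k l by simp_all
  with k l show ?thesis by (intro that[of "k * l"]) auto
qed

lemma exp_conv_assoc:
  fixes f g h :: "('d :: finite \<Rightarrow> rat) \<Rightarrow> 'a :: semiring_0"
  assumes k: "k > 0" and f: "{\<alpha>. f \<alpha> \<noteq> 0} \<subseteq> exp_grid k" and g: "{\<alpha>. g \<alpha> \<noteq> 0} \<subseteq> exp_grid k"
    and h: "{\<alpha>. h \<alpha> \<noteq> 0} \<subseteq> exp_grid k"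
  shows "exp_conv (exp_conv f g) h \<alpha> = exp_conv f (exp_conv g h) \<alpha>"
proof -
  note fin = finite_exp_decomps[OF k]
  have "exp_conv (exp_conv f g) h \<alpha> =
      (\<Sum>x\<in>exp_decomps k \<alpha>. \<Sum>y\<in>exp_decomps k (fst x). f (fst y) * g (snd y) * h (snd x))"
    by (simp add: exp_conv_grid[OF k exp_conv_support[OF f g] h] exp_conv_grid[OF k f g]
        case_prod_unfold sum_distrib_right)
  also have "\<dots> = (\<Sum>(x, y)\<in>(SIGMA x:exp_decomps k \<alpha>. exp_decomps k (fst x)).
      f (fst y) * g (snd y) * h (snd x))"
    by (rule sum.Sigma) (auto intro: fin)
  also have "\<dots> = (\<Sum>(x, y)\<in>(SIGMA x:exp_decomps k \<alpha>. exp_decomps k (snd x)).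
      f (fst x) * (g (fst y) * h (snd y)))"
    by (rule sum.reindex_bij_witness[where
        i = "\<lambda>((\<beta>, _), (\<gamma>, \<delta>)). ((\<beta> + \<gamma>, \<delta>), (\<beta>, \<gamma>))" and
        j = "\<lambda>((_, \<delta>), (\<beta>, \<gamma>)). ((\<beta>, \<gamma> + \<delta>), (\<gamma>, \<delta>))"])
      (auto simp: exp_decomps_def add.assoc mult.assoc intro!: exp_grid_add)
  also have "\<dots> = (\<Sum>x\<in>exp_decomps k \<alpha>. \<Sum>y\<in>exp_decomps k (snd x). f (fst x) * (g (fst y) * h (snd y)))"
    by (rule sum.Sigma[symmetric]) (auto intro: fin)
  also have "\<dots> = exp_conv f (exp_conv g h) \<alpha>"
    by (simp add: exp_conv_grid[OF k f exp_conv_support[OF g h]] exp_conv_grid[OF k g h]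
        case_prod_unfold sum_distrib_left)
  finally show ?thesis .
qed

lemma exp_conv_commute:
  fixes f g :: "('d :: finite \<Rightarrow> rat) \<Rightarrow> 'a :: comm_semiring_0"
  shows "exp_conv f g \<alpha> = exp_conv g f \<alpha>"
  unfolding exp_conv_def
  by (rule sum.reindex_bij_witness[where i = prod.swap and j = prod.swap])
    (auto simp: add.commute mult.commute)

lemma exp_conv_delta:
  fixes g :: "('d :: finite \<Rightarrow> rat) \<Rightarrow> 'a :: semiring_1"
  shows "exp_conv (\<lambda>\<beta>. if \<beta> = \<mu> then 1 else 0) g \<alpha> = g (\<alpha> - \<mu>)"
proof -
  have *: "{(\<beta>, \<gamma>). \<beta> + \<gamma> = \<alpha> \<and> (if \<beta> = \<mu> then 1 else (0 :: 'a)) \<noteq> 0 \<and> g \<gamma> \<noteq> 0} =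
      (if g (\<alpha> - \<mu>) = 0 then {} else {(\<mu>, \<alpha> - \<mu>)})"
    by (auto split: if_splits)
  show ?thesis unfolding exp_conv_def * by auto
qed

text \<open>
  Leading exponents: iterated minimisation of coordinates yields exponents \<open>\<alpha>, \<beta>\<close> whose sum
  decomposes in only one way.
\<close>

lemma unique_sum_exponents:
  fixes S T :: "('d :: finite \<Rightarrow> rat) set"
  assumes k: "k > 0" and S: "S \<subseteq> exp_grid k" "S \<noteq> {}" and T: "T \<subseteq> exp_grid k" "T \<noteq> {}"
  shows "\<exists>\<alpha>\<in>S. \<exists>\<beta>\<in>T. \<forall>\<alpha>'\<in>S. \<forall>\<beta>'\<in>T. \<alpha>' + \<beta>' = \<alpha> + \<beta> \<longrightarrow> \<alpha>' = \<alpha> \<and> \<beta>' = \<beta>"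
proof -
  have min_ex: "\<exists>a\<in>A. \<forall>b\<in>A. a i \<le> b i" if A: "A \<subseteq> exp_grid k" "A \<noteq> {}"
    for A :: "('d \<Rightarrow> rat) set" and i
  proof -
    define m where "m a = nat \<lfloor>a i * of_nat k\<rfloor>" for a :: "'d \<Rightarrow> rat"
    have m: "a i = of_nat (m a) / of_nat k" if "a \<in> A" for a
    proof -
      from that A obtain n where "a = (\<lambda>i. of_nat (n i) / of_nat k)" by (auto simp: exp_grid_def)
      then show ?thesis using k by (simp add: m_def)
    qed
    from A obtain a0 where "a0 \<in> A" by auto
    then obtain a where a: "a \<in> A" "\<And>b. b \<in> A \<Longrightarrow> m a \<le> m b"
      using ex_has_least_nat[of "\<lambda>a. a \<in> A" a0 m] by auto
    then have "a i \<le> b i" if "b \<in> A" for b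
      using k m[of a] m[of b] that by (simp add: divide_right_mono)
    with a show ?thesis by blast
  qed
  define closed where "closed A B \<longleftrightarrow> A \<subseteq> S \<and> A \<noteq> {} \<and> B \<subseteq> T \<and> B \<noteq> {} \<and>
      (\<forall>\<alpha>\<in>A. \<forall>\<beta>\<in>B. \<forall>\<alpha>'\<in>S. \<forall>\<beta>'\<in>T. \<alpha>' + \<beta>' = \<alpha> + \<beta> \<longrightarrow> \<alpha>' \<in> A \<and> \<beta>' \<in> B)" for A B
  define const where "const C i \<longleftrightarrow> (\<forall>\<alpha>\<in>C. \<forall>\<alpha>'\<in>C. \<alpha> i = \<alpha>' i)" for C :: "('d \<Rightarrow> rat) set" and i
  have "\<exists>A B. closed A B \<and> (\<forall>i\<in>I. const A i \<and> const B i)" for I :: "'d set"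
    using finite[of I]
  proof (induction I rule: finite_induct)
    case empty
    have "closed S T" using S T by (simp add: closed_def)
    then show ?case by blast
  next
    case (insert i I)
    from insert.IH obtain A B where c: "closed A B" and eq: "\<forall>i\<in>I. const A i \<and> const B i"
      by blast
    from c have AB: "A \<subseteq> S" "A \<noteq> {}" "B \<subseteq> T" "B \<noteq> {}"
      and cl0: "\<forall>\<alpha>\<in>A. \<forall>\<beta>\<in>B. \<forall>\<alpha>'\<in>S. \<forall>\<beta>'\<in>T. \<alpha>' + \<beta>' = \<alpha> + \<beta> \<longrightarrow> \<alpha>' \<in> A \<and> \<beta>' \<in> B"
      unfolding closed_def by blast+
    have cl: "\<alpha>' \<in> A \<and> \<beta>' \<in> B"
      if "\<alpha> \<in> A" "\<beta> \<in> B" "\<alpha>' \<in> S" "\<beta>' \<in> T" "\<alpha>' + \<beta>' = \<alpha> + \<beta>" for \<alpha> \<beta> \<alpha>' \<beta>'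
      using cl0 that by blast
    have "A \<subseteq> exp_grid k" "B \<subseteq> exp_grid k" using AB S T by blast+
    from min_ex[OF this(1) AB(2)] min_ex[OF this(2) AB(4)] obtain a b
      where a: "a \<in> A" "\<forall>b\<in>A. a i \<le> b i" and b: "b \<in> B" "\<forall>c\<in>B. b i \<le> c i" by blast
    let ?A = "{\<alpha> \<in> A. \<alpha> i = a i}" and ?B = "{\<beta> \<in> B. \<beta> i = b i}"
    have cl': "\<alpha>' \<in> ?A \<and> \<beta>' \<in> ?B"
      if "\<alpha> \<in> ?A" "\<beta> \<in> ?B" "\<alpha>' \<in> S" "\<beta>' \<in> T" "\<alpha>' + \<beta>' = \<alpha> + \<beta>" for \<alpha> \<beta> \<alpha>' \<beta>'
    proof -
      have mem: "\<alpha>' \<in> A" "\<beta>' \<in> B" using cl[OF _ _ that(3-5)] that(1,2) by simp_all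
      have "\<alpha>' i + \<beta>' i = a i + b i"
        using that(1,2) fun_cong[OF that(5), of i] by simp
      moreover have "a i \<le> \<alpha>' i" "b i \<le> \<beta>' i" using a(2) b(2) mem by blast+
      ultimately show ?thesis using mem by simp
    qed
    have "?A \<subseteq> S" "?A \<noteq> {}" "?B \<subseteq> T" "?B \<noteq> {}" using AB a b by blast+
    moreover have "\<forall>\<alpha>\<in>?A. \<forall>\<beta>\<in>?B. \<forall>\<alpha>'\<in>S. \<forall>\<beta>'\<in>T. \<alpha>' + \<beta>' = \<alpha> + \<beta> \<longrightarrow> \<alpha>' \<in> ?A \<and> \<beta>' \<in> ?B"
      by (intro ballI impI cl')
    ultimately have "closed ?A ?B" unfolding closed_def by (intro conjI)
    moreover have "const ?A j \<and> const ?B j" if "j \<in> insert i I" for j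
    proof (cases "j = i")
      case True
      then show ?thesis by (simp add: const_def)
    next
      case False
      with that eq have "const A j" "const B j" by simp_all
      then show ?thesis by (simp add: const_def)
    qed
    ultimately show ?case by blast
  qed
  from this[of UNIV] obtain A B where c: "closed A B" and eq: "\<And>i. const A i" "\<And>i. const B i"
    by blast
  from c have AB: "A \<subseteq> S" "A \<noteq> {}" "B \<subseteq> T" "B \<noteq> {}"
    and cl0: "\<forall>\<alpha>\<in>A. \<forall>\<beta>\<in>B. \<forall>\<alpha>'\<in>S. \<forall>\<beta>'\<in>T. \<alpha>' + \<beta>' = \<alpha> + \<beta> \<longrightarrow> \<alpha>' \<in> A \<and> \<beta>' \<in> B"
    unfolding closed_def by blast+
  have cl: "\<alpha>' \<in> A \<and> \<beta>' \<in> B"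
    if "\<alpha> \<in> A" "\<beta> \<in> B" "\<alpha>' \<in> S" "\<beta>' \<in> T" "\<alpha>' + \<beta>' = \<alpha> + \<beta>" for \<alpha> \<beta> \<alpha>' \<beta>'
    using cl0 that by blast
  from AB obtain \<alpha> \<beta> where "\<alpha> \<in> A" "\<beta> \<in> B" by blast
  have "\<alpha>' = \<alpha> \<and> \<beta>' = \<beta>" if "\<alpha>' \<in> S" "\<beta>' \<in> T" "\<alpha>' + \<beta>' = \<alpha> + \<beta>" for \<alpha>' \<beta>'
  proof -
    from cl[OF \<open>\<alpha> \<in> A\<close> \<open>\<beta> \<in> B\<close> that] have "\<alpha>' \<in> A" "\<beta>' \<in> B" by simp_all
    with eq \<open>\<alpha> \<in> A\<close> \<open>\<beta> \<in> B\<close> show ?thesis by (simp add: const_def fun_eq_iff)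
  qed
  with AB \<open>\<alpha> \<in> A\<close> \<open>\<beta> \<in> B\<close> show ?thesis by blast
qed

instantiation fracps :: (ab_group_add, type) ab_group_add
begin

lift_definition zero_fracps :: "('a, 'b) fracps" is "\<lambda>_. 0" by auto

lift_definition plus_fracps :: "('a, 'b) fracps \<Rightarrow> ('a, 'b) fracps \<Rightarrow> ('a, 'b) fracps"
  is "\<lambda>f g \<alpha>. f \<alpha> + g \<alpha>"
proof -
  fix f g :: "('b \<Rightarrow> rat) \<Rightarrow> 'a"
  assume "\<exists>k>0. {\<alpha>. f \<alpha> \<noteq> 0} \<subseteq> exp_grid k" "\<exists>k>0. {\<alpha>. g \<alpha> \<noteq> 0} \<subseteq> exp_grid k"
  then obtain k where "k > 0" "{\<alpha>. f \<alpha> \<noteq> 0} \<subseteq> exp_grid k" "{\<alpha>. g \<alpha> \<noteq> 0} \<subseteq> exp_grid k"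
    by (rule common_grid2)
  then show "\<exists>k>0. {\<alpha>. f \<alpha> + g \<alpha> \<noteq> 0} \<subseteq> exp_grid k"
    by (intro exI[of _ k] conjI exp_add_support)
qed

lift_definition uminus_fracps :: "('a, 'b) fracps \<Rightarrow> ('a, 'b) fracps" is "\<lambda>f \<alpha>. - f \<alpha>" by auto

definition minus_fracps :: "('a, 'b) fracps \<Rightarrow> ('a, 'b) fracps \<Rightarrow> ('a, 'b) fracps" where
  "minus_fracps f g = f + - g"

instance
proof
  fix a b c :: "('a, 'b) fracps"
  show "a + b + c = a + (b + c)" by transfer (simp add: add.assoc)
  show "a + b = b + a" by transfer (simp add: add.commute)
  show "0 + a = a" by transfer simp
  show "- a + a = 0" by transfer simp
  show "a - b = a + - b" by (simp add: minus_fracps_def)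
qed

end

lift_definition fracps_X_pow :: "('d :: finite \<Rightarrow> rat) \<Rightarrow> ('a :: zero_neq_one, 'd) fracps"
  is "\<lambda>\<mu> \<beta>. if \<beta> = \<mu> \<and> 0 \<le> \<mu> then 1 else 0"
proof -
  fix l :: "'d \<Rightarrow> rat"
  show "\<exists>k>0. {\<beta>. (if \<beta> = l \<and> 0 \<le> l then 1 else (0 :: 'a)) \<noteq> 0} \<subseteq> exp_grid k"
    using nonneg_in_exp_grid[of l] by (cases "0 \<le> l") auto
qed

instantiation fracps :: (comm_ring_1, finite) comm_ring_1
begin

definition one_fracps :: "('a, 'b) fracps" where "one_fracps = fracps_X_pow 0"

lift_definition times_fracps :: "('a, 'b) fracps \<Rightarrow> ('a, 'b) fracps \<Rightarrow> ('a, 'b) fracps"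
  is exp_conv
proof -
  fix f g :: "('b \<Rightarrow> rat) \<Rightarrow> 'a"
  assume "\<exists>k>0. {\<alpha>. f \<alpha> \<noteq> 0} \<subseteq> exp_grid k" "\<exists>k>0. {\<alpha>. g \<alpha> \<noteq> 0} \<subseteq> exp_grid k"
  then obtain k where "k > 0" "{\<alpha>. f \<alpha> \<noteq> 0} \<subseteq> exp_grid k" "{\<alpha>. g \<alpha> \<noteq> 0} \<subseteq> exp_grid k"
    by (rule common_grid2)
  then show "\<exists>k>0. {\<alpha>. exp_conv f g \<alpha> \<noteq> 0} \<subseteq> exp_grid k"
    by (intro exI[of _ k] conjI exp_conv_support)
qed

instance
proof
  fix a b c :: "('a, 'b) fracps"
  show "a * b * c = a * (b * c)"
  proof (transfer, intro ext)
    fix f g h :: "('b \<Rightarrow> rat) \<Rightarrow> 'a" and \<alpha>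
    assume "\<exists>k>0. {\<alpha>. f \<alpha> \<noteq> 0} \<subseteq> exp_grid k" "\<exists>k>0. {\<alpha>. g \<alpha> \<noteq> 0} \<subseteq> exp_grid k"
      "\<exists>k>0. {\<alpha>. h \<alpha> \<noteq> 0} \<subseteq> exp_grid k"
    then obtain k where "k > 0" "{\<alpha>. f \<alpha> \<noteq> 0} \<subseteq> exp_grid k" "{\<alpha>. g \<alpha> \<noteq> 0} \<subseteq> exp_grid k"
      "{\<alpha>. h \<alpha> \<noteq> 0} \<subseteq> exp_grid k"
      by (rule common_grid3)
    then show "exp_conv (exp_conv f g) h \<alpha> = exp_conv f (exp_conv g h) \<alpha>"
      by (rule exp_conv_assoc)
  qed
  show "a * b = b * a"
    by transfer (auto simp: fun_eq_iff intro: exp_conv_commute)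
  show "1 * a = a"
    unfolding one_fracps_def by transfer (rule ext, simp only: order_refl simp_thms exp_conv_delta diff_zero)
  show "(a + b) * c = a * c + b * c"
  proof (transfer, intro ext)
    fix f g h :: "('b \<Rightarrow> rat) \<Rightarrow> 'a" and \<alpha>
    assume "\<exists>k>0. {\<alpha>. f \<alpha> \<noteq> 0} \<subseteq> exp_grid k" "\<exists>k>0. {\<alpha>. g \<alpha> \<noteq> 0} \<subseteq> exp_grid k"
      "\<exists>k>0. {\<alpha>. h \<alpha> \<noteq> 0} \<subseteq> exp_grid k"
    then obtain k where k: "k > 0" "{\<alpha>. f \<alpha> \<noteq> 0} \<subseteq> exp_grid k" "{\<alpha>. g \<alpha> \<noteq> 0} \<subseteq> exp_grid k"
      "{\<alpha>. h \<alpha> \<noteq> 0} \<subseteq> exp_grid k"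
      by (rule common_grid3)
    then have fg: "{\<alpha>. f \<alpha> + g \<alpha> \<noteq> 0} \<subseteq> exp_grid k"
      by (intro exp_add_support)
    show "exp_conv (\<lambda>\<alpha>. f \<alpha> + g \<alpha>) h \<alpha> = exp_conv f h \<alpha> + exp_conv g h \<alpha>"
      by (simp add: exp_conv_grid[OF k(1) fg k(4)] exp_conv_grid[OF k(1) k(2) k(4)]
          exp_conv_grid[OF k(1) k(3) k(4)] case_prod_unfold distrib_right sum.distrib)
  qed
  show "(0 :: ('a, 'b) fracps) \<noteq> 1"
    unfolding one_fracps_def by transfer (auto simp: fun_eq_iff)
qed

end

instance fracps :: (idom, finite) idom
proof
  fix a b :: "('a, 'b) fracps"
  assume "a \<noteq> 0" "b \<noteq> 0"
  then show "a * b \<noteq> 0"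
  proof transfer
    fix f g :: "('b \<Rightarrow> rat) \<Rightarrow> 'a"
    assume *: "\<exists>k>0. {\<alpha>. f \<alpha> \<noteq> 0} \<subseteq> exp_grid k" "\<exists>k>0. {\<alpha>. g \<alpha> \<noteq> 0} \<subseteq> exp_grid k"
      and nz: "f \<noteq> (\<lambda>_. 0)" "g \<noteq> (\<lambda>_. 0)"
    from * obtain k where k: "k > 0" "{\<alpha>. f \<alpha> \<noteq> 0} \<subseteq> exp_grid k" "{\<alpha>. g \<alpha> \<noteq> 0} \<subseteq> exp_grid k"
      by (rule common_grid2)
    have "{\<alpha>. f \<alpha> \<noteq> 0} \<noteq> {}" "{\<alpha>. g \<alpha> \<noteq> 0} \<noteq> {}" using nz by auto
    from unique_sum_exponents[OF k(1,2) this(1) k(3) this(2)] obtain \<alpha> \<beta>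
      where "\<alpha> \<in> {\<alpha>. f \<alpha> \<noteq> 0}" "\<beta> \<in> {\<alpha>. g \<alpha> \<noteq> 0}"
        and u: "\<forall>\<alpha>'\<in>{\<alpha>. f \<alpha> \<noteq> 0}. \<forall>\<beta>'\<in>{\<alpha>. g \<alpha> \<noteq> 0}. \<alpha>' + \<beta>' = \<alpha> + \<beta> \<longrightarrow> \<alpha>' = \<alpha> \<and> \<beta>' = \<beta>"
      by (elim bexE)
    then have ab: "f \<alpha> \<noteq> 0" "g \<beta> \<noteq> 0" by simp_all
    have uniq: "\<alpha>' = \<alpha> \<and> \<beta>' = \<beta>" if "f \<alpha>' \<noteq> 0" "g \<beta>' \<noteq> 0" "\<alpha>' + \<beta>' = \<alpha> + \<beta>" for \<alpha>' \<beta>'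
      using u that by blast
    have "{(\<beta>', \<gamma>). \<beta>' + \<gamma> = \<alpha> + \<beta> \<and> f \<beta>' \<noteq> 0 \<and> g \<gamma> \<noteq> 0} = {(\<alpha>, \<beta>)}"
      using ab uniq by blast
    then have "exp_conv f g (\<alpha> + \<beta>) = f \<alpha> * g \<beta>" by (simp add: exp_conv_def)
    with ab have "exp_conv f g (\<alpha> + \<beta>) \<noteq> 0" by simp
    then show "exp_conv f g \<noteq> (\<lambda>_. 0)" by auto
  qed
qed


section \<open>Formal power series in several variables\<close>

text \<open>
  The ring \<open>'a[[X\<^sub>1, \<dots>, X\<^sub>d]]\<close>, as the subring of series with exponents in \<open>\<nat>\<^sup>d\<close>; the embedding
  of rings is \<open>of_mps\<close>.
\<close>

typedef (overloaded) ('a :: comm_ring_1, 'd :: finite) mps =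
  "{f :: ('a, 'd) fracps. {\<alpha>. fracps_coeff f \<alpha> \<noteq> 0} \<subseteq> exp_grid 1}"
  morphisms of_mps Abs_mps
  by (rule exI[of _ 0]) (auto simp: zero_fracps.rep_eq)

setup_lifting type_definition_mps

instantiation mps :: (comm_ring_1, finite) comm_ring_1
begin

lift_definition zero_mps :: "('a, 'b) mps" is 0 by (auto simp: zero_fracps.rep_eq)

lift_definition one_mps :: "('a, 'b) mps" is 1
  by (auto simp: one_fracps_def fracps_X_pow.rep_eq exp_grid_zero)

lift_definition plus_mps :: "('a, 'b) mps \<Rightarrow> ('a, 'b) mps \<Rightarrow> ('a, 'b) mps" is "(+)"
  unfolding plus_fracps.rep_eq mem_Collect_eq by (rule exp_add_support)

lift_definition uminus_mps :: "('a, 'b) mps \<Rightarrow> ('a, 'b) mps" is uminus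
  by (auto simp: uminus_fracps.rep_eq)

lift_definition times_mps :: "('a, 'b) mps \<Rightarrow> ('a, 'b) mps \<Rightarrow> ('a, 'b) mps" is "(*)"
  unfolding times_fracps.rep_eq mem_Collect_eq by (rule exp_conv_support)

definition minus_mps :: "('a, 'b) mps \<Rightarrow> ('a, 'b) mps \<Rightarrow> ('a, 'b) mps" where
  "minus_mps f g = f + - g"

instance
proof
  fix a b c :: "('a, 'b) mps"
  show "a + b + c = a + (b + c)" by transfer (simp add: add.assoc)
  show "a + b = b + a" by transfer (simp add: add.commute)
  show "0 + a = a" by transfer simp
  show "- a + a = 0" by transfer simp
  show "a - b = a + - b" by (simp add: minus_mps_def)
  show "a * b * c = a * (b * c)" by transfer (simp add: mult.assoc)
  show "a * b = b * a" by transfer (simp add: mult.commute)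
  show "1 * a = a" by transfer simp
  show "(a + b) * c = a * c + b * c" by transfer (simp add: distrib_right)
  show "(0 :: ('a, 'b) mps) \<noteq> 1" by transfer simp
qed

end

instance mps :: (idom, finite) idom
  by standard (transfer, auto)

definition mps_coeff :: "('a :: comm_ring_1, 'd :: finite) mps \<Rightarrow> ('d \<Rightarrow> nat) \<Rightarrow> 'a" where
  "mps_coeff f m = fracps_coeff (of_mps f) (\<lambda>i. of_nat (m i))"

lift_definition mps_X_pow :: "('d :: finite \<Rightarrow> nat) \<Rightarrow> ('a :: comm_ring_1, 'd) mps"
  is "\<lambda>m. fracps_X_pow (\<lambda>i. of_nat (m i))"
  by (auto simp: fracps_X_pow.rep_eq exp_grid_def)


section \<open>Quasi-ordinary Weierstrass polynomials\<close>

definition weierstrass_poly :: "('a :: comm_ring_1, 'd :: finite) mps poly \<Rightarrow> bool" where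
  "weierstrass_poly f \<longleftrightarrow>
     degree f \<ge> 1 \<and> lead_coeff f = 1 \<and> (\<forall>i<degree f. mps_coeff (coeff f i) 0 = 0)"

text \<open>
  The usual formula for the discriminant divides by the leading coefficient, which is 1 here.
\<close>

definition monic_discriminant :: "'a :: idom poly \<Rightarrow> 'a" where
  "monic_discriminant f = (- 1) ^ (degree f * (degree f - 1) div 2) * resultant f (pderiv f)"

definition quasi_ordinary :: "('a :: idom, 'd :: finite) mps poly \<Rightarrow> bool" where
  "quasi_ordinary f \<longleftrightarrow>
     (\<exists>\<alpha> u. monic_discriminant f = mps_X_pow \<alpha> * u \<and> mps_coeff u 0 \<noteq> 0)"

definition Zer :: "('a :: idom, 'd :: finite) mps poly \<Rightarrow> ('a, 'd) fracps set" where
  "Zer f = {y. poly (map_poly of_mps f) y = 0}"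


section \<open>Contacts and tree models\<close>

text \<open>
  The value is meaningful only if \<open>y = z\<close> or \<open>y - z\<close> is a monomial times a series with nonzero
  constant term; the exponent is then unique. This is the case for the roots of a quasi-ordinary
  polynomial. The constructor \<open>Minf\<close> of \<open>extended\<close> plays no role.
\<close>

definition contact :: "('a :: idom, 'd :: finite) fracps \<Rightarrow> ('a, 'd) fracps \<Rightarrow> ('d \<Rightarrow> rat) extended" where
  "contact y z = (if y = z then Pinf else
     Fin (THE \<mu>. 0 \<le> \<mu> \<and> (\<exists>u. y - z = fracps_X_pow \<mu> * u \<and> fracps_coeff u 0 \<noteq> 0)))"

definition bar_height :: "('a :: idom, 'd :: finite) fracps set \<Rightarrow> ('d \<Rightarrow> rat) extended" where
  "bar_height B = (LEAST c. \<exists>y\<in>B. \<exists>z\<in>B. c = contact y z)"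

definition postbars :: "('a :: idom, 'd :: finite) fracps set \<Rightarrow> ('a, 'd) fracps set set" where
  "postbars B = (if bar_height B = Pinf then {}
     else B // {(y, z). y \<in> B \<and> z \<in> B \<and> contact y z > bar_height B})"

inductive_set tree_model :: "('a :: idom, 'd :: finite) mps poly \<Rightarrow> ('a, 'd) fracps set set"
  for f :: "('a, 'd) mps poly" where
  root: "Zer f \<in> tree_model f"
| postbar: "B \<in> tree_model f \<Longrightarrow> P \<in> postbars B \<Longrightarrow> P \<in> tree_model f"

text \<open>
  \<open>exp_lattice hs i\<close> is \<open>N\<^sub>i = \<int>\<^sup>d + \<int> h\<^sub>1 + \<dots> + \<int> h\<^sub>i\<close>. The list \<open>hs\<close> is indexed from 0, so
  \<open>h\<^sub>j\<close> is \<open>hs ! (j - 1)\<close>.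
\<close>

definition exp_lattice :: "('d \<Rightarrow> rat) list \<Rightarrow> nat \<Rightarrow> ('d \<Rightarrow> rat) set" where
  "exp_lattice hs i =
     {(\<lambda>l. of_int (z l) + (\<Sum>j<i. of_int (c j) * (hs ! j) l)) | (z :: 'd \<Rightarrow> int) (c :: nat \<Rightarrow> int). True}"

text \<open>The index of an additive subgroup \<open>M\<close> of \<open>N\<close>, as the number of cosets (0 if infinite).\<close>

definition add_index :: "'b :: ab_group_add set \<Rightarrow> 'b set \<Rightarrow> nat" where
  "add_index N M = card (N // {(x, y). x \<in> N \<and> y \<in> N \<and> x - y \<in> M})"

definition ext_height :: "('d \<Rightarrow> rat) list \<Rightarrow> nat \<Rightarrow> ('d \<Rightarrow> rat) extended" where
  "ext_height hs i = (if i < length hs then Fin (hs ! i) else Pinf)"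

definition tree_of_type :: "('a :: idom, 'd :: finite) fracps set set \<Rightarrow> ('d \<Rightarrow> rat) list \<Rightarrow> bool" where
  "tree_of_type T hs \<longleftrightarrow>
     (\<forall>h\<in>set hs. 0 \<le> h) \<and>
     bar_height ` T = ext_height hs ` {..length hs} \<and>
     (\<forall>i<length hs. \<forall>B\<in>T. bar_height B = ext_height hs i \<longrightarrow>
        card (postbars B) = add_index (exp_lattice hs (Suc i)) (exp_lattice hs i) \<and>
        (\<forall>P\<in>postbars B. bar_height P = ext_height hs (Suc i)))"

text \<open>
  For irreducible quasi-ordinary \<open>f\<close> the set of contacts with a fixed root does not depend on the
  root and is totally ordered; both properties are part of the condition.
\<close>

definition char_exponents :: "('a :: idom, 'd :: finite) mps poly \<Rightarrow> ('d \<Rightarrow> rat) list \<Rightarrow> bool" where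
  "char_exponents f hs \<longleftrightarrow> sorted_wrt (<) hs \<and>
     (\<forall>y\<in>Zer f. {contact z y | z. z \<in> Zer f \<and> z \<noteq> y} = Fin ` set hs)"

end

theory Submission
  imports Defs "HOL-Analysis.Continuum_Not_Denumerable" "Subresultants.Subresultant"
begin

hide_const (open) Module.smult

text \<open>
  The proof has two halves: first the roots of \<open>f\<close> are found among the fractional power series
  (the Abhyankar--Jung theorem), then a group of automorphisms is shown to permute them transitively.

  \<^bold>\<open>Finding the roots.\<close> Give the variables positive real weights \<open>w\<close> that are linearly independent
  over the rationals. Then \<open>X\<^sup>\<alpha> \<mapsto> t\<^sup>w\<^sup>\<cdot>\<^sup>\<alpha>\<close> embeds the fractional power series into the field of series in
  one variable \<open>t\<close> with real exponents and left-finite support. Newton polygons and Hensel's lemma show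
  that this field is algebraically closed, so \<open>f\<close> splits there; what has to be shown is that the
  exponents of a root \<open>y\<close> have the form \<open>w \<cdot> \<beta>\<close> with \<open>\<beta>\<close> in a fixed grid of nonnegative exponents.

  A rational linear functional \<open>d\<close> on the reals induces a derivation \<open>D\<close> of the field, which multiplies
  the coefficient at \<open>x\<close> by \<open>d x\<close>. It never enlarges supports, and on power series it is a logarithmic
  derivation. The discriminant \<open>\<delta>\<close> is a monomial \<open>X\<^sup>\<mu>\<close> times a unit, and being a resultant up to sign it
  has the form \<open>\<delta> = c f' + e f\<close>, where \<open>f'\<close> is the derivative of \<open>f\<close>; differentiating \<open>f(y) = 0\<close>
  therefore shows that \<open>\<delta> D y\<close> is a polynomial in \<open>y\<close>. By iteration, for each product \<open>P\<close> of operators \<open>D - k\<close> the element \<open>P y\<close> is a polynomial in \<open>y\<close> divided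
  by a power of \<open>\<delta>\<close>, and one polynomial serves all roots and all weights simultaneously.

  Let \<open>x\<close> be an exponent of some root. Choose \<open>P\<close> so that it kills the terms of order at most \<open>x\<close> in all
  roots, except those of order \<open>x\<close>. For some \<open>r \<le> degree f\<close> the sum of \<open>(P y)\<^sup>r\<close> over all
  roots \<open>y\<close> then has order exactly \<open>r x\<close>. This sum is a symmetric expression in the roots, hence
  equal to \<open>T / \<delta>\<^sup>N\<close> for a power series \<open>T\<close> that does not depend on the weights. So
  \<open>r x = w \<cdot> (m - N \<mu>)\<close> for an exponent \<open>m\<close> of \<open>T\<close>. Finally \<open>m \<ge> N \<mu>\<close>: the roots are integral, so for
  every choice of weights the sum has no negative exponents, and weights that make the \<open>j\<close>-th
  variable very heavy yield the inequality for the \<open>j\<close>-th coordinate. This is \<open>root_exponents\<close>;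
  its consequence \<open>card_Zer\<close> says that \<open>f\<close> has \<open>degree f\<close> roots.

  \<^bold>\<open>Transitivity.\<close> A character \<open>\<chi>\<close> of \<open>(1/k) \<int>\<^sup>d\<close> that is trivial on \<open>\<int>\<^sup>d\<close> acts by
  \<open>X\<^sup>\<alpha> \<mapsto> \<chi>(\<alpha>) X\<^sup>\<alpha>\<close> and permutes the roots. Suppose that the tree has type \<open>(h\<^sub>1, \<dots>, h\<^sub>g)\<close>. By induction
  along the tree, a character that is trivial on \<open>N\<^sub>i\<close> keeps each root inside its bar of height
  \<open>h\<^sub>i\<^sub>+\<^sub>1\<close>, so it fixes all terms that are not above \<open>h\<^sub>i\<^sub>+\<^sub>1\<close>; since characters separate points, the
  exponents of these terms lie in \<open>N\<^sub>i\<close> (\<open>support_below\<close>). The postbars of a bar of height \<open>h\<^sub>i\<close>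
  correspond to the values of the coefficient at \<open>h\<^sub>i\<close>. There are \<open>n = [N\<^sub>i : N\<^sub>i\<^sub>-\<^sub>1] \<ge> 2\<close> of them, and the
  characters trivial on \<open>N\<^sub>i\<^sub>-\<^sub>1\<close> multiply them by arbitrary \<open>n\<close>-th roots of unity; counting leaves
  room for one orbit only (\<open>coefficients_in_bar\<close>). Climbing the tree gives transitivity
  (\<open>galois_transitive\<close>), and \<open>f\<close> is irreducible because the roots of a factor form an invariant set.
  The characteristic exponents are the heights because the contacts of a fixed root with the others
  are the finite heights of the bars that contain it.
\<close>

section \<open>Series with real exponents and left-finite support\<close>

definition left_finite :: "(real \<Rightarrow> 'a :: zero) \<Rightarrow> bool" where
  "left_finite f \<longleftrightarrow> (\<forall>c. finite {x. x \<le> c \<and> f x \<noteq> 0})"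

lemma left_finiteD: "left_finite f \<Longrightarrow> finite {x. x \<le> c \<and> f x \<noteq> 0}"
  by (simp add: left_finite_def)

lemma left_finite_subset:
  assumes "left_finite g" "\<And>x. f x \<noteq> 0 \<Longrightarrow> g x \<noteq> 0"
  shows "left_finite f"
  unfolding left_finite_def
proof
  fix c
  show "finite {x. x \<le> c \<and> f x \<noteq> 0}"
    by (rule finite_subset[OF _ left_finiteD[OF assms(1), of c]]) (use assms(2) in auto)
qed

text \<open>
  The Levi-Civita field over \<open>'a\<close>. Real exponents leave room for rationally independent weights;
  left-finiteness makes the terms of a product finite sums and allows limits to be taken
  coefficientwise.
\<close>

typedef (overloaded) 'a lcs = "{f :: real \<Rightarrow> 'a :: zero. left_finite f}"
  morphisms lcs_coeff Abs_lcs
  by (rule exI[of _ "\<lambda>_. 0"]) (simp add: left_finite_def)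

setup_lifting type_definition_lcs

lemma lcs_eqI: "(\<And>x. lcs_coeff f x = lcs_coeff g x) \<Longrightarrow> f = g"
  by (metis ext lcs_coeff_inject)

lemma left_finite_bounded_below:
  assumes "left_finite f"
  shows "\<exists>L. \<forall>x. f x \<noteq> 0 \<longrightarrow> L \<le> x"
proof (cases "\<exists>x. f x \<noteq> 0")
  case True
  then obtain x0 where x0: "f x0 \<noteq> 0" by blast
  let ?A = "{x. x \<le> x0 \<and> f x \<noteq> 0}"
  have A: "finite ?A" "x0 \<in> ?A" using left_finiteD[OF assms] x0 by auto
  have "Min ?A \<le> x" if "f x \<noteq> 0" for x
  proof (cases "x \<le> x0")
    case True
    with that A show ?thesis by (intro Min_le) auto
  next
    case False
    then show ?thesis using Min_le[OF A] by linarith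
  qed
  then show ?thesis by blast
qed auto

definition real_conv :: "(real \<Rightarrow> 'a :: semiring_0) \<Rightarrow> (real \<Rightarrow> 'a) \<Rightarrow> real \<Rightarrow> 'a" where
  "real_conv f g z = (\<Sum>a | f a \<noteq> 0 \<and> g (z - a) \<noteq> 0. f a * g (z - a))"

lemma real_conv_left:
  assumes "finite A" "{a. f a \<noteq> 0 \<and> g (z - a) \<noteq> 0} \<subseteq> A"
  shows "real_conv f g z = (\<Sum>a\<in>A. f a * g (z - a))"
  unfolding real_conv_def using assms by (intro sum.mono_neutral_left) auto

lemma real_conv_right:
  assumes "finite C" "{c. f (z - c) \<noteq> 0 \<and> g c \<noteq> 0} \<subseteq> C"
  shows "real_conv f g z = (\<Sum>c\<in>C. f (z - c) * g c)"
proof -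
  have "real_conv f g z = (\<Sum>c | f (z - c) \<noteq> 0 \<and> g c \<noteq> 0. f (z - c) * g c)"
    unfolding real_conv_def
    by (rule sum.reindex_bij_witness[where i = "\<lambda>c. z - c" and j = "\<lambda>c. z - c"]) auto
  also have "\<dots> = (\<Sum>c\<in>C. f (z - c) * g c)"
    using assms by (intro sum.mono_neutral_left) auto
  finally show ?thesis .
qed

lemma real_conv_left_finite:
  assumes f: "left_finite f" and g: "left_finite g"
  shows "left_finite (real_conv f g)"
  unfolding left_finite_def
proof
  fix c
  from left_finite_bounded_below[OF f] obtain K where K: "\<And>x. f x \<noteq> 0 \<Longrightarrow> K \<le> x" by blast
  from left_finite_bounded_below[OF g] obtain L where L: "\<And>x. g x \<noteq> 0 \<Longrightarrow> L \<le> x" by blast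
  let ?A = "{x. x \<le> c - L \<and> f x \<noteq> 0}" and ?B = "{x. x \<le> c - K \<and> g x \<noteq> 0}"
  have "{x. x \<le> c \<and> real_conv f g x \<noteq> 0} \<subseteq> (\<lambda>(a, b). a + b) ` (?A \<times> ?B)"
  proof
    fix x assume x: "x \<in> {x. x \<le> c \<and> real_conv f g x \<noteq> 0}"
    then have "{a. f a \<noteq> 0 \<and> g (x - a) \<noteq> 0} \<noteq> {}" unfolding real_conv_def by force
    then obtain a where a: "f a \<noteq> 0" "g (x - a) \<noteq> 0" by blast
    with x K[OF a(1)] L[OF a(2)] show "x \<in> (\<lambda>(a, b). a + b) ` (?A \<times> ?B)"
      by (intro image_eqI[of _ _ "(a, x - a)"]) auto
  qed
  moreover have "finite ((\<lambda>(a, b). a + b) ` (?A \<times> ?B))" using left_finiteD[OF f] left_finiteD[OF g] by blast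
  ultimately show "finite {x. x \<le> c \<and> real_conv f g x \<noteq> 0}" by (rule finite_subset)
qed

lemma real_conv_assoc:
  fixes f g h :: "real \<Rightarrow> 'a :: semiring_0"
  assumes f: "left_finite f" and g: "left_finite g"
    and h: "left_finite h"
  shows "real_conv (real_conv f g) h z = real_conv f (real_conv g h) z"
proof -
  from left_finite_bounded_below[OF f] obtain F where F: "\<And>x. f x \<noteq> 0 \<Longrightarrow> F \<le> x" by blast
  from left_finite_bounded_below[OF g] obtain G where G: "\<And>x. g x \<noteq> 0 \<Longrightarrow> G \<le> x" by blast
  from left_finite_bounded_below[OF h] obtain H where H: "\<And>x. h x \<noteq> 0 \<Longrightarrow> H \<le> x" by blast
  let ?A = "{x. x \<le> z - G - H \<and> f x \<noteq> 0}" and ?C = "{x. x \<le> z - F - G \<and> h x \<noteq> 0}"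
  have fin: "finite ?A" "finite ?C" using left_finiteD[OF f] left_finiteD[OF h] by auto
  have bnd: "\<exists>a. f a \<noteq> 0 \<and> g (y - a) \<noteq> 0" if "real_conv f g y \<noteq> 0" for y
  proof -
    from that have "{a. f a \<noteq> 0 \<and> g (y - a) \<noteq> 0} \<noteq> {}" unfolding real_conv_def by force
    then show ?thesis by blast
  qed
  have bnd': "\<exists>a. g a \<noteq> 0 \<and> h (y - a) \<noteq> 0" if "real_conv g h y \<noteq> 0" for y
  proof -
    from that have "{a. g a \<noteq> 0 \<and> h (y - a) \<noteq> 0} \<noteq> {}" unfolding real_conv_def by force
    then show ?thesis by blast
  qed
  have "real_conv (real_conv f g) h z = (\<Sum>c\<in>?C. real_conv f g (z - c) * h c)"
  proof (rule real_conv_right[OF fin(2)], rule subsetI)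
    fix c assume "c \<in> {c. real_conv f g (z - c) \<noteq> 0 \<and> h c \<noteq> 0}"
    then have c: "real_conv f g (z - c) \<noteq> 0" "h c \<noteq> 0" by auto
    from bnd[OF c(1)] obtain a where "f a \<noteq> 0" "g (z - c - a) \<noteq> 0" by blast
    from F[OF this(1)] G[OF this(2)] c show "c \<in> ?C" by auto
  qed
  also have "\<dots> = (\<Sum>c\<in>?C. (\<Sum>a\<in>?A. f a * g (z - c - a)) * h c)"
  proof (rule sum.cong[OF refl], rule arg_cong[where f = "\<lambda>x. x * _"], rule real_conv_left[OF fin(1)], rule subsetI)
    fix c a assume c: "c \<in> ?C" and "a \<in> {a. f a \<noteq> 0 \<and> g (z - c - a) \<noteq> 0}"
    then have "f a \<noteq> 0" "g (z - c - a) \<noteq> 0" by auto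
    with G[OF this(2)] H[of c] c show "a \<in> ?A" by auto
  qed
  also have "\<dots> = (\<Sum>a\<in>?A. f a * (\<Sum>c\<in>?C. g (z - a - c) * h c))"
    unfolding sum_distrib_left sum_distrib_right
    by (subst sum.swap) (simp add: mult.assoc diff_diff_eq add.commute)
  also have "\<dots> = (\<Sum>a\<in>?A. f a * real_conv g h (z - a))"
  proof (rule sum.cong[OF refl], rule arg_cong[where f = "\<lambda>x. _ * x"], rule real_conv_right[OF fin(2), symmetric], rule subsetI)
    fix c a assume a: "a \<in> ?A" and "c \<in> {c. g (z - a - c) \<noteq> 0 \<and> h c \<noteq> 0}"
    then have "h c \<noteq> 0" "g (z - a - c) \<noteq> 0" by auto
    with G[OF this(2)] F[of a] a show "c \<in> ?C" by auto
  qed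
  also have "\<dots> = real_conv f (real_conv g h) z"
  proof (rule real_conv_left[OF fin(1), symmetric], rule subsetI)
    fix a assume "a \<in> {a. f a \<noteq> 0 \<and> real_conv g h (z - a) \<noteq> 0}"
    then have a: "f a \<noteq> 0" "real_conv g h (z - a) \<noteq> 0" by auto
    from bnd'[OF a(2)] obtain b where "g b \<noteq> 0" "h (z - a - b) \<noteq> 0" by blast
    from G[OF this(1)] H[OF this(2)] a show "a \<in> ?A" by auto
  qed
  finally show ?thesis .
qed

lemma left_finite_add:
  fixes f g :: "real \<Rightarrow> 'a :: monoid_add"
  assumes f: "left_finite f" and g: "left_finite g"
  shows "left_finite (\<lambda>x. f x + g x)"
  unfolding left_finite_def
proof
  fix c
  show "finite {x. x \<le> c \<and> f x + g x \<noteq> 0}"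
    by (rule finite_subset[OF _ finite_UnI[OF left_finiteD[OF f, of c] left_finiteD[OF g, of c]]]) auto
qed

lemma finite_conv_support:
  assumes f: "left_finite f" and g: "left_finite g"
  shows "finite {a. f a \<noteq> 0 \<and> g (z - a) \<noteq> 0}"
proof -
  from left_finite_bounded_below[OF g] obtain L where L: "\<And>x. g x \<noteq> 0 \<Longrightarrow> L \<le> x" by blast
  show ?thesis
    by (rule finite_subset[OF _ left_finiteD[OF f, of "z - L"]]) (use L in force)
qed

lift_definition lcs_monom :: "'a :: zero \<Rightarrow> real \<Rightarrow> 'a lcs" is "\<lambda>c x y. if y = x then c else 0"
  unfolding left_finite_def by (intro allI, rule finite_subset[of _ "{_}"]) (auto split: if_splits)

instantiation lcs :: (comm_ring_1) comm_ring_1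
begin

lift_definition zero_lcs :: "'a lcs" is "\<lambda>_. 0" by (simp add: left_finite_def)

definition one_lcs :: "'a lcs" where "one_lcs = lcs_monom 1 0"

lift_definition plus_lcs :: "'a lcs \<Rightarrow> 'a lcs \<Rightarrow> 'a lcs" is "\<lambda>f g x. f x + g x"
  by (rule left_finite_add)

lift_definition uminus_lcs :: "'a lcs \<Rightarrow> 'a lcs" is "\<lambda>f x. - f x"
  by (erule left_finite_subset) simp

definition minus_lcs :: "'a lcs \<Rightarrow> 'a lcs \<Rightarrow> 'a lcs" where "minus_lcs f g = f + - g"

lift_definition times_lcs :: "'a lcs \<Rightarrow> 'a lcs \<Rightarrow> 'a lcs" is real_conv
  by (rule real_conv_left_finite)

instance
proof
  fix a b c :: "'a lcs"
  show "a + b + c = a + (b + c)" by transfer (simp add: add.assoc)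
  show "a + b = b + a" by transfer (simp add: add.commute)
  show "0 + a = a" by transfer simp
  show "- a + a = 0" by transfer simp
  show "a - b = a + - b" by (simp add: minus_lcs_def)
  show "a * b * c = a * (b * c)" by transfer (auto simp: fun_eq_iff intro: real_conv_assoc)
  show "a * b = b * a"
  proof (transfer, intro ext)
    fix f g :: "real \<Rightarrow> 'a" and z
    assume f: "left_finite f" and g: "left_finite g"
    have "real_conv f g z = (\<Sum>c | g c \<noteq> 0 \<and> f (z - c) \<noteq> 0. f (z - c) * g c)"
      by (rule real_conv_right[OF finite_conv_support[OF g f, of z]]) blast
    then show "real_conv f g z = real_conv g f z"
      unfolding real_conv_def by (simp only: mult.commute)
  qed
  show "1 * a = a"
    unfolding one_lcs_def
  proof (transfer, intro ext)
    fix f :: "real \<Rightarrow> 'a" and z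
    show "real_conv (\<lambda>y. if y = 0 then 1 else 0) f z = f z"
      by (subst real_conv_left[of "{0}"]) auto
  qed
  show "(a + b) * c = a * c + b * c"
  proof (transfer, intro ext)
    fix f g h :: "real \<Rightarrow> 'a" and z
    assume f: "left_finite f" and g: "left_finite g"
      and h: "left_finite h"
    let ?A = "{a. f a \<noteq> 0 \<and> h (z - a) \<noteq> 0} \<union> {a. g a \<noteq> 0 \<and> h (z - a) \<noteq> 0}"
    have A: "finite ?A" using finite_conv_support[OF f h] finite_conv_support[OF g h] by blast
    have "real_conv (\<lambda>x. f x + g x) h z = (\<Sum>a\<in>?A. (f a + g a) * h (z - a))"
      using A by (intro real_conv_left) auto
    moreover have "real_conv f h z = (\<Sum>a\<in>?A. f a * h (z - a))"
      using A by (intro real_conv_left) auto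
    moreover have "real_conv g h z = (\<Sum>a\<in>?A. g a * h (z - a))"
      using A by (intro real_conv_left) auto
    ultimately show "real_conv (\<lambda>x. f x + g x) h z = real_conv f h z + real_conv g h z"
      by (simp add: distrib_right sum.distrib)
  qed
  show "(0 :: 'a lcs) \<noteq> 1"
    unfolding one_lcs_def by transfer (auto simp: fun_eq_iff)
qed

end

lemma lcs_coeff_0 [simp]: "lcs_coeff 0 x = 0" by (simp add: zero_lcs.rep_eq)
lemma lcs_coeff_add [simp]: "lcs_coeff (f + g) x = lcs_coeff f x + lcs_coeff g x"
  by (simp add: plus_lcs.rep_eq)
lemma lcs_coeff_uminus [simp]: "lcs_coeff (- f) x = - lcs_coeff f x"
  by (simp add: uminus_lcs.rep_eq)
lemma lcs_coeff_diff [simp]: "lcs_coeff (f - g) x = lcs_coeff f x - lcs_coeff g x"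
  by (simp only: minus_lcs_def lcs_coeff_add lcs_coeff_uminus) simp
lemma lcs_coeff_sum [simp]: "lcs_coeff (\<Sum>i\<in>A. f i) x = (\<Sum>i\<in>A. lcs_coeff (f i) x)"
  by (induction A rule: infinite_finite_induct) auto
lemma lcs_coeff_monom: "lcs_coeff (lcs_monom c x) y = (if y = x then c else 0)"
  by (simp add: lcs_monom.rep_eq)

lemma lcs_coeff_one: "lcs_coeff 1 y = (if y = 0 then 1 else 0)"
  by (simp add: one_lcs_def lcs_coeff_monom)

lemma lcs_monom_0 [simp]: "lcs_monom 0 x = 0"
  by (rule lcs_eqI) (simp add: lcs_coeff_monom)

lemma lcs_coeff_monom_mult: "lcs_coeff (lcs_monom c x * f) y = c * lcs_coeff f (y - x)"
proof -
  have "real_conv (lcs_coeff (lcs_monom c x)) (lcs_coeff f) y = c * lcs_coeff f (y - x)"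
    by (subst real_conv_left[of "{x}"]) (auto simp: lcs_coeff_monom)
  then show ?thesis by (simp add: times_lcs.rep_eq)
qed

lemma lcs_monom_mult: "lcs_monom c x * lcs_monom d y = lcs_monom (c * d) (x + y)"
  by (rule lcs_eqI) (auto simp: lcs_coeff_monom_mult lcs_coeff_monom)

lemma lcs_monom_power: "lcs_monom c x ^ n = lcs_monom (c ^ n) (of_nat n * x)"
  by (induction n) (simp_all add: one_lcs_def lcs_monom_mult algebra_simps)

text \<open>
  \<open>supp_ge x f\<close> says that the valuation of \<open>f\<close> is at least \<open>x\<close>; in this form the zero series needs no
  separate treatment.
\<close>

definition supp_ge :: "real \<Rightarrow> 'a :: zero lcs \<Rightarrow> bool" where
  "supp_ge x f \<longleftrightarrow> (\<forall>z<x. lcs_coeff f z = 0)"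

lemma supp_geD: "supp_ge x f \<Longrightarrow> z < x \<Longrightarrow> lcs_coeff f z = 0"
  by (simp add: supp_ge_def)

lemma supp_ge_mono: "supp_ge x f \<Longrightarrow> y \<le> x \<Longrightarrow> supp_ge y f"
  by (auto simp: supp_ge_def)

lemma supp_ge_0 [simp]: "supp_ge x 0" by (simp add: supp_ge_def zero_lcs.rep_eq)

lemma supp_ge_add: "supp_ge x f \<Longrightarrow> supp_ge x g \<Longrightarrow> supp_ge x (f + g)"
  by (simp add: supp_ge_def)

lemma supp_ge_uminus: "supp_ge x f \<Longrightarrow> supp_ge x (- f)"
  by (simp add: supp_ge_def)

lemma supp_ge_diff: "supp_ge x f \<Longrightarrow> supp_ge x g \<Longrightarrow> supp_ge x (f - g)"
  by (simp add: supp_ge_def)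

lemma supp_ge_sum: "(\<And>i. i \<in> A \<Longrightarrow> supp_ge x (f i)) \<Longrightarrow> supp_ge x (\<Sum>i\<in>A. f i)"
  by (simp add: supp_ge_def)

lemma supp_ge_monom: "x \<le> y \<Longrightarrow> supp_ge x (lcs_monom c y)"
  by (auto simp: supp_ge_def lcs_coeff_monom)

lemma supp_ge_one: "supp_ge 0 1"
  unfolding one_lcs_def by (rule supp_ge_monom) simp

lemma lcs_coeff_mult_lowest:
  assumes "supp_ge x f" "supp_ge y g"
  shows "lcs_coeff (f * g) (x + y) = lcs_coeff f x * lcs_coeff g y"
proof -
  have "a = x" if "lcs_coeff f a \<noteq> 0" "lcs_coeff g (x + y - a) \<noteq> 0" for a
  proof -
    have "\<not> a < x" "\<not> x + y - a < y" using that supp_geD[OF assms(1)] supp_geD[OF assms(2)] by blast+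
    then show ?thesis by linarith
  qed
  then have "real_conv (lcs_coeff f) (lcs_coeff g) (x + y) = (\<Sum>a\<in>{x}. lcs_coeff f a * lcs_coeff g (x + y - a))"
    by (intro real_conv_left) auto
  then show ?thesis by (simp add: times_lcs.rep_eq)
qed

lemma supp_ge_mult:
  assumes "supp_ge x f" "supp_ge y g"
  shows "supp_ge (x + y) (f * g)"
  unfolding supp_ge_def
proof (intro allI impI)
  fix z assume z: "z < x + y"
  have "False" if "lcs_coeff f a \<noteq> 0" "lcs_coeff g (z - a) \<noteq> 0" for a
  proof -
    have "\<not> a < x" "\<not> z - a < y" using that supp_geD[OF assms(1)] supp_geD[OF assms(2)] by blast+
    then show ?thesis using z by linarith
  qed
  then have "real_conv (lcs_coeff f) (lcs_coeff g) z = (\<Sum>a\<in>{}. lcs_coeff f a * lcs_coeff g (z - a))"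
    by (intro real_conv_left) auto
  then show "lcs_coeff (f * g) z = 0" by (simp add: times_lcs.rep_eq)
qed

lemma supp_ge_mult_left: "supp_ge x f \<Longrightarrow> supp_ge 0 g \<Longrightarrow> supp_ge x (f * g)"
  using supp_ge_mult[of x f 0 g] by simp

lemma supp_ge_mult_right: "supp_ge 0 f \<Longrightarrow> supp_ge x g \<Longrightarrow> supp_ge x (f * g)"
  using supp_ge_mult[of 0 f x g] by simp

lemma supp_ge_power:
  assumes "supp_ge x f"
  shows "supp_ge (of_nat n * x) (f ^ n)" "lcs_coeff (f ^ n) (of_nat n * x) = lcs_coeff f x ^ n"
proof -
  have "supp_ge (of_nat n * x) (f ^ n) \<and> lcs_coeff (f ^ n) (of_nat n * x) = lcs_coeff f x ^ n"
  proof (induction n)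
    case 0
    then show ?case by (simp add: supp_ge_one lcs_coeff_one)
  next
    case (Suc n)
    then show ?case
      using supp_ge_mult[OF assms, of "of_nat n * x" "f ^ n"]
        lcs_coeff_mult_lowest[OF assms, of "of_nat n * x" "f ^ n"]
      by (simp add: algebra_simps)
  qed
  then show "supp_ge (of_nat n * x) (f ^ n)" "lcs_coeff (f ^ n) (of_nat n * x) = lcs_coeff f x ^ n"
    by auto
qed

lemma supp_ge_obtain_lowest:
  fixes f :: "'a :: comm_ring_1 lcs"
  assumes "f \<noteq> 0"
  obtains x where "supp_ge x f" "lcs_coeff f x \<noteq> 0"
proof -
  from assms obtain x0 where x0: "lcs_coeff f x0 \<noteq> 0" using lcs_eqI[of f 0] by auto
  let ?A = "{x. x \<le> x0 \<and> lcs_coeff f x \<noteq> 0}"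
  have A: "finite ?A" "x0 \<in> ?A" using left_finiteD[of "lcs_coeff f"] lcs_coeff[of f] x0 by auto
  then have m: "Min ?A \<in> ?A" by (intro Min_in) auto
  have "supp_ge (Min ?A) f"
    unfolding supp_ge_def
  proof (intro allI impI, rule ccontr)
    fix z assume z: "z < Min ?A" "lcs_coeff f z \<noteq> 0"
    have "Min ?A \<le> x0" by (rule Min_le[OF A])
    with z have "z \<in> ?A" by simp
    from Min_le[OF A(1) this] z show False by simp
  qed
  with m show ?thesis by (intro that) auto
qed

lemma supp_ge_arbitrary_imp_0:
  fixes f :: "'a :: comm_ring_1 lcs"
  assumes "\<epsilon> > 0" "\<And>n. supp_ge (of_nat n * \<epsilon>) f"
  shows "f = 0"
proof (rule ccontr)
  assume "f \<noteq> 0"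
  then obtain x where x: "lcs_coeff f x \<noteq> 0" using lcs_eqI[of f 0] by auto
  obtain n where "x < of_nat n * \<epsilon>" using reals_Archimedean3[OF assms(1)] by blast
  with assms(2)[of n] x show False by (auto dest: supp_geD)
qed

lemma supp_ge_gap:
  fixes f :: "'a :: comm_ring_1 lcs"
  assumes "supp_ge 0 f" "lcs_coeff f 0 = 0"
  obtains \<epsilon> where "\<epsilon> > 0" "supp_ge \<epsilon> f"
proof (cases "f = 0")
  case False
  then obtain x where x: "supp_ge x f" "lcs_coeff f x \<noteq> 0" by (rule supp_ge_obtain_lowest)
  have "x > 0" using assms x by (metis linorder_neqE_linordered_idom supp_geD)
  with x that show ?thesis by blast
qed (use that[of 1] in auto)

text \<open>
  Completeness: a sequence whose increments have supports moving to infinity at a linear rate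
  converges coefficientwise.
\<close>

lemma lcs_limit:
  fixes g :: "nat \<Rightarrow> 'a :: comm_ring_1 lcs"
  assumes "\<epsilon> > 0" "\<And>n. supp_ge (of_nat n * \<epsilon>) (g (Suc n) - g n)"
  obtains l where "\<And>n. supp_ge (of_nat n * \<epsilon>) (l - g n)"
proof -
  have step: "supp_ge (of_nat n * \<epsilon>) (g m - g n)" if "n \<le> m" for m n
    using that
  proof (induction m rule: dec_induct)
    case (step m)
    have "supp_ge (of_nat n * \<epsilon>) (g (Suc m) - g m)"
      by (rule supp_ge_mono[OF assms(2)]) (use step assms(1) in auto)
    from supp_ge_add[OF this step.IH] show ?case by simp
  qed simp
  \<comment> \<open>From the index \<open>N x\<close> on, the coefficient at \<open>x\<close> has stabilised.\<close>
  define N where "N x = nat \<lceil>x / \<epsilon>\<rceil> + 1" for x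
  have N: "x < of_nat (N x) * \<epsilon>" for x
  proof -
    have "x / \<epsilon> < of_nat (N x)" unfolding N_def by linarith
    with assms(1) show ?thesis by (simp add: field_simps)
  qed
  have N_mono: "N x \<le> N y" if "x \<le> y" for x y
    unfolding N_def using that assms(1) by (intro add_right_mono nat_mono ceiling_mono divide_right_mono) auto
  define c where "c x = lcs_coeff (g (N x)) x" for x
  have c: "c x = lcs_coeff (g m) x" if "x < of_nat m * \<epsilon>" for x m
  proof (cases "N x \<le> m")
    case True
    from supp_geD[OF step[OF True] N] show ?thesis by (simp add: c_def)
  next
    case False
    then have "m \<le> N x" by simp
    from supp_geD[OF step[OF this] that] show ?thesis by (simp add: c_def)
  qed
  have fin: "left_finite c"
    unfolding left_finite_def
  proof
    fix b
    have "{x. x \<le> b \<and> c x \<noteq> 0} \<subseteq> {x. x \<le> b \<and> lcs_coeff (g (N b)) x \<noteq> 0}"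
    proof (rule subsetI)
      fix x assume x: "x \<in> {x. x \<le> b \<and> c x \<noteq> 0}"
      then have "x < of_nat (N b) * \<epsilon>" using N[of b] by auto
      with c[OF this] x show "x \<in> {x. x \<le> b \<and> lcs_coeff (g (N b)) x \<noteq> 0}" by auto
    qed
    moreover have "finite {x. x \<le> b \<and> lcs_coeff (g (N b)) x \<noteq> 0}"
      using lcs_coeff[of "g (N b)"] by (simp add: left_finiteD)
    ultimately show "finite {x. x \<le> b \<and> c x \<noteq> 0}"
      by (rule finite_subset)
  qed
  define l where "l = Abs_lcs c"
  have l: "lcs_coeff l x = c x" for x
    unfolding l_def using fin by (subst Abs_lcs_inverse) auto
  have "supp_ge (of_nat n * \<epsilon>) (l - g n)" for n
    unfolding supp_ge_def using c by (auto simp: l)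
  then show ?thesis by (rule that)
qed

text \<open>
  The geometric series converges.
\<close>

lemma lcs_one_minus_unit:
  fixes u :: "'a :: comm_ring_1 lcs"
  assumes "\<epsilon> > 0" "supp_ge \<epsilon> u"
  shows "\<exists>v. (1 - u) * v = 1"
proof -
  define g where "g n = (\<Sum>i<n. u ^ i)" for n
  have pow: "supp_ge (of_nat n * \<epsilon>) (u ^ n)" for n
    by (rule supp_ge_power(1)[OF assms(2)])
  have "supp_ge (of_nat n * \<epsilon>) (g (Suc n) - g n)" for n
    using pow by (simp add: g_def)
  from lcs_limit[of \<epsilon> g, OF assms(1) this] obtain l where l: "\<And>n. supp_ge (of_nat n * \<epsilon>) (l - g n)"
    by blast
  have "supp_ge 0 u" using assms by (meson less_imp_le supp_ge_mono)
  then have u: "supp_ge 0 (1 - u)" by (intro supp_ge_diff supp_ge_one)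
  have "(1 - u) * l - 1 = 0"
  proof (rule supp_ge_arbitrary_imp_0[OF assms(1)])
    fix n
    have "(1 - u) * l - 1 = (1 - u) * (l - g n) - u ^ n"
      unfolding g_def using one_diff_power_eq[of u n] by (simp add: algebra_simps)
    moreover have "supp_ge (of_nat n * \<epsilon>) ((1 - u) * (l - g n) - u ^ n)"
      by (intro supp_ge_diff pow supp_ge_mult_right u l)
    ultimately show "supp_ge (of_nat n * \<epsilon>) ((1 - u) * l - 1)" by simp
  qed
  then show ?thesis by (intro exI[of _ l]) simp
qed

text \<open>
  Dividing by the lowest term reduces to the geometric series.
\<close>

lemma lcs_inverse_exists:
  fixes f :: "'a :: field lcs"
  assumes "f \<noteq> 0"
  shows "\<exists>g. f * g = 1"
proof -
  from assms obtain x where x: "supp_ge x f" "lcs_coeff f x \<noteq> 0" by (rule supp_ge_obtain_lowest)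
  define m where "m = lcs_monom (inverse (lcs_coeff f x)) (- x)"
  define u where "u = 1 - m * f"
  have "supp_ge 0 (m * f)"
    unfolding m_def using x(1) by (auto simp: supp_ge_def lcs_coeff_monom_mult)
  then have "supp_ge 0 u" unfolding u_def by (intro supp_ge_diff supp_ge_one)
  moreover have "lcs_coeff u 0 = 0"
    using x(2) by (simp add: u_def m_def lcs_coeff_monom_mult lcs_coeff_one)
  ultimately obtain \<epsilon> where "\<epsilon> > 0" "supp_ge \<epsilon> u" by (rule supp_ge_gap)
  from lcs_one_minus_unit[OF this] obtain v where "(1 - u) * v = 1" by blast
  then have "m * f * v = 1" by (simp add: u_def)
  then have "f * (m * v) = 1" by (simp only: mult_ac)
  then show ?thesis ..
qed

instantiation lcs :: (field) field
begin

definition inverse_lcs :: "'a lcs \<Rightarrow> 'a lcs" where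
  "inverse_lcs f = (if f = 0 then 0 else (SOME g. f * g = 1))"

definition divide_lcs :: "'a lcs \<Rightarrow> 'a lcs \<Rightarrow> 'a lcs" where
  "divide_lcs f g = f * inverse g"

instance
proof
  fix f g :: "'a lcs"
  show "inverse f * f = 1" if "f \<noteq> 0"
    using someI_ex[OF lcs_inverse_exists[OF that]] that by (simp add: inverse_lcs_def mult.commute)
  show "f div g = f * inverse g" by (simp add: divide_lcs_def)
  show "inverse (0 :: 'a lcs) = 0" by (simp add: inverse_lcs_def)
qed

end

instance lcs :: (field_char_0) field_char_0
proof
  have "lcs_coeff (of_nat n :: 'a lcs) 0 = of_nat n" for n
    by (induction n) (simp_all add: lcs_coeff_one)
  then show "inj (of_nat :: nat \<Rightarrow> 'a lcs)"
    by (metis injI of_nat_eq_iff)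
qed

section \<open>Hensel factorisation and algebraic closedness\<close>

definition coeffs_ge :: "real \<Rightarrow> 'a :: comm_ring_1 lcs poly \<Rightarrow> bool" where
  "coeffs_ge x p \<longleftrightarrow> (\<forall>i. supp_ge x (coeff p i))"

lemma coeffs_geD: "coeffs_ge x p \<Longrightarrow> supp_ge x (coeff p i)"
  by (simp add: coeffs_ge_def)

lemma coeffs_ge_mono: "coeffs_ge x p \<Longrightarrow> y \<le> x \<Longrightarrow> coeffs_ge y p"
  by (auto simp: coeffs_ge_def intro: supp_ge_mono)

lemma coeffs_ge_0 [simp]: "coeffs_ge x 0"
  by (simp add: coeffs_ge_def)

lemma coeffs_ge_add: "coeffs_ge x p \<Longrightarrow> coeffs_ge x q \<Longrightarrow> coeffs_ge x (p + q)"
  by (simp add: coeffs_ge_def supp_ge_add)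

lemma coeffs_ge_diff: "coeffs_ge x p \<Longrightarrow> coeffs_ge x q \<Longrightarrow> coeffs_ge x (p - q)"
  for p q :: "'a :: comm_ring_1 lcs poly"
  by (simp add: coeffs_ge_def supp_ge_diff)

lemma coeffs_ge_uminus: "coeffs_ge x p \<Longrightarrow> coeffs_ge x (- p)"
  for p :: "'a :: comm_ring_1 lcs poly"
  by (simp add: coeffs_ge_def supp_ge_uminus)

lemma coeffs_ge_mult:
  fixes p q :: "'a :: comm_ring_1 lcs poly"
  assumes "coeffs_ge x p" "coeffs_ge y q"
  shows "coeffs_ge (x + y) (p * q)"
  using assms unfolding coeffs_ge_def coeff_mult
  by (intro allI supp_ge_sum supp_ge_mult) auto

lemma coeffs_ge_mult_left: "coeffs_ge x p \<Longrightarrow> coeffs_ge 0 q \<Longrightarrow> coeffs_ge x (p * q)"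
  for p q :: "'a :: comm_ring_1 lcs poly"
  using coeffs_ge_mult[of x p 0 q] by simp

lemma coeffs_ge_mult_right: "coeffs_ge 0 p \<Longrightarrow> coeffs_ge x q \<Longrightarrow> coeffs_ge x (p * q)"
  for p q :: "'a :: comm_ring_1 lcs poly"
  using coeffs_ge_mult[of 0 p x q] by simp

lemma coeffs_ge_arbitrary_imp_0:
  fixes p :: "'a :: comm_ring_1 lcs poly"
  assumes "\<epsilon> > 0" "\<And>n. coeffs_ge (of_nat n * \<epsilon>) p"
  shows "p = 0"
proof (rule poly_eqI)
  fix i
  show "coeff p i = coeff 0 i"
    using supp_ge_arbitrary_imp_0[OF assms(1), of "coeff p i"] assms(2) by (simp add: coeffs_ge_def)
qed

text \<open>
  Division by a monic polynomial subtracts multiples by coefficients only, so it preserves lower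
  bounds for the coefficients.
\<close>

lemma coeffs_ge_div_mod:
  fixes p q :: "'a :: field lcs poly"
  assumes q: "lead_coeff q = 1" "coeffs_ge 0 q" and p: "coeffs_ge x p"
  shows "coeffs_ge x (p mod q) \<and> coeffs_ge x (p div q)"
  using p
proof (induction "if p = 0 then 0 else Suc (degree p)" arbitrary: p rule: less_induct)
  case less
  have q0: "q \<noteq> 0" using q by auto
  show ?case
  proof (cases "p = 0 \<or> degree p < degree q")
    case True
    then show ?thesis using less.prems by (auto simp: mod_poly_less div_poly_less)
  next
    case False
    define m where "m = monom (lead_coeff p) (degree p - degree q)"
    define p' where "p' = p - m * q"
    have m0: "m \<noteq> 0" using False by (simp add: m_def)
    have dm: "degree (m * q) = degree p"
      using False q0 m0 by (simp add: degree_mult_eq) (simp add: m_def degree_monom_eq)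
    have "coeff (m * q) (degree p) = lead_coeff m * lead_coeff q"
      unfolding dm[symmetric] by (rule lead_coeff_mult)
    then have "coeff p' (degree p) = 0"
      using q False by (simp add: p'_def) (simp add: m_def degree_monom_eq)
    moreover have "degree p' \<le> degree p"
      unfolding p'_def by (rule degree_diff_le) (simp_all add: dm)
    ultimately have small: "p' = 0 \<or> degree p' < degree p" by (intro eq_zero_or_degree_less)
    have "coeffs_ge x m"
      using less.prems by (simp add: coeffs_ge_def m_def coeff_monom)
    moreover from this have "coeffs_ge x p'"
      unfolding p'_def using q less.prems by (intro coeffs_ge_diff coeffs_ge_mult_left)
    then have "coeffs_ge x (p' mod q) \<and> coeffs_ge x (p' div q)"
      using small False by (intro less.hyps) auto
    moreover have "p = p' + m * q" by (simp add: p'_def)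
    then have "p mod q = p' mod q" "p div q = m + p' div q"
      using q0 by simp_all
    ultimately show ?thesis by (simp add: coeffs_ge_add)
  qed
qed

definition lcs_const :: "'a :: zero \<Rightarrow> 'a lcs" where "lcs_const c = lcs_monom c 0"

lemma lcs_coeff_const: "lcs_coeff (lcs_const c) x = (if x = 0 then c else 0)"
  by (simp add: lcs_const_def lcs_coeff_monom)

lemma supp_ge_const: "supp_ge 0 (lcs_const c)"
  by (simp add: supp_ge_def lcs_coeff_const)

interpretation lcs_const: inj_comm_ring_hom "lcs_const :: 'a :: comm_ring_1 \<Rightarrow> 'a lcs"
proof
  fix x y :: 'a
  show "lcs_const 0 = (0 :: 'a lcs)" "lcs_const 1 = (1 :: 'a lcs)"
    by (simp_all add: lcs_const_def one_lcs_def)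
  show "lcs_const (x + y) = lcs_const x + lcs_const y"
    by (rule lcs_eqI) (simp add: lcs_coeff_const)
  show "lcs_const (x * y) = lcs_const x * lcs_const y"
    by (simp add: lcs_const_def lcs_monom_mult)
  show "x = 0" if "lcs_const x = 0"
    using arg_cong[OF that, of "\<lambda>f. lcs_coeff f 0"] by (simp add: lcs_coeff_const)
qed

interpretation lcs_const_poly: map_poly_inj_comm_ring_hom "lcs_const :: 'a :: comm_ring_1 \<Rightarrow> 'a lcs" ..

lemma coeffs_ge_const: "coeffs_ge 0 (map_poly lcs_const p)"
  for p :: "'a :: comm_ring_1 poly"
  by (simp add: coeffs_ge_def coeff_map_poly supp_ge_const)

lemma coeffs_ge_gap:
  fixes p :: "'a :: comm_ring_1 lcs poly"
  assumes "coeffs_ge 0 p" "\<And>i. lcs_coeff (coeff p i) 0 = 0"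
  obtains \<epsilon> where "\<epsilon> > 0" "coeffs_ge \<epsilon> p"
proof -
  have "\<exists>\<epsilon>>0. supp_ge \<epsilon> (coeff p i)" for i
    using supp_ge_gap[OF coeffs_geD[OF assms(1)] assms(2)] by metis
  then obtain e where e: "\<And>i. e i > 0" "\<And>i. supp_ge (e i) (coeff p i)" by metis
  define \<epsilon> where "\<epsilon> = Min (e ` {..degree p})"
  have "\<epsilon> > 0" using e by (simp add: \<epsilon>_def)
  moreover have "supp_ge \<epsilon> (coeff p i)" for i
  proof (cases "i \<le> degree p")
    case True
    then have "\<epsilon> \<le> e i" by (simp add: \<epsilon>_def)
    with e show ?thesis by (meson supp_ge_mono)
  qed (simp add: coeff_eq_0)
  ultimately show ?thesis by (intro that) (auto simp: coeffs_ge_def)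
qed

lemma monic_add_lower:
  fixes p a :: "'a :: comm_ring_1 poly"
  assumes "lead_coeff p = 1" "\<And>i. i \<ge> degree p \<Longrightarrow> coeff a i = 0"
  shows "degree (p + a) = degree p" "lead_coeff (p + a) = 1"
proof -
  have "degree (p + a) \<le> degree p"
    by (rule degree_le) (use assms in \<open>auto simp: coeff_eq_0\<close>)
  moreover have "coeff (p + a) (degree p) = 1" using assms by simp
  ultimately show "degree (p + a) = degree p" "lead_coeff (p + a) = 1"
    using le_degree[of "p + a" "degree p"] by (auto simp: antisym)
qed

text \<open>
  The linearised problem of Hensel's lemma: a Bezout relation splits the error \<open>R\<close> of an approximate
  factorisation into corrections of the two factors. Reducing \<open>R b\<^sub>1\<close> modulo \<open>q\<^sub>1\<close> keeps the correction
  of the first factor below its leading term, and the degree of \<open>R\<close> then forces the same for the second.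
\<close>

lemma hensel_step:
  fixes A B R q1 q2 b1 b2 :: "'a :: field lcs poly"
  assumes q1: "lead_coeff q1 = 1" "coeffs_ge 0 q1" and q2: "lead_coeff q2 = 1" "coeffs_ge 0 q2"
    and b: "b1 * q2 + b2 * q1 = 1" "coeffs_ge 0 b1" "coeffs_ge 0 b2"
    and R: "coeffs_ge x R" "\<And>i. i \<ge> degree q1 + degree q2 \<Longrightarrow> coeff R i = 0"
  obtains s1 s2 where "s1 * q2 + s2 * q1 = R" "coeffs_ge x s1" "coeffs_ge x s2"
    "\<And>i. i \<ge> degree q1 \<Longrightarrow> coeff s1 i = 0" "\<And>i. i \<ge> degree q2 \<Longrightarrow> coeff s2 i = 0"
proof -
  define s1 where "s1 = (R * b1) mod q1"
  define s2 where "s2 = R * b2 + ((R * b1) div q1) * q2"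
  have nz: "q1 \<noteq> 0" "q2 \<noteq> 0" using q1 q2 by auto
  have Rb: "coeffs_ge x (R * b1)" by (rule coeffs_ge_mult_left[OF R(1) b(2)])
  have s1eq: "s1 = R * b1 - (R * b1) div q1 * q1"
    unfolding s1_def by (simp add: minus_div_mult_eq_mod)
  have "s1 * q2 + s2 * q1 = R * (b1 * q2 + b2 * q1)"
    unfolding s1eq s2_def by (simp add: algebra_simps)
  with b have eq: "s1 * q2 + s2 * q1 = R" by simp
  have ge: "coeffs_ge x s1" "coeffs_ge x s2"
    unfolding s1_def s2_def using coeffs_ge_div_mod[OF q1 Rb] R b q2
    by (auto intro!: coeffs_ge_add coeffs_ge_mult_left)
  have d1: "coeff s1 i = 0" if "i \<ge> degree q1" for i
    using degree_mod_less[OF nz(1), of "R * b1"] that unfolding s1_def[symmetric]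
    by (auto simp: coeff_eq_0)
  have d2: "coeff s2 i = 0" if "i \<ge> degree q2" for i
  proof (cases "s2 = 0")
    case False
    have "coeff (s1 * q2) i = 0" if "i \<ge> degree q1 + degree q2" for i
    proof (cases "s1 = 0")
      case False
      then have "degree s1 < degree q1" using degree_mod_less[OF nz(1), of "R * b1"] by (simp add: s1_def)
      then have "degree (s1 * q2) < degree q1 + degree q2" using False nz by (simp add: degree_mult_eq)
      then show ?thesis using that by (intro coeff_eq_0) simp
    qed simp
    with R(2) have z: "coeff (s2 * q1) i = 0" if "i \<ge> degree q1 + degree q2" for i
      using that arg_cong[OF eq, of "\<lambda>p. coeff p i"] by simp
    have "degree (s2 * q1) = degree s2 + degree q1" using False nz by (simp add: degree_mult_eq)
    moreover have "coeff (s2 * q1) (degree (s2 * q1)) \<noteq> 0" using False nz by simp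
    ultimately have "degree s2 < degree q2" using z[of "degree s2 + degree q1"] by (metis add.commute add_le_cancel_left not_le)
    then show ?thesis using that by (intro coeff_eq_0) simp
  qed simp
  from that[OF eq ge d1 d2] show ?thesis .
qed

lemma monic_product_diff:
  fixes P A B :: "'a :: idom poly"
  assumes "lead_coeff P = 1" "lead_coeff A = 1" "lead_coeff B = 1" "degree P = degree A + degree B"
    and "i \<ge> degree P"
  shows "coeff (P - A * B) i = 0"
proof -
  have "A \<noteq> 0" "B \<noteq> 0" using assms by auto
  then have d: "degree (A * B) = degree P" using assms by (simp add: degree_mult_eq)
  have "coeff (A * B) (degree P) = 1" unfolding d[symmetric] using assms by (simp add: lead_coeff_mult)
  then show ?thesis
    using assms d by (cases "i = degree P") (auto simp: coeff_eq_0)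
qed

text \<open>
  A coprime factorisation of the reduction lifts. After the linear correction only products of two
  terms of positive order remain in the error, so that each step gains a fixed \<open>\<epsilon>\<close>, the order of the
  initial error.
\<close>

lemma hensel_factorization:
  fixes Q :: "'a :: field lcs poly" and q1 q2 b1 b2 :: "'a poly"
  assumes Q: "lead_coeff Q = 1" "coeffs_ge 0 Q"
    and monic: "lead_coeff q1 = 1" "lead_coeff q2 = 1"
    and bez: "b1 * q2 + b2 * q1 = 1"
    and red: "\<And>i. coeff (q1 * q2) i = lcs_coeff (coeff Q i) 0"
    and deg: "degree Q = degree q1 + degree q2"
  shows "\<exists>A B. Q = A * B \<and> degree A = degree q1 \<and> degree B = degree q2"
proof -
  let ?k = "map_poly lcs_const :: 'a poly \<Rightarrow> 'a lcs poly"
  have kdeg: "degree (?k p) = degree p" for p by simp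
  have klead: "lead_coeff (?k q1) = 1" "lead_coeff (?k q2) = 1"
    using monic by (simp_all add: coeff_map_poly)
  have kbez: "?k b1 * ?k q2 + ?k b2 * ?k q1 = 1"
    using arg_cong[OF bez, of ?k] by (simp add: hom_distribs)
  have ksupp: "coeffs_ge 0 (?k p)" for p by (rule coeffs_ge_const)
  have "coeffs_ge 0 (Q - ?k q1 * ?k q2)"
    by (intro coeffs_ge_diff Q coeffs_ge_mult_left ksupp)
  moreover have "lcs_coeff (coeff (Q - ?k q1 * ?k q2) i) 0 = 0" for i
  proof -
    have "?k q1 * ?k q2 = ?k (q1 * q2)" by (simp add: hom_distribs)
    then show ?thesis by (simp add: coeff_map_poly lcs_coeff_const red)
  qed
  ultimately obtain \<epsilon> where e: "\<epsilon> > 0" "coeffs_ge \<epsilon> (Q - ?k q1 * ?k q2)"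
    by (rule coeffs_ge_gap)
  define P where "P n ab \<longleftrightarrow> (case ab of (a, b) \<Rightarrow>
    (\<forall>i\<ge>degree q1. coeff a i = 0) \<and> (\<forall>i\<ge>degree q2. coeff b i = 0) \<and> coeffs_ge \<epsilon> a \<and> coeffs_ge \<epsilon> b \<and>
    coeffs_ge (of_nat (Suc n) * \<epsilon>) (Q - (?k q1 + a) * (?k q2 + b)))" for n ab
  define S where "S n ab ab' \<longleftrightarrow> coeffs_ge (of_nat (Suc n) * \<epsilon>) (fst ab' - fst ab) \<and>
    coeffs_ge (of_nat (Suc n) * \<epsilon>) (snd ab' - snd ab)" for n and ab ab' :: "'a lcs poly \<times> 'a lcs poly"
  have lead: "degree (?k q1 + a) = degree q1" "lead_coeff (?k q1 + a) = 1"
    if "\<forall>i\<ge>degree q1. coeff a i = 0" for a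
    using monic_add_lower[of "?k q1" a] that klead by (simp_all add: kdeg)
  have lead': "degree (?k q2 + b) = degree q2" "lead_coeff (?k q2 + b) = 1"
    if "\<forall>i\<ge>degree q2. coeff b i = 0" for b
    using monic_add_lower[of "?k q2" b] that klead by (simp_all add: kdeg)
  have "\<exists>f. \<forall>n. P n (f n) \<and> S n (f n) (f (Suc n))"
  proof (rule dependent_nat_choice)
    show "\<exists>ab. P 0 ab" using e by (intro exI[of _ "(0, 0)"]) (simp add: P_def)
  next
    fix ab n assume "P n ab"
    moreover obtain a b where ab: "ab = (a, b)" by force
    ultimately have za: "\<forall>i\<ge>degree q1. coeff a i = 0" and zb: "\<forall>i\<ge>degree q2. coeff b i = 0"
      and ga: "coeffs_ge \<epsilon> a" and gb: "coeffs_ge \<epsilon> b"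
      and gR: "coeffs_ge (of_nat (Suc n) * \<epsilon>) (Q - (?k q1 + a) * (?k q2 + b))"
      by (simp_all add: P_def)
    define R where "R = Q - (?k q1 + a) * (?k q2 + b)"
    define x where "x = of_nat (Suc n) * \<epsilon>"
    have xe: "\<epsilon> \<le> x" using e by (simp add: x_def)
    have gR': "coeffs_ge x R" using gR by (simp add: R_def x_def)
    have zR: "coeff R i = 0" if "i \<ge> degree (?k q1) + degree (?k q2)" for i
      unfolding R_def using that lead[OF za] lead'[OF zb] deg Q
      by (intro monic_product_diff) (auto simp: kdeg)
    obtain s1 s2 where s: "s1 * ?k q2 + s2 * ?k q1 = R" "coeffs_ge x s1" "coeffs_ge x s2"
      "\<And>i. i \<ge> degree (?k q1) \<Longrightarrow> coeff s1 i = 0" "\<And>i. i \<ge> degree (?k q2) \<Longrightarrow> coeff s2 i = 0"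
      using hensel_step[OF klead(1) ksupp klead(2) ksupp kbez ksupp ksupp gR' zR] by blast
    have "Q - (?k q1 + (a + s1)) * (?k q2 + (b + s2)) =
        R - (s1 * ?k q2 + s2 * ?k q1) - s1 * b - s2 * a - s1 * s2"
      unfolding R_def by (simp add: algebra_simps)
    also have "\<dots> = - (s1 * b) - s2 * a - s1 * s2" using s(1) by simp
    finally have eq: "Q - (?k q1 + (a + s1)) * (?k q2 + (b + s2)) = - (s1 * b) - s2 * a - s1 * s2" .
    have se: "coeffs_ge \<epsilon> s1" "coeffs_ge \<epsilon> s2" using s(2,3) xe by (auto intro: coeffs_ge_mono)
    have "coeffs_ge (x + \<epsilon>) (- (s1 * b) - s2 * a - s1 * s2)"
      by (intro coeffs_ge_diff coeffs_ge_uminus coeffs_ge_mult s ga gb se)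
    then have "P (Suc n) (a + s1, b + s2)"
      unfolding P_def prod.case eq using za zb s se ga gb
      by (auto simp: x_def algebra_simps kdeg intro!: coeffs_ge_add)
    moreover have "S n ab (a + s1, b + s2)"
      using s by (simp add: S_def ab x_def)
    ultimately show "\<exists>ab'. P (Suc n) ab' \<and> S n ab ab'" by blast
  qed
  then obtain f where f: "\<And>n. P n (f n)" "\<And>n. S n (f n) (f (Suc n))" by blast
  define a b where "a n = fst (f n)" and "b n = snd (f n)" for n
  have ab: "f n = (a n, b n)" for n by (simp add: a_def b_def)
  have limit: "\<exists>L. \<forall>n. coeffs_ge (of_nat n * \<epsilon>) (L - c n) \<and> (\<forall>i\<ge>d. coeff L i = 0)"
    if c: "\<And>n. coeffs_ge (of_nat (Suc n) * \<epsilon>) (c (Suc n) - c n)" "\<And>n i. i \<ge> d \<Longrightarrow> coeff (c n) i = 0"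
    for c :: "nat \<Rightarrow> 'a lcs poly" and d
  proof -
    have "\<exists>l. \<forall>n. supp_ge (of_nat n * \<epsilon>) (l - coeff (c n) i)" for i
    proof -
      have "supp_ge (of_nat n * \<epsilon>) (coeff (c (Suc n)) i - coeff (c n) i)" for n
        by (rule supp_ge_mono[of "of_nat (Suc n) * \<epsilon>"]) (use coeffs_geD[OF c(1), of n i] e in auto)
      from lcs_limit[of \<epsilon> "\<lambda>n. coeff (c n) i", OF e(1) this] show ?thesis by blast
    qed
    then obtain l where l: "\<And>i n. supp_ge (of_nat n * \<epsilon>) (l i - coeff (c n) i)" by metis
    define L where "L = (\<Sum>i<d. monom (l i) i)"
    have L: "coeff L i = (if i < d then l i else 0)" for i
      by (simp add: L_def coeff_sum coeff_monom)
    have "coeffs_ge (of_nat n * \<epsilon>) (L - c n)" for n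
      unfolding coeffs_ge_def
    proof
      fix i show "supp_ge (of_nat n * \<epsilon>) (coeff (L - c n) i)"
        using l[of n i] c(2)[of i n] by (cases "i < d") (auto simp: L)
    qed
    then show ?thesis by (intro exI[of _ L]) (auto simp: L)
  qed
  have "\<exists>L. \<forall>n. coeffs_ge (of_nat n * \<epsilon>) (L - a n) \<and> (\<forall>i\<ge>degree q1. coeff L i = 0)"
    by (rule limit) (use f in \<open>auto simp: P_def S_def ab simp del: of_nat_Suc\<close>)
  moreover have "\<exists>L. \<forall>n. coeffs_ge (of_nat n * \<epsilon>) (L - b n) \<and> (\<forall>i\<ge>degree q2. coeff L i = 0)"
    by (rule limit) (use f in \<open>auto simp: P_def S_def ab simp del: of_nat_Suc\<close>)
  ultimately obtain La Lb where La: "\<And>n. coeffs_ge (of_nat n * \<epsilon>) (La - a n)" "\<forall>i\<ge>degree q1. coeff La i = 0"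
    and Lb: "\<And>n. coeffs_ge (of_nat n * \<epsilon>) (Lb - b n)" "\<forall>i\<ge>degree q2. coeff Lb i = 0" by blast
  have ge0: "coeffs_ge 0 (a n)" "coeffs_ge 0 (b n)" for n
    using f(1)[of n] e(1) by (auto simp: P_def ab intro: coeffs_ge_mono)
  have geL: "coeffs_ge 0 Lb"
  proof -
    have "Lb = (Lb - b 0) + b 0" by simp
    moreover have "coeffs_ge 0 (Lb - b 0)" using Lb(1)[of 0] by simp
    ultimately show ?thesis using ge0(2)[of 0] by (metis coeffs_ge_add)
  qed
  have "Q - (?k q1 + La) * (?k q2 + Lb) = 0"
  proof (rule coeffs_ge_arbitrary_imp_0[OF e(1)])
    fix n
    have "Q - (?k q1 + La) * (?k q2 + Lb) = (Q - (?k q1 + a n) * (?k q2 + b n))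
        - (La - a n) * (?k q2 + Lb) - (?k q1 + a n) * (Lb - b n)"
      by (simp add: algebra_simps)
    moreover have "coeffs_ge (of_nat n * \<epsilon>) (Q - (?k q1 + a n) * (?k q2 + b n))"
    proof (rule coeffs_ge_mono)
      show "coeffs_ge (of_nat (Suc n) * \<epsilon>) (Q - (?k q1 + a n) * (?k q2 + b n))"
        using f(1)[of n] by (simp add: P_def ab del: of_nat_Suc)
      show "of_nat n * \<epsilon> \<le> of_nat (Suc n) * \<epsilon>" using e(1) by (simp add: algebra_simps)
    qed
    moreover have "coeffs_ge 0 (?k q2 + Lb)" "coeffs_ge 0 (?k q1 + a n)"
      by (intro coeffs_ge_add geL ge0 ksupp)+
    ultimately show "coeffs_ge (of_nat n * \<epsilon>) (Q - (?k q1 + La) * (?k q2 + Lb))"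
      using La(1)[of n] Lb(1)[of n]
      by (metis coeffs_ge_diff coeffs_ge_mult_left coeffs_ge_mult_right)
  qed
  then show ?thesis using lead(1)[OF La(2)] lead'(1)[OF Lb(2)] by (intro exI conjI) auto
qed

text \<open>
  Euclid's algorithm over a bare field, on which no choice of gcd is fixed.
\<close>

lemma poly_bezout:
  fixes r s :: "'a :: field poly"
  shows "\<exists>a b. (a * r + b * s) dvd r \<and> (a * r + b * s) dvd s"
proof (induction "if s = 0 then 0 else Suc (degree s)" arbitrary: r s rule: less_induct)
  case less
  show ?case
  proof (cases "s = 0")
    case True
    then show ?thesis by (intro exI[of _ 1] exI[of _ 0]) simp
  next
    case False
    have "\<exists>a b. (a * s + b * (r mod s)) dvd s \<and> (a * s + b * (r mod s)) dvd (r mod s)"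
      by (rule less.hyps) (use False degree_mod_less[of s r] in auto)
    then obtain a b where d: "(a * s + b * (r mod s)) dvd s" "(a * s + b * (r mod s)) dvd (r mod s)"
      by blast
    have "a * s + b * (r mod s) = b * r + (a - b * (r div s)) * s"
      by (simp add: algebra_simps flip: minus_div_mult_eq_mod)
    moreover have "(a * s + b * (r mod s)) dvd r"
    proof -
      have "a * s + b * (r mod s) dvd r div s * s + r mod s"
        by (intro dvd_add dvd_mult d)
      then show ?thesis by (simp only: div_mult_mod_eq)
    qed
    ultimately show ?thesis using d by metis
  qed
qed

lemma coprime_poly_bezout:
  fixes r s :: "'a :: field poly"
  assumes "coprime r s"
  obtains a b where "a * r + b * s = 1"
proof -
  from poly_bezout[of r s] obtain a b where "(a * r + b * s) dvd r" "(a * r + b * s) dvd s" by blast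
  with assms have "is_unit (a * r + b * s)" by (rule coprime_common_divisor)
  then obtain c where c: "1 = (a * r + b * s) * c" by (rule dvdE)
  show ?thesis by (rule that[of "c * a" "c * b"]) (use c in \<open>simp add: algebra_simps\<close>)
qed

text \<open>
  With a single root \<open>x\<close> the polynomial would be \<open>(Y - x)\<^sup>m\<close>, whose second coefficient is \<open>- m x\<close>; in
  characteristic zero this forces \<open>x = 0\<close>, and then all lower coefficients vanish.
\<close>

lemma two_roots_of_trace_zero:
  fixes q :: "'a :: {alg_closed_field, field_char_0} poly"
  assumes "lead_coeff q = 1" "degree q > 0" "coeff q (degree q - 1) = 0" "i < degree q" "coeff q i \<noteq> 0"
  shows "\<exists>x y. x \<noteq> y \<and> poly q x = 0 \<and> poly q y = 0"
proof -
  from alg_closed_imp_poly_has_root[OF assms(2)] obtain x where x: "poly q x = 0" by blast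
  define m where "m = order x q"
  have q0: "q \<noteq> 0" using assms by auto
  obtain r where r: "q = [:-x, 1:] ^ m * r" using order_1[of x q] by (auto simp: m_def elim: dvdE)
  have r0: "r \<noteq> 0" using r q0 by auto
  have rx: "poly r x \<noteq> 0"
  proof
    assume "poly r x = 0"
    then have "[:-x, 1:] dvd r" by (simp add: poly_eq_0_iff_dvd)
    then have "[:-x, 1:] ^ Suc m dvd q"
      unfolding r by (metis mult.commute mult_dvd_mono dvd_refl power_Suc)
    with order_2[OF q0, of x] show False by (simp add: m_def)
  qed
  show ?thesis
  proof (cases "degree r > 0")
    case True
    from alg_closed_imp_poly_has_root[OF True] obtain y where "poly r y = 0" by blast
    with rx x show ?thesis by (intro exI[of _ x] exI[of _ y]) (auto simp: r)
  next
    case False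
    then obtain c where c: "r = [:c:]" by (auto elim: degree_eq_zeroE)
    have dq: "degree q = m" unfolding r using r0 False by (simp add: degree_mult_eq degree_power_eq)
    have "lead_coeff q = lead_coeff ([:-x, 1:] ^ m) * lead_coeff r" unfolding r by (rule lead_coeff_mult)
    then have "c = 1" using assms(1) c by (simp add: lead_coeff_power)
    then have qm: "q = [:-x, 1:] ^ m" using r c by simp
    have m: "m > 0" using dq assms by simp
    have "coeff q (m - 1) = of_nat m * (- x)"
    proof -
      have "coeff q (m - 1) = of_nat (m choose (m - 1)) * (- x)"
        unfolding qm using m by (subst coeff_linear_poly_power) auto
      also have "m choose (m - 1) = m" using m by (subst binomial_symmetric) auto
      finally show ?thesis .
    qed
    with assms(3) dq m have "x = 0" by simp
    then have "q = monom 1 m" by (simp add: qm monom_altdef)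
    with assms(4,5) dq have False by (simp add: coeff_monom)
    then show ?thesis ..
  qed
qed

text \<open>
  The first slope \<open>\<rho>\<close> of the Newton polygon is chosen so that after the substitution \<open>Y \<mapsto> t\<^sup>\<rho> Y\<close> and
  division by \<open>t\<^sup>n\<^sup>\<rho>\<close> all coefficients are integral and some lower coefficient is a unit.
  The second coefficient stays zero, so the reduction has two distinct roots, splits into coprime factors, and Hensel's lemma applies.
\<close>

lemma lcs_newton_hensel_reducible:
  fixes p :: "'a :: {alg_closed_field, field_char_0} lcs poly"
  assumes p: "degree p > 1" "lead_coeff p = 1" "coeff p (degree p - 1) = 0" "coeff p 0 \<noteq> 0"
  shows "\<not> irreducible p"
proof -
  define n where "n = degree p"
  have n: "n > 1" using p by (simp add: n_def)
  define I where "I = {i. i < n \<and> coeff p i \<noteq> 0}"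
  have "0 \<in> I" using p n by (simp add: I_def)
  then have I: "finite I" "I \<noteq> {}" by (auto simp: I_def)
  have "\<exists>x. supp_ge x (coeff p i) \<and> lcs_coeff (coeff p i) x \<noteq> 0" if "i \<in> I" for i
  proof -
    have "coeff p i \<noteq> 0" using that by (simp add: I_def)
    from supp_ge_obtain_lowest[OF this] show ?thesis by blast
  qed
  then obtain v where v: "\<And>i. i \<in> I \<Longrightarrow> supp_ge (v i) (coeff p i)" "\<And>i. i \<in> I \<Longrightarrow> lcs_coeff (coeff p i) (v i) \<noteq> 0"
    by metis
  define \<rho> where "\<rho> = Min ((\<lambda>i. v i / of_nat (n - i)) ` I)"
  have "\<rho> \<in> (\<lambda>i. v i / of_nat (n - i)) ` I" unfolding \<rho>_def using I by (intro Min_in) auto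
  then obtain i0 where i0: "i0 \<in> I" "\<rho> = v i0 / of_nat (n - i0)" by blast
  have rho: "of_nat (n - i) * \<rho> \<le> v i" if "i \<in> I" for i
  proof -
    have "\<rho> \<le> v i / of_nat (n - i)" unfolding \<rho>_def using I that by (intro Min_le) auto
    moreover have "(of_nat (n - i) :: real) > 0" using that by (simp add: I_def)
    ultimately show ?thesis by (simp add: field_simps)
  qed
  have rho0: "of_nat (n - i0) * \<rho> = v i0" using i0 by (simp add: I_def)
  let ?t = "lcs_monom 1 :: real \<Rightarrow> 'a lcs"
  define Q where "Q = smult (?t (- (of_nat n * \<rho>))) (p \<circ>\<^sub>p [:0, ?t \<rho>:])"
  have t_mult: "?t x * ?t y = ?t (x + y)" for x y by (simp add: lcs_monom_mult)
  have t_0: "?t 0 = 1" by (simp add: one_lcs_def)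
  have t_nz: "?t x \<noteq> 0" for x using t_mult[of x "- x"] t_0 by auto
  have cQ: "coeff Q i = ?t (of_nat i * \<rho> - of_nat n * \<rho>) * coeff p i" for i
    by (simp add: Q_def coeff_pcompose_linear lcs_monom_power lcs_monom_mult flip: mult.assoc)
  have dQ: "degree Q = n" using t_nz by (simp add: Q_def degree_pcompose n_def)
  have lQ: "lead_coeff Q = 1" unfolding dQ cQ using p by (simp add: n_def t_0)
  have cQ': "lcs_coeff (coeff Q i) z = lcs_coeff (coeff p i) (z + of_nat (n - i) * \<rho>)" if "i \<le> n" for i z
  proof -
    have "z - (of_nat i * \<rho> - of_nat n * \<rho>) = z + of_nat (n - i) * \<rho>"
      using that by (simp add: of_nat_diff left_diff_distrib)
    from arg_cong[OF this, of "lcs_coeff (coeff p i)"] show ?thesis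
      unfolding cQ lcs_coeff_monom_mult by simp
  qed
  have gQ: "coeffs_ge 0 Q"
    unfolding coeffs_ge_def
  proof
    fix i
    consider "i \<in> I" | "i = n" | "coeff p i = 0" using coeff_eq_0[of p i] by (auto simp: I_def n_def) linarith
    then show "supp_ge 0 (coeff Q i)"
    proof cases
      case 1
      then have "i \<le> n" by (simp add: I_def)
      from cQ'[OF this] show ?thesis
        unfolding supp_ge_def using rho[OF 1] supp_geD[OF v(1)[OF 1]] by force
    next
      case 2
      then show ?thesis using lQ dQ by (simp add: supp_ge_one)
    next
      case 3
      then show ?thesis by (simp add: cQ)
    qed
  qed
  define q where "q = map_poly (\<lambda>f. lcs_coeff f 0) Q"
  have cq: "coeff q i = lcs_coeff (coeff Q i) 0" for i by (simp add: q_def coeff_map_poly)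
  have cqn: "coeff q n = 1" using lQ dQ by (simp add: cq lcs_coeff_one)
  have "degree q \<le> n" using dQ by (intro degree_le) (auto simp: cq coeff_eq_0)
  moreover have "degree q \<ge> n" using cqn by (intro le_degree) auto
  ultimately have dq: "degree q = n" by simp
  have i0n: "i0 < n" using i0 by (simp add: I_def)
  have "\<exists>x y. x \<noteq> y \<and> poly q x = 0 \<and> poly q y = 0"
  proof (rule two_roots_of_trace_zero[of q i0])
    show "lead_coeff q = 1" using cqn dq by simp
    show "degree q > 0" using dq n by simp
    show "coeff q (degree q - 1) = 0" using p(3) by (simp add: dq cq cQ n_def)
    show "i0 < degree q" using i0n dq by simp
    show "coeff q i0 \<noteq> 0" using v(2)[OF i0(1)] by (simp only: cq cQ'[OF less_imp_le[OF i0n]] rho0 add_0_left not_False_eq_True)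
  qed
  then obtain x y where xy: "x \<noteq> y" "poly q x = 0" "poly q y = 0" by blast
  have "degree q > 1" using dq n by simp
  from alg_closed_imp_poly_splits_coprime[OF this xy(2,3,1)] obtain r s where
    rs: "degree r > 0" "degree s > 0" "coprime r s" "q = r * s" by blast
  define lr ls where "lr = lead_coeff r" and "ls = lead_coeff s"
  have nz: "lr \<noteq> 0" "ls \<noteq> 0" using rs by (auto simp: lr_def ls_def)
  have lrls: "lr * ls = 1"
    using cqn dq rs(4) by (metis lead_coeff_mult lr_def ls_def)
  from coprime_poly_bezout[OF rs(3)] obtain a b where ab: "a * r + b * s = 1" .
  define q1 q2 where "q1 = smult ls r" and "q2 = smult lr s"
  have q12: "q1 * q2 = q" using lrls by (simp add: q1_def q2_def rs(4) mult.commute)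
  have "\<exists>A B. Q = A * B \<and> degree A = degree q1 \<and> degree B = degree q2"
  proof (rule hensel_factorization[OF lQ gQ])
    show "lead_coeff q1 = 1" "lead_coeff q2 = 1"
      using lrls nz by (auto simp: q1_def q2_def lr_def ls_def mult.commute)
    have "smult lr a * q1 + smult ls b * q2 = smult (lr * ls) (a * r + b * s)"
      by (simp add: q1_def q2_def smult_add_right mult.commute)
    then show "smult ls b * q2 + smult lr a * q1 = 1" using ab lrls by (simp add: add.commute)
    show "coeff (q1 * q2) i = lcs_coeff (coeff Q i) 0" for i by (simp add: q12 cq)
    have "degree (r * s) = degree r + degree s" using rs by (intro degree_mult_eq) auto
    then show "degree Q = degree q1 + degree q2"
      using dq dQ nz rs(4) by (simp add: q1_def q2_def)
  qed
  then obtain A B where AB: "Q = A * B" "degree A = degree r" "degree B = degree s"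
    using nz by (auto simp: q1_def q2_def)
  let ?c = "[:0, ?t (- \<rho>):]"
  have "p = smult (?t (of_nat n * \<rho>)) (Q \<circ>\<^sub>p ?c)"
  proof (rule poly_eqI)
    fix i
    have "coeff (smult (?t (of_nat n * \<rho>)) (Q \<circ>\<^sub>p ?c)) i =
      (?t (of_nat n * \<rho>) * ?t (of_nat i * - \<rho>) * ?t (of_nat i * \<rho> - of_nat n * \<rho>)) * coeff p i"
      by (simp add: coeff_pcompose_linear cQ lcs_monom_power mult_ac)
    also have "\<dots> = coeff p i" unfolding t_mult by (simp add: t_0)
    finally show "coeff p i = coeff (smult (?t (of_nat n * \<rho>)) (Q \<circ>\<^sub>p ?c)) i" by simp
  qed
  then have "p = smult (?t (of_nat n * \<rho>)) (A \<circ>\<^sub>p ?c) * (B \<circ>\<^sub>p ?c)"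
    by (simp add: AB pcompose_mult)
  moreover have "degree (smult (?t (of_nat n * \<rho>)) (A \<circ>\<^sub>p ?c)) > 0" "degree (B \<circ>\<^sub>p ?c) > 0"
    using AB rs t_nz by (simp_all add: degree_pcompose)
  ultimately show ?thesis by (intro reducible_polyI)
qed

instance lcs :: ("{alg_closed_field, field_char_0}") alg_closed_field
  by (rule alg_closedI_reducible_coeff_deg_minus_one_eq_0) (rule lcs_newton_hensel_reducible)

section \<open>Generic weights and the embedding of power series\<close>

text \<open>
  Each of these functionals gives a derivation of the series field; rational values act on
  coefficients in every field of characteristic zero.
\<close>

definition rat_linear :: "(real \<Rightarrow> rat) \<Rightarrow> bool" where
  "rat_linear d \<longleftrightarrow> (\<forall>x y. d (x + y) = d x + d y) \<and> (\<forall>r x. d (of_rat r * x) = r * d x)"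

lemma rat_linear_add: "rat_linear d \<Longrightarrow> d (x + y) = d x + d y"
  and rat_linear_scale: "rat_linear d \<Longrightarrow> d (of_rat r * x) = r * d x"
  by (auto simp: rat_linear_def)

lemma rat_linear_0: "rat_linear d \<Longrightarrow> d 0 = 0"
  using rat_linear_add[of d 0 0] by simp

lemma rat_linear_diff: "rat_linear d \<Longrightarrow> d (x - y) = d x - d y"
  using rat_linear_add[of d "x - y" y] by simp

lemma rat_linear_sum: "rat_linear d \<Longrightarrow> d (\<Sum>i\<in>A. f i) = (\<Sum>i\<in>A. d (f i))"
  by (induction A rule: infinite_finite_induct) (auto simp: rat_linear_0 rat_linear_add)

interpretation rat_real: vector_space "\<lambda>(r :: rat) (x :: real). of_rat r * x"
  by standard (simp_all add: algebra_simps of_rat_add of_rat_mult)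

interpretation rat_rat: vector_space "\<lambda>(r :: rat) (x :: rat). r * x"
  by standard (simp_all add: algebra_simps)

interpretation rat_pair: vector_space_pair "\<lambda>(r :: rat) (x :: real). of_rat r * x" "\<lambda>(r :: rat) (x :: rat). r * x" ..

lemma rat_linear_extension:
  assumes "rat_real.independent B"
  shows "\<exists>d. rat_linear d \<and> (\<forall>x\<in>B. d x = q x)"
proof -
  from rat_pair.linear_independent_extend[OF assms, of q] obtain d
    where d: "Vector_Spaces.linear (\<lambda>r x. of_rat r * x) (\<lambda>r x. r * x) d" "\<forall>x\<in>B. d x = q x" by blast
  have "rat_linear d"
    unfolding rat_linear_def
    using Vector_Spaces.linear.axioms(3)[OF d(1)] by (simp add: module_hom_def module_hom_axioms_def)
  with d(2) show ?thesis by blast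
qed

lemma rat_linear_separates:
  assumes "x \<noteq> y"
  shows "\<exists>d. rat_linear d \<and> d x \<noteq> d y"
proof -
  have "rat_real.independent {x - y}" using assms by simp
  from rat_linear_extension[OF this, of "\<lambda>_. 1"] obtain d where "rat_linear d" "d (x - y) = 1" by auto
  then show ?thesis by (intro exI[of _ d]) (auto simp: rat_linear_diff)
qed

lemma countable_rat_span:
  assumes "finite S"
  shows "countable (rat_real.span S)"
  using assms
proof (induction S)
  case (insert a S)
  have "rat_real.span (insert a S) \<subseteq> (\<lambda>(k, x). of_rat k * a + x) ` (UNIV \<times> rat_real.span S)"
  proof
    fix x assume "x \<in> rat_real.span (insert a S)"
    then obtain k where "x - of_rat k * a \<in> rat_real.span S" by (auto simp: rat_real.span_breakdown_eq)
    then show "x \<in> (\<lambda>(k, x). of_rat k * a + x) ` (UNIV \<times> rat_real.span S)"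
      by (intro image_eqI[of _ _ "(k, x - of_rat k * a)"]) auto
  qed
  moreover have "countable ((\<lambda>(k, x). of_rat k * a + x) ` ((UNIV :: rat set) \<times> rat_real.span S))"
    using insert.IH by (intro countable_image countable_SIGMA) auto
  ultimately show ?case by (rule countable_subset)
qed simp

text \<open>
  The rational span of a finite set is countable, so a finite independent set can always be enlarged.
\<close>

lemma positive_independent_reals:
  "\<exists>B. finite B \<and> card B = n \<and> (\<forall>x\<in>B. x > 0) \<and> rat_real.independent B"
proof (induction n)
  case 0
  then show ?case by (intro exI[of _ "{}"]) (simp add: rat_real.independent_empty)
next
  case (Suc n)
  then obtain B where B: "finite B" "card B = n" "\<forall>x\<in>B. x > 0" "rat_real.independent B" by blast
  have "rat_real.span B \<noteq> UNIV"
    using countable_rat_span[OF B(1)] uncountable_UNIV_real by metis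
  then obtain x where x: "x \<notin> rat_real.span B" by blast
  have "\<bar>x\<bar> \<notin> rat_real.span B"
    using x rat_real.span_neg[of "- x" B] by (auto simp: abs_if split: if_splits)
  moreover from x have "\<bar>x\<bar> > 0" using rat_real.span_zero[of B] by (cases "x = 0") auto
  moreover from calculation(1) have "\<bar>x\<bar> \<notin> B" using rat_real.span_base by blast
  ultimately show ?case
    using B by (intro exI[of _ "insert \<bar>x\<bar> B"]) (simp add: rat_real.independent_insert)
qed

text \<open>
  The second condition says that the weights are linearly independent over the rationals. Stated
  through functionals, it directly provides a derivation of the series field that extends a
  prescribed logarithmic derivation of the power series.
\<close>

definition generic_weight :: "('d \<Rightarrow> real) \<Rightarrow> bool" where
  "generic_weight w \<longleftrightarrow> (\<forall>i. w i > 0) \<and> (\<forall>q. \<exists>d. rat_linear d \<and> (\<forall>i. d (w i) = q i))"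

lemma generic_weight_exists: "\<exists>w. generic_weight (w :: 'd :: finite \<Rightarrow> real)"
proof -
  from positive_independent_reals[of "card (UNIV :: 'd set)"] obtain B where
    B: "finite B" "card B = card (UNIV :: 'd set)" "\<forall>x\<in>B. x > 0" "rat_real.independent B" by blast
  from B(1,2) obtain w :: "'d \<Rightarrow> real" where w: "bij_betw w UNIV B"
    using finite_same_card_bij[of "UNIV :: 'd set" B] by auto
  have "\<exists>d. rat_linear d \<and> (\<forall>i. d (w i) = q i)" for q
  proof -
    from rat_linear_extension[OF B(4), of "\<lambda>x. q (the_inv_into UNIV w x)"] obtain d
      where "rat_linear d" "\<forall>x\<in>B. d x = q (the_inv_into UNIV w x)" by blast
    moreover have "the_inv_into UNIV w (w i) = i" for i
      using w by (intro the_inv_into_f_f) (auto simp: bij_betw_def)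
    ultimately show ?thesis using w by (intro exI[of _ d]) (auto simp: bij_betw_def)
  qed
  moreover have "w i > 0" for i using w B(3) by (auto simp: bij_betw_def)
  ultimately show ?thesis unfolding generic_weight_def by blast
qed

text \<open>
  Used to make one variable much heavier than the others.
\<close>

lemma generic_weight_rescale:
  assumes w: "generic_weight w" and c: "\<And>i. c i > 0"
  shows "generic_weight (\<lambda>i. of_rat (c i) * w i)"
  unfolding generic_weight_def
proof (intro conjI allI)
  show "of_rat (c i) * w i > 0" for i using w c[of i] by (simp add: generic_weight_def)
  fix q
  from w obtain d where d: "rat_linear d" "\<And>i. d (w i) = q i / c i"
    unfolding generic_weight_def by (elim conjE allE[of _ "\<lambda>i. q i / c i"]) auto
  have "d (of_rat (c i) * w i) = q i" for i
    using c[of i] by (simp add: rat_linear_scale[OF d(1)] d(2))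
  with d(1) show "\<exists>d. rat_linear d \<and> (\<forall>i. d (of_rat (c i) * w i) = q i)" by blast
qed

definition weight_of :: "('d \<Rightarrow> real) \<Rightarrow> ('d :: finite \<Rightarrow> rat) \<Rightarrow> real" where
  "weight_of w \<alpha> = (\<Sum>i\<in>UNIV. of_rat (\<alpha> i) * w i)"

lemma weight_of_0 [simp]: "weight_of w 0 = 0"
  and weight_of_add: "weight_of w (\<alpha> + \<beta>) = weight_of w \<alpha> + weight_of w \<beta>"
  by (simp_all add: weight_of_def of_rat_add sum.distrib algebra_simps)

lemma weight_of_mono:
  assumes "generic_weight w" "\<alpha> \<le> \<beta>"
  shows "weight_of w \<alpha> \<le> weight_of w \<beta>"
  unfolding weight_of_def using assms
  by (intro sum_mono mult_right_mono) (auto simp: le_fun_def generic_weight_def of_rat_less_eq less_imp_le)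

lemma rat_linear_weight_of:
  assumes "rat_linear d"
  shows "d (weight_of w \<alpha>) = (\<Sum>i\<in>UNIV. \<alpha> i * d (w i))"
  by (simp add: weight_of_def rat_linear_sum[OF assms] rat_linear_scale[OF assms])

lemma inj_weight_of:
  assumes "generic_weight w"
  shows "inj (weight_of w)"
proof (rule injI)
  fix \<alpha> \<beta> assume eq: "weight_of w \<alpha> = weight_of w \<beta>"
  show "\<alpha> = \<beta>"
  proof
    fix j
    from assms obtain d where d: "rat_linear d" "\<And>i. d (w i) = (if i = j then 1 else 0)"
      unfolding generic_weight_def by (elim conjE allE[of _ "\<lambda>i. if i = j then 1 else 0"]) auto
    have "d (weight_of w \<gamma>) = \<gamma> j" for \<gamma>
      by (simp add: rat_linear_weight_of[OF d(1)] d(2) if_distrib cong: if_cong)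
    with eq show "\<alpha> j = \<beta> j" by metis
  qed
qed

text \<open>
  The substitution \<open>X\<^sup>\<alpha> \<mapsto> t\<^sup>w\<^sup>\<cdot>\<^sup>\<alpha>\<close>. Distinct exponents have distinct generic weights, so no terms have
  to be collected.
\<close>

definition weight_embed :: "('d \<Rightarrow> real) \<Rightarrow> ('a :: zero, 'd :: finite) fracps \<Rightarrow> 'a lcs" where
  "weight_embed w f =
     Abs_lcs (\<lambda>x. if x \<in> range (weight_of w) then fracps_coeff f (inv_into UNIV (weight_of w) x) else 0)"

lemma finite_weight_le:
  fixes w :: "'d :: finite \<Rightarrow> real"
  assumes w: "generic_weight w" and k: "k > 0"
  shows "finite {\<alpha> \<in> exp_grid k. weight_of w \<alpha> \<le> c}"
proof (rule finite_subset)
  show "finite {\<alpha> \<in> exp_grid k. \<alpha> \<le> (\<lambda>i. of_int \<lceil>c / w i\<rceil>)}" by (rule finite_exp_grid_le[OF k])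
  show "{\<alpha> \<in> exp_grid k. weight_of w \<alpha> \<le> c} \<subseteq> {\<alpha> \<in> exp_grid k. \<alpha> \<le> (\<lambda>i. of_int \<lceil>c / w i\<rceil>)}"
  proof
    fix \<alpha> assume \<alpha>: "\<alpha> \<in> {\<alpha> \<in> exp_grid k. weight_of w \<alpha> \<le> c}"
    then have nn: "0 \<le> \<alpha>" using exp_grid_nonneg by blast
    have wpos: "w i > 0" for i using w by (simp add: generic_weight_def)
    have "\<alpha> i \<le> of_int \<lceil>c / w i\<rceil>" for i
    proof -
      have "of_rat (\<alpha> i) * w i \<le> weight_of w \<alpha>"
        unfolding weight_of_def
        by (rule member_le_sum) (use nn wpos in \<open>auto simp: le_fun_def less_imp_le zero_le_of_rat_iff intro!: mult_nonneg_nonneg\<close>)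
      also have "\<dots> \<le> c" using \<alpha> by simp
      finally have "of_rat (\<alpha> i) \<le> c / w i" using wpos[of i] by (simp add: field_simps)
      also have "\<dots> \<le> of_int \<lceil>c / w i\<rceil>" by (rule le_of_int_ceiling)
      finally have "(of_rat (\<alpha> i) :: real) \<le> of_rat (of_int \<lceil>c / w i\<rceil>)" by simp
      then show ?thesis by (simp only: of_rat_less_eq)
    qed
    with \<alpha> show "\<alpha> \<in> {\<alpha> \<in> exp_grid k. \<alpha> \<le> (\<lambda>i. of_int \<lceil>c / w i\<rceil>)}" by (auto simp: le_fun_def)
  qed
qed

lemma lcs_coeff_weight_embed:
  assumes w: "generic_weight w"
  shows "lcs_coeff (weight_embed w f) x =
    (if x \<in> range (weight_of w) then fracps_coeff f (inv_into UNIV (weight_of w) x) else 0)"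
proof -
  let ?c = "\<lambda>x. if x \<in> range (weight_of w) then fracps_coeff f (inv_into UNIV (weight_of w) x) else 0"
  obtain k where k: "k > 0" "{\<alpha>. fracps_coeff f \<alpha> \<noteq> 0} \<subseteq> exp_grid k" by (rule fracps_supportE)
  have "finite {x. x \<le> c \<and> ?c x \<noteq> 0}" for c
  proof (rule finite_subset)
    show "finite (weight_of w ` {\<alpha> \<in> exp_grid k. weight_of w \<alpha> \<le> c})"
      using finite_weight_le[OF w k(1)] by blast
    show "{x. x \<le> c \<and> ?c x \<noteq> 0} \<subseteq> weight_of w ` {\<alpha> \<in> exp_grid k. weight_of w \<alpha> \<le> c}"
      using k(2) inj_weight_of[OF w] by (auto split: if_splits)
  qed
  then show ?thesis unfolding weight_embed_def by (subst Abs_lcs_inverse) (auto simp: left_finite_def)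
qed

lemma lcs_coeff_weight_embed_weight:
  "generic_weight w \<Longrightarrow> lcs_coeff (weight_embed w f) (weight_of w \<alpha>) = fracps_coeff f \<alpha>"
  by (simp add: lcs_coeff_weight_embed inj_weight_of)

lemma lcs_coeff_weight_embedE:
  assumes "generic_weight w" "lcs_coeff (weight_embed w f) x \<noteq> 0"
  obtains \<alpha> where "x = weight_of w \<alpha>" "fracps_coeff f \<alpha> \<noteq> 0"
  using assms by (auto simp: lcs_coeff_weight_embed inj_weight_of split: if_splits)

lemma weight_embed_mult:
  fixes f g :: "('a :: comm_ring_1, 'd :: finite) fracps"
  assumes w: "generic_weight w"
  shows "weight_embed w (f * g) = weight_embed w f * weight_embed w g"
proof (rule lcs_eqI)
  fix x
  let ?F = "lcs_coeff (weight_embed w f)" and ?G = "lcs_coeff (weight_embed w g)"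
  note inj = inj_weight_of[OF w]
  show "lcs_coeff (weight_embed w (f * g)) x = lcs_coeff (weight_embed w f * weight_embed w g) x"
  proof (cases "x \<in> range (weight_of w)")
    case True
    then obtain \<alpha> where x: "x = weight_of w \<alpha>" by blast
    have "real_conv ?F ?G x = exp_conv (fracps_coeff f) (fracps_coeff g) \<alpha>"
      unfolding real_conv_def exp_conv_def
    proof (rule sum.reindex_bij_witness[where j = "\<lambda>a. (inv_into UNIV (weight_of w) a, inv_into UNIV (weight_of w) (x - a))" and i = "\<lambda>(\<beta>, \<gamma>). weight_of w \<beta>"])
      fix a assume "a \<in> {a. ?F a \<noteq> 0 \<and> ?G (x - a) \<noteq> 0}"
      then obtain \<beta> \<gamma> where bg: "a = weight_of w \<beta>" "fracps_coeff f \<beta> \<noteq> 0"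
        "x - a = weight_of w \<gamma>" "fracps_coeff g \<gamma> \<noteq> 0"
        by (auto elim!: lcs_coeff_weight_embedE[OF w])
      have "weight_of w (\<beta> + \<gamma>) = weight_of w \<alpha>" using bg x by (simp add: weight_of_add)
      then have "\<beta> + \<gamma> = \<alpha>" by (simp only: inj_eq[OF inj])
      with bg inj show "(case (inv_into UNIV (weight_of w) a, inv_into UNIV (weight_of w) (x - a)) of (\<beta>, \<gamma>) \<Rightarrow> weight_of w \<beta>) = a"
        "(inv_into UNIV (weight_of w) a, inv_into UNIV (weight_of w) (x - a)) \<in> {(\<beta>, \<gamma>). \<beta> + \<gamma> = \<alpha> \<and> fracps_coeff f \<beta> \<noteq> 0 \<and> fracps_coeff g \<gamma> \<noteq> 0}"
        "(case (inv_into UNIV (weight_of w) a, inv_into UNIV (weight_of w) (x - a)) of (\<beta>, \<gamma>) \<Rightarrow> fracps_coeff f \<beta> * fracps_coeff g \<gamma>) = ?F a * ?G (x - a)"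
        by (simp_all add: lcs_coeff_weight_embed_weight[OF w])
    next
      fix p assume "p \<in> {(\<beta>, \<gamma>). \<beta> + \<gamma> = \<alpha> \<and> fracps_coeff f \<beta> \<noteq> 0 \<and> fracps_coeff g \<gamma> \<noteq> 0}"
      then obtain \<beta> \<gamma> where p: "p = (\<beta>, \<gamma>)" "\<beta> + \<gamma> = \<alpha>" "fracps_coeff f \<beta> \<noteq> 0" "fracps_coeff g \<gamma> \<noteq> 0" by auto
      have "x - weight_of w \<beta> = weight_of w \<gamma>" using p(2) x by (auto simp: weight_of_add)
      with p inj show "(inv_into UNIV (weight_of w) (case p of (\<beta>, \<gamma>) \<Rightarrow> weight_of w \<beta>), inv_into UNIV (weight_of w) (x - (case p of (\<beta>, \<gamma>) \<Rightarrow> weight_of w \<beta>))) = p"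
        "(case p of (\<beta>, \<gamma>) \<Rightarrow> weight_of w \<beta>) \<in> {a. ?F a \<noteq> 0 \<and> ?G (x - a) \<noteq> 0}"
        by (simp_all add: lcs_coeff_weight_embed_weight[OF w])
    qed
    then show ?thesis
      by (simp add: x lcs_coeff_weight_embed_weight[OF w] times_fracps.rep_eq times_lcs.rep_eq)
  next
    case False
    have "{a. ?F a \<noteq> 0 \<and> ?G (x - a) \<noteq> 0} = {}"
    proof (rule ccontr)
      assume "{a. ?F a \<noteq> 0 \<and> ?G (x - a) \<noteq> 0} \<noteq> {}"
      then obtain a \<beta> \<gamma> where "a = weight_of w \<beta>" "x - a = weight_of w \<gamma>"
        by (auto elim!: lcs_coeff_weight_embedE[OF w])
      then have "x = weight_of w (\<beta> + \<gamma>)" by (simp add: weight_of_add)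
      with False show False by blast
    qed
    then have "lcs_coeff (weight_embed w f * weight_embed w g) x = 0"
      unfolding times_lcs.rep_eq real_conv_def by (simp only: sum.empty)
    with False show ?thesis by (simp add: lcs_coeff_weight_embed[OF w])
  qed
qed

lemma inj_comm_ring_hom_weight_embed:
  fixes w :: "'d :: finite \<Rightarrow> real"
  assumes w: "generic_weight w"
  shows "inj_comm_ring_hom (weight_embed w :: ('a :: comm_ring_1, 'd) fracps \<Rightarrow> 'a lcs)"
proof
  fix f g :: "('a, 'd) fracps"
  show "weight_embed w 0 = (0 :: 'a lcs)"
    by (rule lcs_eqI) (simp add: lcs_coeff_weight_embed[OF w] zero_fracps.rep_eq)
  show "weight_embed w 1 = (1 :: 'a lcs)"
  proof (rule lcs_eqI)
    fix x
    show "lcs_coeff (weight_embed w 1) x = lcs_coeff (1 :: 'a lcs) x"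
    proof (cases "x \<in> range (weight_of w)")
      case True
      then obtain \<alpha> where x: "x = weight_of w \<alpha>" by blast
      have "x = 0 \<longleftrightarrow> \<alpha> = 0"
        unfolding x using injD[OF inj_weight_of[OF w], of \<alpha> 0] by auto
      then show ?thesis
        unfolding x by (simp add: lcs_coeff_weight_embed_weight[OF w] lcs_coeff_one one_fracps_def fracps_X_pow.rep_eq)
    next
      case False
      then have "x \<noteq> 0" using weight_of_0[of w] by (metis rangeI)
      with False show ?thesis by (simp add: lcs_coeff_weight_embed[OF w] lcs_coeff_one)
    qed
  qed
  show "weight_embed w (f + g) = weight_embed w f + weight_embed w g"
    by (rule lcs_eqI) (simp add: lcs_coeff_weight_embed[OF w] plus_fracps.rep_eq)
  show "weight_embed w (f * g) = weight_embed w f * weight_embed w g"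
    by (rule weight_embed_mult[OF w])
  show "f = 0" if "weight_embed w f = 0"
  proof (rule fracps_eqI)
    fix \<alpha>
    show "fracps_coeff f \<alpha> = fracps_coeff 0 \<alpha>"
      using that lcs_coeff_weight_embed_weight[OF w, of f \<alpha>] by (simp add: zero_fracps.rep_eq)
  qed
qed

interpretation of_mps: inj_comm_ring_hom "of_mps :: ('a :: comm_ring_1, 'd :: finite) mps \<Rightarrow> _"
proof
  fix f g :: "('a, 'd) mps"
  show "of_mps 0 = (0 :: ('a, 'd) fracps)" by (rule zero_mps.rep_eq)
  show "of_mps 1 = (1 :: ('a, 'd) fracps)" by (rule one_mps.rep_eq)
  show "of_mps (f + g) = of_mps f + of_mps g" by (rule plus_mps.rep_eq)
  show "of_mps (f * g) = of_mps f * of_mps g" by (rule times_mps.rep_eq)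
  show "f = 0" if "of_mps f = 0" using that by (metis of_mps_inject zero_mps.rep_eq)
qed

definition mps_embed :: "('d \<Rightarrow> real) \<Rightarrow> ('a :: comm_ring_1, 'd :: finite) mps \<Rightarrow> 'a lcs" where
  "mps_embed w f = weight_embed w (of_mps f)"

lemma inj_comm_ring_hom_mps_embed:
  fixes w :: "'d :: finite \<Rightarrow> real"
  assumes w: "generic_weight w"
  shows "inj_comm_ring_hom (mps_embed w :: ('a :: comm_ring_1, 'd) mps \<Rightarrow> 'a lcs)"
proof -
  interpret inj_comm_ring_hom "weight_embed w :: ('a, 'd) fracps \<Rightarrow> 'a lcs"
    by (rule inj_comm_ring_hom_weight_embed[OF w])
  show ?thesis by standard (simp_all add: mps_embed_def hom_distribs)
qed

lemma lcs_coeff_mps_embed_weight: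
  "generic_weight w \<Longrightarrow> lcs_coeff (mps_embed w f) (weight_of w (\<lambda>i. of_nat (m i))) = mps_coeff f m"
  by (simp add: mps_embed_def mps_coeff_def lcs_coeff_weight_embed_weight)

lemma lcs_coeff_mps_embedE:
  fixes f :: "('a :: comm_ring_1, 'd :: finite) mps"
  assumes w: "generic_weight w" "lcs_coeff (mps_embed w f) x \<noteq> 0"
  obtains m :: "'d \<Rightarrow> nat" where "x = weight_of w (\<lambda>i. of_nat (m i))" "mps_coeff f m \<noteq> 0"
proof -
  from w obtain \<alpha> where \<alpha>: "x = weight_of w \<alpha>" "fracps_coeff (of_mps f) \<alpha> \<noteq> 0"
    unfolding mps_embed_def by (rule lcs_coeff_weight_embedE)
  with of_mps[of f] have "\<alpha> \<in> exp_grid 1" by auto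
  then obtain m where "\<alpha> = (\<lambda>i. of_nat (m i))" by (auto simp: exp_grid_def)
  with \<alpha> that[of m] show ?thesis by (simp add: mps_coeff_def)
qed

lemma supp_ge_mps_embed:
  assumes "generic_weight w"
  shows "supp_ge 0 (mps_embed w f)"
  unfolding supp_ge_def
proof (intro allI impI, rule ccontr)
  fix z assume z: "z < 0" "lcs_coeff (mps_embed w f) z \<noteq> 0"
  from lcs_coeff_mps_embedE[OF assms z(2)] obtain m where m: "z = weight_of w (\<lambda>i. of_nat (m i))" by blast
  have "z \<ge> weight_of w 0" unfolding m by (rule weight_of_mono[OF assms]) (simp add: le_fun_def)
  with z(1) show False by simp
qed

section \<open>Logarithmic derivations\<close>

text \<open>
  Operators that are diagonal on monomials: derivations and all products of operators \<open>D - k\<close>.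
\<close>

lift_definition lcs_scale :: "(real \<Rightarrow> 'a) \<Rightarrow> 'a :: mult_zero lcs \<Rightarrow> 'a lcs" is "\<lambda>E f x. E x * f x"
  by (erule left_finite_subset) auto

lemma lcs_coeff_scale: "lcs_coeff (lcs_scale E f) x = E x * lcs_coeff f x"
  by (simp add: lcs_scale.rep_eq)

lemma supp_ge_scale: "supp_ge x f \<Longrightarrow> supp_ge x (lcs_scale E f)"
  by (simp add: supp_ge_def lcs_coeff_scale)

abbreviation lcs_deriv :: "(real \<Rightarrow> rat) \<Rightarrow> 'a :: field_char_0 lcs \<Rightarrow> 'a lcs" where
  "lcs_deriv d \<equiv> lcs_scale (\<lambda>x. of_rat (d x))"

lemma lcs_deriv_add: "lcs_deriv d (f + g) = lcs_deriv d f + lcs_deriv d g"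
  by (rule lcs_eqI) (simp add: lcs_coeff_scale algebra_simps)

lemma lcs_deriv_0 [simp]: "lcs_deriv d 0 = 0"
  by (rule lcs_eqI) (simp add: lcs_coeff_scale)

lemma lcs_deriv_mult:
  fixes f g :: "'a :: field_char_0 lcs"
  assumes d: "rat_linear d"
  shows "lcs_deriv d (f * g) = lcs_deriv d f * g + f * lcs_deriv d g"
proof (rule lcs_eqI)
  fix z
  let ?f = "lcs_coeff f" and ?g = "lcs_coeff g"
  let ?A = "{a. ?f a \<noteq> 0 \<and> ?g (z - a) \<noteq> 0}"
  have A: "finite ?A" using lcs_coeff[of f] lcs_coeff[of g] by (intro finite_conv_support) auto
  have "lcs_coeff (lcs_deriv d f * g) z = (\<Sum>a\<in>?A. lcs_coeff (lcs_deriv d f) a * ?g (z - a))"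
    unfolding times_lcs.rep_eq by (rule real_conv_left[OF A]) (auto simp: lcs_coeff_scale)
  moreover have "lcs_coeff (f * lcs_deriv d g) z = (\<Sum>a\<in>?A. ?f a * lcs_coeff (lcs_deriv d g) (z - a))"
    unfolding times_lcs.rep_eq by (rule real_conv_left[OF A]) (auto simp: lcs_coeff_scale)
  moreover have "lcs_coeff (lcs_deriv d (f * g)) z = (\<Sum>a\<in>?A. of_rat (d z) * (?f a * ?g (z - a)))"
    unfolding lcs_coeff_scale times_lcs.rep_eq real_conv_def by (rule sum_distrib_left)
  moreover have "(\<Sum>a\<in>?A. of_rat (d z) * (?f a * ?g (z - a))) =
    (\<Sum>a\<in>?A. lcs_coeff (lcs_deriv d f) a * ?g (z - a) + ?f a * lcs_coeff (lcs_deriv d g) (z - a))"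
  proof (rule sum.cong[OF refl])
    fix a
    have "of_rat (d z) = (of_rat (d a) + of_rat (d (z - a)) :: 'a)"
      by (simp add: rat_linear_diff[OF d] flip: of_rat_add)
    then show "of_rat (d z) * (?f a * ?g (z - a)) =
      lcs_coeff (lcs_deriv d f) a * ?g (z - a) + ?f a * lcs_coeff (lcs_deriv d g) (z - a)"
      by (simp only: lcs_coeff_scale) (simp add: algebra_simps)
  qed
  ultimately show "lcs_coeff (lcs_deriv d (f * g)) z = lcs_coeff (lcs_deriv d f * g + f * lcs_deriv d g) z"
    by (simp only: lcs_coeff_add sum.distrib)
qed

lemma lcs_deriv_power:
  fixes f :: "'a :: field_char_0 lcs"
  assumes d: "rat_linear d"
  shows "f * lcs_deriv d (f ^ n) = of_nat n * f ^ n * lcs_deriv d f"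
proof (induction n)
  case 0
  have "lcs_deriv d (1 :: 'a lcs) = 0"
    by (rule lcs_eqI) (simp add: lcs_coeff_scale lcs_coeff_one rat_linear_0[OF d])
  then show ?case by simp
next
  case (Suc n)
  have "f * lcs_deriv d (f ^ Suc n) = f * (lcs_deriv d f * f ^ n) + f * (f * lcs_deriv d (f ^ n))"
    by (simp add: lcs_deriv_mult[OF d] algebra_simps)
  then show ?case unfolding Suc.IH by (simp add: algebra_simps)
qed

text \<open>
  The logarithmic derivation \<open>\<Sum>\<^sub>i q\<^sub>i X\<^sub>i \<partial>/\<partial>X\<^sub>i\<close>.
\<close>

lift_definition fracps_deriv :: "('d \<Rightarrow> rat) \<Rightarrow> ('a :: field_char_0, 'd :: finite) fracps \<Rightarrow> ('a, 'd) fracps"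
  is "\<lambda>q f \<alpha>. of_rat (\<Sum>i\<in>UNIV. \<alpha> i * q i) * f \<alpha>"
  by (elim exE conjE) (rule exI, rule conjI, assumption, auto)

lift_definition mps_deriv :: "('d \<Rightarrow> rat) \<Rightarrow> ('a :: field_char_0, 'd :: finite) mps \<Rightarrow> ('a, 'd) mps"
  is fracps_deriv
  by (auto simp: fracps_deriv.rep_eq)

lemma mps_embed_deriv:
  fixes f :: "('a :: field_char_0, 'd :: finite) mps"
  assumes w: "generic_weight w" and d: "rat_linear d" and q: "\<And>i. d (w i) = q i"
  shows "mps_embed w (mps_deriv q f) = lcs_deriv d (mps_embed w f)"
proof (rule lcs_eqI)
  fix x
  show "lcs_coeff (mps_embed w (mps_deriv q f)) x = lcs_coeff (lcs_deriv d (mps_embed w f)) x"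
  proof (cases "x \<in> range (weight_of w)")
    case True
    then obtain \<alpha> where x: "x = weight_of w \<alpha>" by blast
    show ?thesis
      unfolding x by (simp add: mps_embed_def lcs_coeff_scale lcs_coeff_weight_embed_weight[OF w]
          mps_deriv.rep_eq fracps_deriv.rep_eq rat_linear_weight_of[OF d] q)
  next
    case False
    then show ?thesis by (simp add: mps_embed_def lcs_coeff_scale lcs_coeff_weight_embed[OF w])
  qed
qed

lemma mps_deriv_0 [simp]: "mps_deriv q 0 = 0"
  by transfer (rule fracps_eqI, simp add: fracps_deriv.rep_eq zero_fracps.rep_eq)

text \<open>The chain rule for a polynomial with power series coefficients.\<close>

lemma lcs_deriv_poly:
  fixes G :: "('a :: field_char_0, 'd :: finite) mps poly"
  assumes w: "generic_weight w" and d: "rat_linear d" and q: "\<And>i. d (w i) = q i"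
  shows "lcs_deriv d (poly (map_poly (mps_embed w) G) y) =
    poly (map_poly (mps_embed w) (map_poly (mps_deriv q) G)) y +
    poly (map_poly (mps_embed w) (pderiv G)) y * lcs_deriv d y"
proof -
  interpret inj_comm_ring_hom "mps_embed w :: ('a, 'd) mps \<Rightarrow> 'a lcs"
    by (rule inj_comm_ring_hom_mps_embed[OF w])
  interpret P: map_poly_inj_comm_ring_hom "mps_embed w :: ('a, 'd) mps \<Rightarrow> 'a lcs" ..
  show ?thesis
  proof (induction G)
    case (pCons c G)
    have m: "map_poly (mps_deriv q) (pCons c G) = pCons (mps_deriv q c) (map_poly (mps_deriv q) G)"
      by (simp add: poly_eq_iff coeff_map_poly coeff_pCons split: nat.splits)
    show ?case
      unfolding m
      by (simp add: pderiv_pCons hom_distribs lcs_deriv_add lcs_deriv_mult[OF d] pCons.IH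
          mps_embed_deriv[OF w d q] algebra_simps)
  qed simp
qed

section \<open>The resultant, monic division and traces\<close>

lemma sum_in_ideal:
  fixes F G :: "'a :: comm_ring_1"
  assumes "\<And>j. j \<in> A \<Longrightarrow> \<exists>c e. h j = c * F + e * G"
  shows "\<exists>c e. (\<Sum>j\<in>A. h j) = c * F + e * G"
  using assms
proof (induction A rule: infinite_finite_induct)
  case (insert x A)
  then obtain c e c' e' where "h x = c * F + e * G" "(\<Sum>j\<in>A. h j) = c' * F + e' * G" by (meson insertCI)
  with insert show ?case
    by (intro exI[of _ "c + c'"] exI[of _ "e + e'"]) (simp add: algebra_simps)
qed (rule exI[of _ 0], rule exI[of _ 0], simp)+

text \<open>
  The resultant is the determinant of a matrix whose last row consists of multiples of \<open>F\<close> and \<open>G\<close>;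
  expand it along that row.
\<close>

lemma resultant_in_ideal:
  fixes F G :: "'a :: idom poly"
  assumes "degree F + degree G > 0"
  shows "\<exists>c e. [:resultant F G:] = c * F + e * G"
proof -
  let ?n = "degree F + degree G" and ?S = "subresultant_mat 0 F G"
  have S: "?S \<in> carrier_mat ?n ?n" by (intro carrier_matI) simp_all
  have "[:resultant F G:] = det ?S"
    by (simp add: subresultant_def flip: subresultant_resultant)
  also have "\<dots> = (\<Sum>j<?n. ?S $$ (?n - 1, j) * cofactor ?S (?n - 1) j)"
    by (rule laplace_expansion_row[OF S]) (use assms in simp)
  also have "\<exists>c e. \<dots> = c * F + e * G"
  proof (rule sum_in_ideal)
    fix j assume j: "j \<in> {..<?n}"
    let ?C = "cofactor ?S (?n - 1) j"
    have "?S $$ (?n - 1, j) = (if j < degree G then monom 1 (degree G - 1 - j) * F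
        else monom 1 (degree F - 1 - (j - degree G)) * G)"
      using j assms by (subst subresultant_index_mat) (auto simp: Let_def)
    then show "\<exists>c e. ?S $$ (?n - 1, j) * ?C = c * F + e * G"
    proof (cases "j < degree G")
      case True
      with \<open>?S $$ (?n - 1, j) = _\<close> show ?thesis
        by (intro exI[of _ "monom 1 (degree G - 1 - j) * ?C"] exI[of _ 0]) (simp add: mult_ac)
    next
      case False
      with \<open>?S $$ (?n - 1, j) = _\<close> show ?thesis
        by (intro exI[of _ 0] exI[of _ "monom 1 (degree F - 1 - (j - degree G)) * ?C"]) (simp add: mult_ac)
    qed
  qed
  finally show ?thesis .
qed

lemma monic_division_exists:
  fixes p f :: "'a :: comm_ring_1 poly"
  assumes f: "lead_coeff f = 1"
  shows "\<exists>q r. p = q * f + r \<and> (\<forall>i\<ge>degree f. coeff r i = 0)"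
proof (induction "if p = 0 then 0 else Suc (degree p)" arbitrary: p rule: less_induct)
  case less
  show ?case
  proof (cases "p = 0 \<or> degree p < degree f")
    case True
    then show ?thesis by (intro exI[of _ 0] exI[of _ p]) (auto simp: coeff_eq_0)
  next
    case False
    define m where "m = monom (lead_coeff p) (degree p - degree f)"
    have "degree (m * f) \<le> degree p"
      using False degree_mult_le[of m f] degree_monom_le[of "lead_coeff p" "degree p - degree f"]
      unfolding m_def[symmetric] by linarith
    then have "degree (p - m * f) \<le> degree p" by (intro degree_diff_le) simp_all
    moreover have "coeff (p - m * f) (degree p) = 0"
      using False f by (simp add: m_def coeff_monom_mult)
    ultimately have "p - m * f = 0 \<or> degree (p - m * f) < degree p" by (rule eq_zero_or_degree_less)
    then have "\<exists>q r. p - m * f = q * f + r \<and> (\<forall>i\<ge>degree f. coeff r i = 0)"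
      using False by (intro less.hyps) auto
    then obtain q r where "p - m * f = q * f + r" "\<forall>i\<ge>degree f. coeff r i = 0" by blast
    then show ?thesis by (intro exI[of _ "m + q"] exI[of _ r]) (simp add: algebra_simps)
  qed
qed

lemma monic_separable_splits:
  fixes p :: "'a :: alg_closed_field poly"
  assumes p: "lead_coeff p = 1" and sep: "\<And>y. poly p y = 0 \<Longrightarrow> poly (pderiv p) y \<noteq> 0"
  shows "card {y. poly p y = 0} = degree p" "p = (\<Prod>y | poly p y = 0. [:-y, 1:])"
proof -
  have p0: "p \<noteq> 0" using p by auto
  from alg_closed_imp_factorization[OF this] obtain A where
    A: "size A = degree p" "p = (\<Prod>x\<in>#A. [:-x, 1:])" using p by auto
  have roots: "set_mset A = {y. poly p y = 0}"
    by (subst A(2)) (auto simp: poly_prod_mset prod_mset_zero_iff image_iff)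
  have "count A x \<le> 1" for x
  proof (rule ccontr)
    assume "\<not> count A x \<le> 1"
    then have "count A x \<ge> 2" by simp
    then have "replicate_mset 2 x \<subseteq># A" by (simp add: count_le_replicate_mset_subset_eq)
    then obtain B where B: "A = {#x, x#} + B" by (auto simp: mset_subset_eq_exists_conv numeral_2_eq_2)
    define r where "r = (\<Prod>x\<in>#B. [:-x, 1:])"
    have pr: "p = [:-x, 1:] * ([:-x, 1:] * r)" unfolding A(2) B by (simp add: r_def)
    have "poly p x = 0" "poly (pderiv p) x = 0"
      unfolding pr pderiv_mult by simp_all
    with sep show False by blast
  qed
  moreover have "count A x \<ge> 1" if "x \<in># A" for x using that by (simp add: Suc_leI)
  ultimately have "A = mset_set (set_mset A)"
    by (intro multiset_eqI) (auto simp: count_mset_set' le_antisym not_in_iff)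
  then have AR: "A = mset_set {y. poly p y = 0}" by (simp only: roots)
  show "card {y. poly p y = 0} = degree p" using A(1) AR by (metis size_mset_set)
  show "p = (\<Prod>y | poly p y = 0. [:-y, 1:])"
    using A(2) AR by (metis prod_unfold_prod_mset)
qed

lemma monic_eq_prod_roots:
  fixes p :: "'a :: idom poly"
  assumes "lead_coeff p = 1" "card {y. poly p y = 0} = degree p"
  shows "p = (\<Prod>y | poly p y = 0. [:-y, 1:])"
proof -
  let ?R = "{y. poly p y = 0}"
  have fin: "finite ?R" using assms by (intro poly_roots_finite) auto
  have d: "degree (\<Prod>y\<in>?R. [:-y, 1:]) = degree p"
    using assms(2) by (subst degree_prod_eq_sum_degree) auto
  have l: "lead_coeff (\<Prod>y\<in>?R. [:-y, 1:]) = 1" by (simp add: lead_coeff_prod)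
  show ?thesis
    by (rule poly_eqI_degree_lead_coeff[where A = ?R and n = "degree p"])
      (use assms d l fin in \<open>auto simp: poly_prod prod_zero_iff\<close>)
qed

lemma pderiv_at_root:
  fixes R :: "'a :: idom set"
  assumes "finite R" "y \<in> R"
  shows "poly (pderiv (\<Prod>t\<in>R. [:-t, 1:])) y = (\<Prod>t\<in>R - {y}. y - t)"
proof -
  have "poly (pderiv (\<Prod>t\<in>R. [:-t, 1:])) y = (\<Sum>z\<in>R. \<Prod>t\<in>R - {z}. y - t)"
    by (simp add: pderiv_prod pderiv_pCons poly_sum poly_prod)
  also have "\<dots> = (\<Prod>t\<in>R - {y}. y - t) + (\<Sum>z\<in>R - {y}. \<Prod>t\<in>R - {z}. y - t)"
    by (rule sum.remove[OF assms])
  also have "(\<Sum>z\<in>R - {y}. \<Prod>t\<in>R - {z}. y - t) = 0"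
    using assms by (intro sum.neutral ballI prod_zero) auto
  finally show ?thesis by simp
qed

text \<open>
  By Lagrange interpolation the remainder of \<open>G f'\<close> modulo \<open>f\<close> is \<open>\<Sum>\<^sub>y G(y) f / (Y - y)\<close>: both have the value
  \<open>G(y) f'(y)\<close> at each root \<open>y\<close>. Comparing leading coefficients shows that the sum of the values of \<open>G\<close>
  at the roots can be computed over the ring of coefficients, wherever the roots live.
\<close>

lemma trace_by_remainder:
  fixes R :: "'a :: idom set" and G q r :: "'a poly"
  assumes R: "finite R" and f: "f = (\<Prod>t\<in>R. [:-t, 1:])"
    and r: "G * pderiv f = q * f + r" "\<And>i. i \<ge> card R \<Longrightarrow> coeff r i = 0"
  shows "(\<Sum>y\<in>R. poly G y) = coeff r (card R - 1)"
proof (cases "R = {}")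
  case True
  then show ?thesis using r(2) by simp
next
  case False
  define L where "L y = (\<Prod>t\<in>R - {y}. [:-t, 1:])" for y
  have dL: "degree (L y) = card R - 1" if "y \<in> R" for y
    unfolding L_def using R that by (subst degree_prod_eq_sum_degree) auto
  have lL: "coeff (L y) (card R - 1) = 1" if "y \<in> R" for y
    unfolding dL[OF that, symmetric] by (simp add: L_def lead_coeff_prod)
  define S where "S = (\<Sum>y\<in>R. smult (poly G y) (L y))"
  have cR: "card R > 0" using False R by (simp add: card_gt_0_iff)
  have "degree r \<le> card R - 1" using r(2) cR by (intro degree_le) auto
  moreover have "degree S \<le> card R - 1"
    unfolding S_def using dL by (intro degree_sum_le R) (auto intro: order.trans[OF degree_smult_le])
  ultimately have "r = S"
  proof (intro poly_eqI_degree[where A = R])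
    fix x assume x: "x \<in> R"
    have "poly f x = 0" unfolding f using R x by (auto simp: poly_prod prod_zero_iff)
    then have "poly r x = poly G x * poly (pderiv f) x"
      using arg_cong[OF r(1), of "\<lambda>p. poly p x"] by simp
    also have "poly (pderiv f) x = poly (L x) x"
      unfolding f pderiv_at_root[OF R x] by (simp add: L_def poly_prod)
    finally have "poly r x = poly G x * poly (L x) x" .
    moreover have "poly (L y) x = 0" if "y \<in> R" "y \<noteq> x" for y
      unfolding L_def using R x that by (auto simp: poly_prod prod_zero_iff)
    then have "poly S x = poly G x * poly (L x) x"
      unfolding S_def poly_sum using R x by (subst sum.remove[OF R x]) (auto intro!: sum.neutral)
    ultimately show "poly r x = poly S x" by simp
  qed (use cR in auto)
  then show ?thesis using lL by (simp add: S_def coeff_sum)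
qed

text \<open>
  A polynomial \<open>q\<close> without constant term that vanishes at all values of \<open>c\<close> other than \<open>c y\<close> turns the
  power sums into a positive multiple of \<open>q (c y)\<close>.
\<close>

lemma power_sum_nonzero:
  fixes c :: "'b \<Rightarrow> 'a :: field_char_0"
  assumes "finite R" "y \<in> R" "c y \<noteq> 0"
  shows "\<exists>r\<in>{1..card R}. (\<Sum>z\<in>R. c z ^ r) \<noteq> 0"
proof (rule ccontr)
  assume "\<not> ?thesis"
  then have zero: "(\<Sum>z\<in>R. c z ^ r) = 0" if "1 \<le> r" "r \<le> card R" for r
    using that by auto
  define V where "V = c ` R - {c y, 0}"
  define q where "q = [:0, 1:] * (\<Prod>v\<in>V. [:-v, 1:])"
  have V: "finite V" using assms by (simp add: V_def)
  have "card V < card R"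
  proof -
    have "card V \<le> card (c ` R - {c y})" unfolding V_def using assms by (intro card_mono) auto
    also have "\<dots> < card (c ` R)" using assms by (intro card_Diff1_less) auto
    also have "\<dots> \<le> card R" using assms by (intro card_image_le)
    finally show ?thesis .
  qed
  moreover have "degree q \<le> 1 + card V"
    unfolding q_def by (rule order.trans[OF degree_mult_le]) (simp add: degree_prod_eq_sum_degree V)
  ultimately have dq: "degree q \<le> card R" by simp
  have q0: "coeff q 0 = 0" by (simp add: q_def)
  have "(\<Sum>z\<in>R. poly q (c z)) = (\<Sum>i\<le>degree q. coeff q i * (\<Sum>z\<in>R. c z ^ i))"
    by (simp add: poly_altdef sum_distrib_left) (rule sum.swap)
  also have "\<dots> = 0"
  proof (rule sum.neutral, rule ballI)
    fix i assume "i \<in> {..degree q}"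
    then show "coeff q i * (\<Sum>z\<in>R. c z ^ i) = 0"
      using q0 zero[of i] dq by (cases "i = 0") auto
  qed
  finally have s0: "(\<Sum>z\<in>R. poly q (c z)) = 0" .
  have "poly q (c z) = (if c z = c y then poly q (c y) else 0)" if "z \<in> R" for z
    using that V by (auto simp: q_def poly_prod prod_zero_iff V_def)
  then have "(\<Sum>z\<in>R. poly q (c z)) = (\<Sum>z\<in>R. if c z = c y then poly q (c y) else 0)"
    by (intro sum.cong) auto
  also have "\<dots> = of_nat (card {z \<in> R. c z = c y}) * poly q (c y)"
    using assms(1) by (simp add: sum.If_cases Int_def)
  finally have "of_nat (card {z \<in> R. c z = c y}) * poly q (c y) = 0" using s0 by simp
  moreover have "card {z \<in> R. c z = c y} > 0" using assms by (auto simp: card_gt_0_iff)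
  moreover have "poly q (c y) \<noteq> 0"
    using assms(3) V by (auto simp: q_def poly_prod prod_zero_iff V_def)
  ultimately show False by simp
qed

section \<open>The Abhyankar--Jung theorem\<close>

text \<open>
  If the lowest exponent of \<open>y\<close> were negative, the leading term of \<open>p\<close> at \<open>y\<close> would have a strictly
  lower order than all others.
\<close>

lemma supp_ge_integral:
  fixes p :: "'a :: idom lcs poly"
  assumes p: "lead_coeff p = 1" "coeffs_ge 0 p" and y: "poly p y = 0"
  shows "supp_ge 0 y"
proof (cases "y = 0")
  case False
  then obtain x where x: "supp_ge x y" "lcs_coeff y x \<noteq> 0" by (rule supp_ge_obtain_lowest)
  show ?thesis
  proof (rule ccontr)
    assume "\<not> supp_ge 0 y"
    with x have neg: "x < 0" by (meson not_le supp_ge_mono)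
    let ?n = "degree p"
    have "lcs_coeff (coeff p i * y ^ i) (of_nat ?n * x) = 0" if "i < ?n" for i
    proof (rule supp_geD)
      show "supp_ge (of_nat i * x) (coeff p i * y ^ i)"
        using p(2) x(1) by (intro supp_ge_mult_right supp_ge_power) (simp_all add: coeffs_ge_def)
      show "of_nat ?n * x < of_nat i * x" using that neg by simp
    qed
    moreover have "poly p y = (\<Sum>i<?n. coeff p i * y ^ i) + y ^ ?n"
      using p(1) by (simp add: poly_altdef lessThan_Suc_atMost[symmetric])
    ultimately have "lcs_coeff (poly p y) (of_nat ?n * x) = lcs_coeff y x ^ ?n"
      by (simp add: supp_ge_power(2)[OF x(1)])
    with y x(2) show False by simp
  qed
qed simp

lemma map_poly_pderiv_hom:
  fixes h :: "'a :: idom \<Rightarrow> 'b :: idom"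
  assumes "comm_ring_hom h"
  shows "map_poly h (pderiv p) = pderiv (map_poly h p)"
proof -
  interpret comm_ring_hom h by fact
  show ?thesis by (rule poly_eqI) (simp add: coeff_map_poly coeff_pderiv hom_distribs)
qed

abbreviation poly_at :: "('d \<Rightarrow> real) \<Rightarrow> ('a :: comm_ring_1, 'd :: finite) mps poly \<Rightarrow> 'a lcs \<Rightarrow> 'a lcs" where
  "poly_at w G y \<equiv> poly (map_poly (mps_embed w) G) y"

lemma poly_at_hom:
  fixes G H :: "('a :: comm_ring_1, 'd :: finite) mps poly"
  assumes "generic_weight w"
  shows "poly_at w (G + H) y = poly_at w G y + poly_at w H y"
    and "poly_at w (G - H) y = poly_at w G y - poly_at w H y"
    and "poly_at w (G * H) y = poly_at w G y * poly_at w H y"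
    and "poly_at w (G ^ n) y = poly_at w G y ^ n"
    and "poly_at w [:a:] y = mps_embed w a"
    and "poly_at w [:0, 1:] y = y"
    and "poly_at w 0 y = 0"
proof -
  interpret inj_comm_ring_hom "mps_embed w :: ('a, 'd) mps \<Rightarrow> 'a lcs"
    by (rule inj_comm_ring_hom_mps_embed[OF assms])
  interpret P: map_poly_inj_comm_ring_hom "mps_embed w :: ('a, 'd) mps \<Rightarrow> 'a lcs" ..
  show "poly_at w (G + H) y = poly_at w G y + poly_at w H y"
    "poly_at w (G - H) y = poly_at w G y - poly_at w H y"
    "poly_at w (G * H) y = poly_at w G y * poly_at w H y"
    "poly_at w (G ^ n) y = poly_at w G y ^ n"
    "poly_at w [:a:] y = mps_embed w a"
    "poly_at w [:0, 1:] y = y" "poly_at w 0 y = 0"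
    by (simp_all add: hom_distribs)
qed

text \<open>
  The consequence of quasi-ordinarity that drives the proof: the ideal generated by \<open>f\<close> and its
  derivative contains a monomial times a unit. In particular \<open>f\<close> is separable over each of the fields
  that contain the power series.
\<close>

locale monomial_bezout =
  fixes f c e :: "('k :: {alg_closed_field, field_char_0}, 'd :: finite) mps poly"
    and \<delta> u :: "('k, 'd) mps" and \<mu> :: "'d \<Rightarrow> nat"
  assumes monic: "lead_coeff f = 1" and deg: "degree f > 0"
    and bezout: "[:\<delta>:] = c * pderiv f + e * f"
    and delta: "\<delta> = mps_X_pow \<mu> * u" "mps_coeff u 0 \<noteq> 0"
begin

definition roots :: "('d \<Rightarrow> real) \<Rightarrow> 'k lcs set" where
  "roots w = {y. poly_at w f y = 0}"

definition delta_exp :: "'d \<Rightarrow> rat" where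
  "delta_exp = (\<lambda>i. of_nat (\<mu> i))"

lemma embed_delta:
  assumes w: "generic_weight w"
  shows "supp_ge (weight_of w delta_exp) (mps_embed w \<delta>)"
    and "lcs_coeff (mps_embed w \<delta>) (weight_of w delta_exp) \<noteq> 0"
proof -
  interpret inj_comm_ring_hom "mps_embed w :: ('k, 'd) mps \<Rightarrow> 'k lcs"
    by (rule inj_comm_ring_hom_mps_embed[OF w])
  have X: "mps_embed w (mps_X_pow \<mu> :: ('k, 'd) mps) = lcs_monom 1 (weight_of w delta_exp)"
  proof (rule lcs_eqI)
    fix x
    have nn: "(0 :: 'd \<Rightarrow> rat) \<le> (\<lambda>i. of_nat (\<mu> i))" by (simp add: le_fun_def)
    show "lcs_coeff (mps_embed w (mps_X_pow \<mu> :: ('k, 'd) mps)) x = lcs_coeff (lcs_monom 1 (weight_of w delta_exp)) x"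
    proof (cases "x \<in> range (weight_of w)")
      case True
      then obtain \<alpha> where x: "x = weight_of w \<alpha>" by blast
      show ?thesis
        unfolding x mps_embed_def lcs_coeff_weight_embed_weight[OF w] mps_X_pow.rep_eq fracps_X_pow.rep_eq
        using nn by (simp add: lcs_coeff_monom delta_exp_def inj_eq[OF inj_weight_of[OF w]])
    next
      case False
      then show ?thesis
        by (auto simp: mps_embed_def lcs_coeff_weight_embed[OF w] lcs_coeff_monom)
    qed
  qed
  have eq: "mps_embed w \<delta> = lcs_monom 1 (weight_of w delta_exp) * mps_embed w u"
    unfolding delta(1) by (simp add: hom_distribs X)
  show "supp_ge (weight_of w delta_exp) (mps_embed w \<delta>)"
    unfolding eq by (intro supp_ge_mult_left supp_ge_monom supp_ge_mps_embed w order.refl)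
  have "lcs_coeff (mps_embed w u) 0 = mps_coeff u 0"
  proof -
    have "(\<lambda>i. of_nat ((0 :: 'd \<Rightarrow> nat) i)) = (0 :: 'd \<Rightarrow> rat)" by auto
    then show ?thesis
      using lcs_coeff_mps_embed_weight[OF w, of u 0] by (simp only: weight_of_0)
  qed
  then show "lcs_coeff (mps_embed w \<delta>) (weight_of w delta_exp) \<noteq> 0"
    using delta(2) by (simp add: eq lcs_coeff_monom_mult)
qed

lemma roots_properties:
  assumes w: "generic_weight w"
  shows "finite (roots w)" "card (roots w) = degree f"
    "map_poly (mps_embed w) f = (\<Prod>y\<in>roots w. [:-y, 1:])"
    "y \<in> roots w \<Longrightarrow> supp_ge 0 y"
    "y \<in> roots w \<Longrightarrow> mps_embed w \<delta> = poly_at w c y * poly_at w (pderiv f) y"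
proof -
  interpret inj_comm_ring_hom "mps_embed w :: ('k, 'd) mps \<Rightarrow> 'k lcs"
    by (rule inj_comm_ring_hom_mps_embed[OF w])
  interpret P: map_poly_inj_comm_ring_hom "mps_embed w :: ('k, 'd) mps \<Rightarrow> 'k lcs" ..
  let ?p = "map_poly (mps_embed w) f"
  have bez: "mps_embed w \<delta> = poly_at w c y * poly_at w (pderiv f) y" if "poly_at w f y = 0" for y
    using arg_cong[OF bezout, of "\<lambda>p. poly_at w p y"] that by (simp add: poly_at_hom[OF w])
  then show "y \<in> roots w \<Longrightarrow> mps_embed w \<delta> = poly_at w c y * poly_at w (pderiv f) y"
    by (simp add: roots_def)
  have d0: "mps_embed w \<delta> \<noteq> 0" using embed_delta(2)[OF w] by auto
  have lp: "lead_coeff ?p = 1" using monic by simp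
  have sep: "poly (pderiv ?p) y \<noteq> 0" if "poly ?p y = 0" for y
    using bez[OF that] d0 by (auto simp: map_poly_pderiv_hom[OF comm_ring_hom_axioms])
  note split = monic_separable_splits[OF lp sep]
  show "card (roots w) = degree f" using split(1) by (simp add: roots_def)
  then show "finite (roots w)" using deg by (intro card_ge_0_finite) simp
  show "?p = (\<Prod>y\<in>roots w. [:-y, 1:])" using split(2) by (simp add: roots_def)
  have "coeffs_ge 0 ?p" by (simp add: coeffs_ge_def supp_ge_mps_embed[OF w])
  then show "supp_ge 0 y" if "y \<in> roots w"
    using supp_ge_integral[OF lp] that by (simp add: roots_def)
qed

text \<open>
  At the roots for the weights \<open>w\<close>, the operator with eigenvalues \<open>E\<close> coincides with the polynomial \<open>G\<close>
  divided by \<open>\<delta>\<^sup>N\<close>. The point is to find \<open>G\<close> and \<open>N\<close> that are the same for all weights.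
\<close>

definition uniform :: "('d \<Rightarrow> real) \<Rightarrow> (real \<Rightarrow> 'k) \<Rightarrow> ('k, 'd) mps poly \<Rightarrow> nat \<Rightarrow> bool" where
  "uniform w E G N \<longleftrightarrow> (\<forall>y\<in>roots w. mps_embed w \<delta> ^ N * lcs_scale E y = poly_at w G y)"

text \<open>
  Differentiate \<open>f(y) = 0\<close> and multiply by the cofactor \<open>c\<close>.
\<close>

lemma deriv_root:
  assumes w: "generic_weight w" and d: "rat_linear d" and q: "\<And>i. d (w i) = q i"
    and y: "y \<in> roots w"
  shows "mps_embed w \<delta> * lcs_deriv d y = - poly_at w (c * map_poly (mps_deriv q) f) y"
proof -
  have "poly_at w (map_poly (mps_deriv q) f) y + poly_at w (pderiv f) y * lcs_deriv d y = 0"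
    using y lcs_deriv_poly[OF w d q, of f y] by (simp add: roots_def)
  then have "poly_at w (pderiv f) y * lcs_deriv d y = - poly_at w (map_poly (mps_deriv q) f) y"
    by (simp add: eq_neg_iff_add_eq_0 add.commute)
  then show ?thesis
    unfolding roots_properties(5)[OF w y] by (simp add: poly_at_hom[OF w] mult.assoc)
qed

text \<open>
  Composition with one more operator \<open>D - k\<close>, by the Leibniz rule. The new polynomial depends on the
  weights and on \<open>d\<close> only through the values \<open>q\<^sub>i = d(w\<^sub>i)\<close>.
\<close>

lemma uniform_step:
  assumes w: "generic_weight w" and d: "rat_linear d" and q: "\<And>i. d (w i) = q i"
    and U: "uniform w E G N"
  shows "uniform w (\<lambda>x. of_rat (d x - of_int k) * E x)
    ([:\<delta>:] * map_poly (mps_deriv q) G - pderiv G * c * map_poly (mps_deriv q) f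
      - [:of_nat N * mps_deriv q \<delta>:] * G - [:of_int k * \<delta>:] * G) (Suc N)"
  unfolding uniform_def
proof
  fix y assume y: "y \<in> roots w"
  interpret inj_comm_ring_hom "mps_embed w :: ('k, 'd) mps \<Rightarrow> 'k lcs"
    by (rule inj_comm_ring_hom_mps_embed[OF w])
  let ?D = "mps_embed w \<delta>" and ?g = "lcs_scale E y" and ?d = "lcs_deriv d"
  have Gy: "?D ^ N * ?g = poly_at w G y" using U y by (simp add: uniform_def)
  have scale: "lcs_scale (\<lambda>x. of_rat (d x - of_int k) * E x) y = ?d ?g - of_int k * ?g"
  proof (rule lcs_eqI)
    fix x
    have "(of_int k :: 'k lcs) = lcs_monom (of_int k) 0"
      using lcs_const.hom_of_int[of k, where 'a = 'k] by (simp add: lcs_const_def)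
    then have "lcs_coeff (of_int k * ?g) x = of_int k * lcs_coeff ?g x"
      by (simp only: lcs_coeff_monom_mult) simp
    then show "lcs_coeff (lcs_scale (\<lambda>x. of_rat (d x - of_int k) * E x) y) x = lcs_coeff (?d ?g - of_int k * ?g) x"
      by (simp add: lcs_coeff_scale of_rat_diff algebra_simps)
  qed
  have "?D ^ Suc N * ?d ?g = ?D * (?d (?D ^ N * ?g)) - (?D * ?d (?D ^ N)) * ?g"
    by (simp add: lcs_deriv_mult[OF d] algebra_simps)
  also have "\<dots> = ?D * ?d (poly_at w G y) - of_nat N * ?d ?D * poly_at w G y"
    unfolding lcs_deriv_power[OF d] Gy[symmetric] by (simp add: algebra_simps)
  also have "?D * ?d (poly_at w G y) =
      ?D * poly_at w (map_poly (mps_deriv q) G) y + poly_at w (pderiv G) y * (?D * ?d y)"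
    unfolding lcs_deriv_poly[OF w d q] by (simp add: algebra_simps)
  also have "?d ?D = mps_embed w (mps_deriv q \<delta>)" by (rule mps_embed_deriv[OF w d q, symmetric])
  finally have "?D ^ Suc N * ?d ?g = ?D * poly_at w (map_poly (mps_deriv q) G) y
      + poly_at w (pderiv G) y * (?D * ?d y) - of_nat N * mps_embed w (mps_deriv q \<delta>) * poly_at w G y" .
  moreover have "?D ^ Suc N * (of_int k * ?g) = of_int k * ?D * poly_at w G y"
    unfolding Gy[symmetric] by (simp add: algebra_simps)
  ultimately have main: "?D ^ Suc N * lcs_scale (\<lambda>x. of_rat (d x - of_int k) * E x) y =
      ?D * poly_at w (map_poly (mps_deriv q) G) y + poly_at w (pderiv G) y * (?D * ?d y)
      - of_nat N * mps_embed w (mps_deriv q \<delta>) * poly_at w G y - of_int k * ?D * poly_at w G y"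
    unfolding scale right_diff_distrib by simp
  show "?D ^ Suc N * lcs_scale (\<lambda>x. of_rat (d x - of_int k) * E x) y = poly_at w
     ([:\<delta>:] * map_poly (mps_deriv q) G - pderiv G * c * map_poly (mps_deriv q) f
      - [:of_nat N * mps_deriv q \<delta>:] * G - [:of_int k * \<delta>:] * G) y"
    unfolding main deriv_root[OF w d q y]
    by (simp only: poly_at_hom[OF w] hom_mult hom_of_nat hom_of_int) (simp add: algebra_simps)
qed

text \<open>
  The value at \<open>x'\<close> is made an integer by clearing its denominator, because integers are available as
  constants in the ring of power series.
\<close>

lemma separating_derivation:
  assumes "x \<noteq> x'"
  obtains d k where "rat_linear d" "d x' = of_int k" "d x \<noteq> of_int k"
proof -
  from rat_linear_separates[OF assms] obtain d where d: "rat_linear d" "d x \<noteq> d x'" by blast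
  obtain a b where ab: "quotient_of (d x') = (a, b)" by force
  have b: "b > 0" using ab by (rule quotient_of_denom_pos)
  have e: "d x' = of_int a / of_int b" using ab by (rule quotient_of_div)
  show ?thesis
  proof (rule that)
    show "rat_linear (\<lambda>z. of_int b * d z)"
      unfolding rat_linear_def rat_linear_add[OF d(1)] rat_linear_scale[OF d(1)]
      by (simp only: distrib_left mult.left_commute simp_thms)
    have b0: "of_int b \<noteq> (0 :: rat)" using b by simp
    have eq: "of_int b * d x' = of_int a" unfolding e using b0 by (simp only: times_divide_eq_right nonzero_mult_div_cancel_left not_False_eq_True)
    show "of_int b * d x' = of_int a" by (rule eq)
    show "of_int b * d x \<noteq> of_int a"
      unfolding eq[symmetric] using mult_left_cancel[OF b0, of "d x" "d x'"] d(2) by (simp only: not_False_eq_True)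
  qed
qed

text \<open>
  For other weights the same polynomial arises from the functionals with the same values on these
  weights, whose existence is part of genericity.
\<close>

lemma uniform_separation:
  assumes w: "generic_weight w" and S: "finite S" "x \<notin> S"
  shows "\<exists>E G N. (\<forall>x'\<in>S. E x' = 0) \<and> E x \<noteq> 0 \<and> uniform w E G N \<and>
    (\<forall>w'. generic_weight w' \<longrightarrow> (\<exists>E'. uniform w' E' G N))"
  using S
proof (induction S)
  case empty
  have "lcs_scale (\<lambda>_. 1) y = y" for y :: "'k lcs" by (rule lcs_eqI) (simp add: lcs_coeff_scale)
  then have "uniform w' (\<lambda>_. 1) [:0, 1:] 0" if "generic_weight w'" for w'
    unfolding uniform_def by (simp only: poly_at_hom(6)[OF that] power_0 mult_1_left) simp
  with w show ?case by (intro exI[of _ "\<lambda>_. 1"] exI[of _ "[:0, 1:]"] exI[of _ 0]) auto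
next
  case (insert x' S)
  then obtain E G N where IH: "\<forall>x'\<in>S. E x' = 0" "E x \<noteq> 0" "uniform w E G N"
    "\<And>w'. generic_weight w' \<Longrightarrow> \<exists>E'. uniform w' E' G N" by auto
  from insert have "x \<noteq> x'" by auto
  then obtain d k where d: "rat_linear d" "d x' = of_int k" "d x \<noteq> of_int k"
    by (rule separating_derivation)
  define q where "q i = d (w i)" for i
  let ?G = "[:\<delta>:] * map_poly (mps_deriv q) G - pderiv G * c * map_poly (mps_deriv q) f
      - [:of_nat N * mps_deriv q \<delta>:] * G - [:of_int k * \<delta>:] * G"
  let ?E = "\<lambda>x. of_rat (d x - of_int k) * E x"
  have "uniform w ?E ?G (Suc N)" by (rule uniform_step[OF w d(1) _ IH(3)]) (simp add: q_def)
  moreover have "\<exists>E'. uniform w' E' ?G (Suc N)" if w': "generic_weight w'" for w'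
  proof -
    from IH(4)[OF w'] obtain E' where E': "uniform w' E' G N" by blast
    from w' obtain d' where d': "rat_linear d'" "\<And>i. d' (w' i) = q i"
      unfolding generic_weight_def by blast
    from uniform_step[OF w' d' E'] show ?thesis by blast
  qed
  ultimately show ?case
    using IH(1,2) d(2,3) by (intro exI[of _ ?E] exI[of _ ?G] exI[of _ "Suc N"]) auto
qed

lemma uniform_trace: "\<exists>T. \<forall>w. generic_weight w \<longrightarrow> (\<Sum>y\<in>roots w. poly_at w G y) = mps_embed w T"
proof -
  from monic_division_exists[OF monic, of "G * pderiv f"] obtain q r where
    qr: "G * pderiv f = q * f + r" "\<forall>i\<ge>degree f. coeff r i = 0" by blast
  have "(\<Sum>y\<in>roots w. poly_at w G y) = mps_embed w (coeff r (degree f - 1))" if w: "generic_weight w" for w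
  proof -
    interpret inj_comm_ring_hom "mps_embed w :: ('k, 'd) mps \<Rightarrow> 'k lcs"
      by (rule inj_comm_ring_hom_mps_embed[OF w])
    interpret P: map_poly_inj_comm_ring_hom "mps_embed w :: ('k, 'd) mps \<Rightarrow> 'k lcs" ..
    let ?m = "map_poly (mps_embed w)"
    note R = roots_properties[OF w]
    have "?m G * pderiv (?m f) = ?m q * ?m f + ?m r"
      using arg_cong[OF qr(1), of ?m] by (simp add: hom_distribs map_poly_pderiv_hom[OF comm_ring_hom_axioms])
    from trace_by_remainder[OF R(1,3) this] qr(2) R(2) show ?thesis by simp
  qed
  then show ?thesis by blast
qed

lemma root_exponents:
  assumes w: "generic_weight w" and y: "y \<in> roots w" and x: "lcs_coeff y x \<noteq> 0"
  shows "\<exists>\<beta>. \<beta> \<in> exp_grid (fact (degree f)) \<and> x = weight_of w \<beta>"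
proof -
  note R = roots_properties[OF w]
  \<comment> \<open>The terms to be killed: those of order at most \<open>x\<close> in any root, except the ones of order \<open>x\<close>.\<close>
  define S where "S = (\<Union>y\<in>roots w. {z. z \<le> x \<and> lcs_coeff y z \<noteq> 0}) - {x}"
  have "finite {z. z \<le> x \<and> lcs_coeff y z \<noteq> 0}" for y :: "'k lcs"
    using lcs_coeff[of y] by (simp add: left_finiteD)
  then have "finite S" "x \<notin> S" using R(1) by (auto simp: S_def)
  from uniform_separation[OF w this] obtain E G N where
    E: "\<forall>x'\<in>S. E x' = 0" "E x \<noteq> 0" and U: "uniform w E G N"
    and U': "\<And>w'. generic_weight w' \<Longrightarrow> \<exists>E'. uniform w' E' G N" by auto
  define g where "g y = lcs_scale E y" for y
  have g: "supp_ge x (g y)" if "y \<in> roots w" for y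
    unfolding supp_ge_def g_def lcs_coeff_scale
  proof (intro allI impI)
    fix z assume "z < x"
    show "E z * lcs_coeff y z = 0"
    proof (cases "lcs_coeff y z = 0")
      case False
      with that \<open>z < x\<close> have "z \<in> S" by (auto simp: S_def intro!: bexI[of _ y])
      with E(1) show ?thesis by simp
    qed simp
  qed
  from power_sum_nonzero[OF R(1) y, of "\<lambda>y. lcs_coeff (g y) x"] x E(2) R(2) obtain r where
    r: "1 \<le> r" "r \<le> degree f" "(\<Sum>z\<in>roots w. lcs_coeff (g z) x ^ r) \<noteq> 0"
    by (auto simp: g_def lcs_coeff_scale)
  from uniform_trace[of "G ^ r"] obtain T where
    T: "\<And>w. generic_weight w \<Longrightarrow> (\<Sum>y\<in>roots w. poly_at w (G ^ r) y) = mps_embed w T" by blast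
  have T': "mps_embed w' T = mps_embed w' \<delta> ^ (N * r) * (\<Sum>y\<in>roots w'. lcs_scale E' y ^ r)"
    if w': "generic_weight w'" and E': "uniform w' E' G N" for w' E'
  proof -
    have "poly_at w' (G ^ r) y = mps_embed w' \<delta> ^ (N * r) * lcs_scale E' y ^ r" if "y \<in> roots w'" for y
    proof -
      have eq: "poly_at w' G y = mps_embed w' \<delta> ^ N * lcs_scale E' y"
        using that E' by (simp add: uniform_def)
      show ?thesis by (simp only: poly_at_hom(4)[OF w'] eq power_mult power_mult_distrib)
    qed
    then show ?thesis unfolding T[OF w', symmetric] by (simp add: sum_distrib_left)
  qed
  have dpow: "supp_ge (of_nat (N * r) * weight_of w' delta_exp) (mps_embed w' \<delta> ^ (N * r))"
    "lcs_coeff (mps_embed w' \<delta> ^ (N * r)) (of_nat (N * r) * weight_of w' delta_exp) \<noteq> 0"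
    if w': "generic_weight w'" for w'
    using supp_ge_power[OF embed_delta(1)[OF w'], of "N * r"] embed_delta(2)[OF w'] by simp_all
  define P where "P = (\<Sum>y\<in>roots w. g y ^ r)"
  have P: "supp_ge (of_nat r * x) P" "lcs_coeff P (of_nat r * x) \<noteq> 0"
    using r(3) supp_ge_power[OF g] by (auto simp: P_def intro: supp_ge_sum)
  have "mps_embed w T = mps_embed w \<delta> ^ (N * r) * P"
    using T'[OF w U] by (simp add: P_def g_def)
  with lcs_coeff_mult_lowest[OF dpow(1)[OF w] P(1)] dpow(2)[OF w] P(2)
  have "lcs_coeff (mps_embed w T) (of_nat (N * r) * weight_of w delta_exp + of_nat r * x) \<noteq> 0" by simp
  then obtain m0 where m0: "of_nat (N * r) * weight_of w delta_exp + of_nat r * x = weight_of w (\<lambda>i. of_nat (m0 i))"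
    "mps_coeff T m0 \<noteq> 0" using lcs_coeff_mps_embedE[OF w] by blast
  \<comment> \<open>Weights in which the variable \<open>j\<close> is \<open>M'\<close> times heavier turn integrality into this inequality.\<close>
  have ge: "N * r * \<mu> j \<le> m0 j" for j
  proof (rule ccontr)
    assume "\<not> N * r * \<mu> j \<le> m0 j"
    then have lt: "m0 j < N * r * \<mu> j" by simp
    define a where "a i = real (m0 i) - real (N * r * \<mu> i)" for i
    have aj: "a j < 0" using lt by (simp add: a_def flip: of_nat_mult)
    have wj: "w j > 0" using w by (simp add: generic_weight_def)
    define s where "s = (\<Sum>i\<in>UNIV - {j}. w i * a i)"
    obtain M where M: "s < of_nat M * (w j * - a j)"
      using reals_Archimedean3[of "w j * - a j"] wj aj by (auto simp: mult_pos_neg)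
    define M' where "M' = Suc M"
    have M': "s < of_nat M' * (w j * - a j)"
    proof -
      have "of_nat M * (w j * - a j) \<le> of_nat M' * (w j * - a j)"
        using wj aj by (intro mult_right_mono) (auto simp: M'_def mult_nonneg_nonpos)
      with M show ?thesis by linarith
    qed
    define w' where "w' i = of_rat (if i = j then of_nat M' else 1) * w i" for i
    have w': "generic_weight w'"
      unfolding w'_def by (rule generic_weight_rescale[OF w]) (simp add: M'_def)
    from U'[OF w'] obtain E' where E': "uniform w' E' G N" by blast
    have "supp_ge 0 (\<Sum>y\<in>roots w'. lcs_scale E' y ^ r)"
    proof (rule supp_ge_sum)
      fix y assume "y \<in> roots w'"
      then have "supp_ge 0 (lcs_scale E' y)" by (intro supp_ge_scale roots_properties(4)[OF w'])
      from supp_ge_power(1)[OF this, of r] show "supp_ge 0 (lcs_scale E' y ^ r)" by simp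
    qed
    then have "supp_ge (of_nat (N * r) * weight_of w' delta_exp) (mps_embed w' T)"
      unfolding T'[OF w' E'] by (intro supp_ge_mult_left dpow(1)[OF w'])
    moreover have "lcs_coeff (mps_embed w' T) (weight_of w' (\<lambda>i. of_nat (m0 i))) \<noteq> 0"
      using m0(2) by (simp add: lcs_coeff_mps_embed_weight[OF w'])
    ultimately have "of_nat (N * r) * weight_of w' delta_exp \<le> weight_of w' (\<lambda>i. of_nat (m0 i))"
      by (meson not_le supp_geD)
    then have "0 \<le> (\<Sum>i\<in>UNIV. w' i * a i)"
      by (simp add: weight_of_def delta_exp_def a_def sum_distrib_left algebra_simps sum_subtractf)
    also have "(\<Sum>i\<in>UNIV. w' i * a i) = w' j * a j + (\<Sum>i\<in>UNIV - {j}. w' i * a i)"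
      by (rule sum.remove) auto
    also have "(\<Sum>i\<in>UNIV - {j}. w' i * a i) = s"
      unfolding s_def by (rule sum.cong) (auto simp: w'_def)
    also have "w' j * a j = - (of_nat M' * (w j * - a j))" by (simp add: w'_def)
    finally show False using M' by simp
  qed
  define b where "b i = m0 i - N * r * \<mu> i" for i
  define \<beta> where "\<beta> i = (of_nat (b i) / of_nat r :: rat)" for i
  have rf: "r dvd fact (degree f)" using r by (intro dvd_fact) auto
  then obtain t where t: "fact (degree f) = r * t" by (rule dvdE)
  have "(fact (degree f) :: nat) > 0" by simp
  with t have t0: "t > 0" by (cases t) auto
  have "\<beta> \<in> exp_grid (fact (degree f))"
    unfolding exp_grid_def
  proof (rule image_eqI[of _ _ "\<lambda>i. b i * t"])
    show "\<beta> = (\<lambda>i. of_nat (b i * t) / of_nat (fact (degree f)))"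
      using r(1) t0 by (auto simp: \<beta>_def t)
  qed simp
  moreover have "x = weight_of w \<beta>"
  proof -
    have "of_nat r * weight_of w \<beta> = weight_of w (\<lambda>i. of_nat (b i))"
      using r(1) by (simp add: weight_of_def \<beta>_def sum_distrib_left of_rat_divide)
    also have "\<dots> = weight_of w (\<lambda>i. of_nat (m0 i)) - of_nat (N * r) * weight_of w delta_exp"
    proof -
      have "of_rat (of_nat (b i)) * w i = of_rat (of_nat (m0 i)) * w i
          - of_nat (N * r) * (of_rat (delta_exp i) * w i)" for i
      proof -
        have "real (b i) = real (m0 i) - real (N * r) * real (\<mu> i)"
          using ge[of i] by (simp only: b_def of_nat_diff of_nat_mult)
        then show ?thesis by (simp only: of_rat_of_nat_eq delta_exp_def left_diff_distrib mult.assoc)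
      qed
      then show ?thesis by (simp only: weight_of_def sum_subtractf sum_distrib_left)
    qed
    also have "\<dots> = of_nat r * x" using m0(1) by simp
    finally show ?thesis using r(1) by simp
  qed
  ultimately show ?thesis by blast
qed

text \<open>
  The Abhyankar--Jung theorem: by the form of their exponents, all roots in the series field come
  from fractional power series.
\<close>

theorem card_Zer: "card (Zer f) = degree f"
proof -
  obtain w :: "'d \<Rightarrow> real" where w: "generic_weight w" using generic_weight_exists by blast
  interpret W: inj_comm_ring_hom "weight_embed w :: ('k, 'd) fracps \<Rightarrow> 'k lcs"
    by (rule inj_comm_ring_hom_weight_embed[OF w])
  have comp: "poly_at w f (weight_embed w Y) = weight_embed w (poly (map_poly of_mps f) Y)" for Y
  proof -
    have "map_poly (mps_embed w) f = map_poly (weight_embed w) (map_poly of_mps f)"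
      by (rule poly_eqI) (simp add: coeff_map_poly mps_embed_def)
    then show ?thesis by simp
  qed
  have "weight_embed w ` Zer f = roots w"
  proof
    show "weight_embed w ` Zer f \<subseteq> roots w" using comp by (auto simp: Zer_def roots_def)
    show "roots w \<subseteq> weight_embed w ` Zer f"
    proof
      fix y assume y: "y \<in> roots w"
      let ?c = "\<lambda>\<alpha>. lcs_coeff y (weight_of w \<alpha>)"
      have supp: "{\<alpha>. ?c \<alpha> \<noteq> 0} \<subseteq> exp_grid (fact (degree f))"
        using root_exponents[OF w y] injD[OF inj_weight_of[OF w]] by blast
      define Y where "Y = Abs_fracps ?c"
      have "fracps_coeff Y = ?c"
        unfolding Y_def by (subst Abs_fracps_inverse) (use supp in \<open>auto intro!: exI[of _ "fact (degree f)"]\<close>)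
      then have "weight_embed w Y = y"
        using root_exponents[OF w y]
        by (intro lcs_eqI) (auto simp: lcs_coeff_weight_embed[OF w] f_inv_into_f)
      then show "y \<in> weight_embed w ` Zer f"
        using comp[of Y] y by (intro image_eqI[of _ _ Y]) (auto simp: Zer_def roots_def)
    qed
  qed
  moreover have "inj_on (weight_embed w) (Zer f)" by (rule inj_onI) simp
  ultimately have "card (Zer f) = card (roots w)" by (metis card_image)
  then show ?thesis by (simp add: roots_properties(2)[OF w])
qed

end

section \<open>Least exponents and contacts\<close>

text \<open>
  Being a monomial times a unit, in terms of the support; the exponent \<open>\<mu>\<close> is the contact when \<open>f\<close> is a
  difference of two roots.
\<close>

definition least_exponent :: "('a :: zero, 'd) fracps \<Rightarrow> ('d \<Rightarrow> rat) \<Rightarrow> bool" where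
  "least_exponent f \<mu> \<longleftrightarrow> fracps_coeff f \<mu> \<noteq> 0 \<and> (\<forall>\<beta>. fracps_coeff f \<beta> \<noteq> 0 \<longrightarrow> \<mu> \<le> \<beta>)"

lemma least_exponent_unique: "least_exponent f \<mu> \<Longrightarrow> least_exponent f \<nu> \<Longrightarrow> \<mu> = \<nu>"
  by (meson antisym least_exponent_def)

lemma fracps_coeff_diff: "fracps_coeff (f - g) \<alpha> = fracps_coeff f \<alpha> - fracps_coeff g \<alpha>"
  for f g :: "('a :: comm_ring_1, 'd :: finite) fracps"
  by (simp only: minus_fracps_def plus_fracps.rep_eq uminus_fracps.rep_eq) simp

lemma exp_grid_diff:
  assumes "\<alpha> \<in> exp_grid k" "\<beta> \<in> exp_grid k" "\<alpha> \<le> \<beta>"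
  shows "\<beta> - \<alpha> \<in> exp_grid k"
proof (cases "k = 0")
  case True
  then have "\<alpha> = 0" "\<beta> = 0" using assms by (auto simp: exp_grid_def)
  then show ?thesis by (simp add: exp_grid_zero)
next
  case False
  from assms obtain m n where mn: "\<alpha> = (\<lambda>i. of_nat (m i) / of_nat k)" "\<beta> = (\<lambda>i. of_nat (n i) / of_nat k)"
    by (auto simp: exp_grid_def)
  have le: "m i \<le> n i" for i
  proof -
    have "\<alpha> i \<le> \<beta> i" using assms(3) by (simp add: le_fun_def)
    then show ?thesis using False by (simp add: mn divide_le_cancel)
  qed
  have "\<beta> - \<alpha> = (\<lambda>i. of_nat (n i - m i) / of_nat k)"
    by (rule ext) (simp add: mn of_nat_diff le diff_divide_distrib)
  then show ?thesis unfolding exp_grid_def by (intro image_eqI[of _ _ "\<lambda>i. n i - m i"]) simp_all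
qed

lemma fracps_coeff_X_pow_mult:
  fixes u :: "('a :: comm_ring_1, 'd :: finite) fracps"
  assumes "0 \<le> \<mu>"
  shows "fracps_coeff (fracps_X_pow \<mu> * u) \<alpha> = fracps_coeff u (\<alpha> - \<mu>)"
proof -
  have "fracps_coeff (fracps_X_pow \<mu> :: ('a, 'd) fracps) = (\<lambda>\<beta>. if \<beta> = \<mu> then 1 else 0)"
    using assms by (simp add: fracps_X_pow.rep_eq)
  then show ?thesis by (simp only: times_fracps.rep_eq exp_conv_delta)
qed

lemma fracps_coeff_nonneg:
  assumes "fracps_coeff f \<alpha> \<noteq> 0"
  shows "0 \<le> \<alpha>"
proof -
  obtain k where "{\<alpha>. fracps_coeff f \<alpha> \<noteq> 0} \<subseteq> exp_grid k" by (rule fracps_supportE)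
  with assms show ?thesis by (intro exp_grid_nonneg[of \<alpha> k]) blast
qed

lemma least_exponent_iff:
  fixes f :: "('a :: comm_ring_1, 'd :: finite) fracps"
  shows "least_exponent f \<mu> \<longleftrightarrow> 0 \<le> \<mu> \<and> (\<exists>u. f = fracps_X_pow \<mu> * u \<and> fracps_coeff u 0 \<noteq> 0)"
proof
  assume l: "least_exponent f \<mu>"
  then have mu: "fracps_coeff f \<mu> \<noteq> 0" "\<And>\<beta>. fracps_coeff f \<beta> \<noteq> 0 \<Longrightarrow> \<mu> \<le> \<beta>"
    by (auto simp: least_exponent_def)
  have nn: "0 \<le> \<mu>" by (rule fracps_coeff_nonneg[OF mu(1)])
  obtain k where k: "k > 0" "{\<alpha>. fracps_coeff f \<alpha> \<noteq> 0} \<subseteq> exp_grid k" by (rule fracps_supportE)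
  have supp: "{\<alpha>. fracps_coeff f (\<alpha> + \<mu>) \<noteq> 0} \<subseteq> exp_grid k"
  proof
    fix \<alpha> assume "\<alpha> \<in> {\<alpha>. fracps_coeff f (\<alpha> + \<mu>) \<noteq> 0}"
    then have "(\<alpha> + \<mu>) - \<mu> \<in> exp_grid k" using k(2) mu by (intro exp_grid_diff) blast+
    then show "\<alpha> \<in> exp_grid k" by simp
  qed
  define u where "u = Abs_fracps (\<lambda>\<alpha>. fracps_coeff f (\<alpha> + \<mu>))"
  have u: "fracps_coeff u = (\<lambda>\<alpha>. fracps_coeff f (\<alpha> + \<mu>))"
    unfolding u_def by (rule Abs_fracps_inverse) (use supp k in blast)
  have "f = fracps_X_pow \<mu> * u"
    by (rule fracps_eqI) (simp add: fracps_coeff_X_pow_mult[OF nn] u)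
  moreover have "fracps_coeff u 0 \<noteq> 0" using mu(1) by (simp add: u)
  ultimately show "0 \<le> \<mu> \<and> (\<exists>u. f = fracps_X_pow \<mu> * u \<and> fracps_coeff u 0 \<noteq> 0)" using nn by blast
next
  assume "0 \<le> \<mu> \<and> (\<exists>u. f = fracps_X_pow \<mu> * u \<and> fracps_coeff u 0 \<noteq> 0)"
  then obtain u where nn: "0 \<le> \<mu>" and u: "f = fracps_X_pow \<mu> * u" "fracps_coeff u 0 \<noteq> 0" by blast
  have c: "fracps_coeff f \<alpha> = fracps_coeff u (\<alpha> - \<mu>)" for \<alpha>
    unfolding u(1) by (rule fracps_coeff_X_pow_mult[OF nn])
  have "\<mu> \<le> \<beta>" if "fracps_coeff f \<beta> \<noteq> 0" for \<beta>
    using fracps_coeff_nonneg[of u "\<beta> - \<mu>"] that c by (simp add: le_fun_def)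
  then show "least_exponent f \<mu>" using u(2) c by (simp add: least_exponent_def)
qed

lemma contact_eq_least_exponent:
  fixes y z :: "('a :: idom, 'd :: finite) fracps"
  assumes "least_exponent (y - z) \<mu>"
  shows "contact y z = Fin \<mu>"
proof -
  have "y \<noteq> z" using assms by (auto simp: least_exponent_def fracps_coeff_diff)
  moreover have "(THE \<nu>. 0 \<le> \<nu> \<and> (\<exists>u. y - z = fracps_X_pow \<nu> * u \<and> fracps_coeff u 0 \<noteq> 0)) = \<mu>"
    using assms least_exponent_unique by (intro the_equality) (auto simp flip: least_exponent_iff)
  ultimately show ?thesis by (simp add: contact_def)
qed

lemma exp_grid_coordinate_min:
  fixes A :: "('d :: finite \<Rightarrow> rat) set"
  assumes "k > 0" "A \<subseteq> exp_grid k" "A \<noteq> {}"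
  shows "\<exists>a\<in>A. \<forall>b\<in>A. a i \<le> b i"
proof -
  define m where "m a = nat \<lfloor>a i * of_nat k\<rfloor>" for a :: "'d \<Rightarrow> rat"
  have m: "a i = of_nat (m a) / of_nat k" if "a \<in> A" for a
  proof -
    from that assms obtain n where "a = (\<lambda>i. of_nat (n i) / of_nat k)" by (auto simp: exp_grid_def)
    then show ?thesis using assms(1) by (simp add: m_def)
  qed
  from assms(3) obtain a0 where "a0 \<in> A" by auto
  then obtain a where a: "a \<in> A" "\<And>b. b \<in> A \<Longrightarrow> m a \<le> m b"
    using ex_has_least_nat[of "\<lambda>a. a \<in> A" a0 m] by auto
  then have "a i \<le> b i" if "b \<in> A" for b
    using assms(1) m[of a] m[of b] that by (simp add: divide_right_mono)
  with a(1) show ?thesis by blast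
qed

text \<open>
  A divisor of a monomial times a unit is again a monomial times a unit. In each coordinate the
  minimal exponents of the factors add up to that of the product, because on the faces where the minima
  are attained some sum of exponents occurs only once. Hence the exponents \<open>\<beta>\<close>, \<open>\<gamma>\<close> that contribute to
  the least exponent \<open>\<alpha>\<close> of the product are minimal in all coordinates.
\<close>

lemma least_exponent_factor:
  fixes f g :: "('a :: idom, 'd :: finite) fracps"
  assumes "least_exponent (f * g) \<alpha>"
  shows "\<exists>\<mu>. least_exponent f \<mu>"
proof -
  obtain k where k: "k > 0" "{\<alpha>. fracps_coeff f \<alpha> \<noteq> 0} \<subseteq> exp_grid k" "{\<alpha>. fracps_coeff g \<alpha> \<noteq> 0} \<subseteq> exp_grid k"
    using common_grid2[of "fracps_coeff f" "fracps_coeff g"] fracps_coeff[of f] fracps_coeff[of g] by auto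
  let ?F = "{\<alpha>. fracps_coeff f \<alpha> \<noteq> 0}" and ?G = "{\<alpha>. fracps_coeff g \<alpha> \<noteq> 0}"
  have \<alpha>: "fracps_coeff (f * g) \<alpha> \<noteq> 0" "\<And>\<beta>. fracps_coeff (f * g) \<beta> \<noteq> 0 \<Longrightarrow> \<alpha> \<le> \<beta>"
    using assms by (auto simp: least_exponent_def)
  have "{(\<beta>, \<gamma>). \<beta> + \<gamma> = \<alpha> \<and> fracps_coeff f \<beta> \<noteq> 0 \<and> fracps_coeff g \<gamma> \<noteq> 0} \<noteq> {}"
    using \<alpha>(1) unfolding times_fracps.rep_eq exp_conv_def by force
  then obtain \<beta> \<gamma> where bg: "\<beta> + \<gamma> = \<alpha>" "\<beta> \<in> ?F" "\<gamma> \<in> ?G" by blast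
  have "\<beta> i \<le> \<nu> i" if "\<nu> \<in> ?F" for \<nu> i
  proof -
    have ne: "?F \<noteq> {}" "?G \<noteq> {}" using bg by blast+
    from exp_grid_coordinate_min[OF k(1,2) ne(1), of i] obtain a where
      a: "a \<in> ?F" "\<And>b. b \<in> ?F \<Longrightarrow> a i \<le> b i" by blast
    from exp_grid_coordinate_min[OF k(1,3) ne(2), of i] obtain b where
      b: "b \<in> ?G" "\<And>c. c \<in> ?G \<Longrightarrow> b i \<le> c i" by blast
    let ?A = "{x \<in> ?F. x i = a i}" and ?B = "{x \<in> ?G. x i = b i}"
    have "?A \<subseteq> exp_grid k" "?A \<noteq> {}" "?B \<subseteq> exp_grid k" "?B \<noteq> {}" using k a(1) b(1) by blast+
    from unique_sum_exponents[OF k(1) this] obtain x y where x: "x \<in> ?A" and y: "y \<in> ?B"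
      and u: "\<forall>x'\<in>?A. \<forall>y'\<in>?B. x' + y' = x + y \<longrightarrow> x' = x \<and> y' = y"
      by (elim bexE)
    have "{(x', y'). x' + y' = x + y \<and> fracps_coeff f x' \<noteq> 0 \<and> fracps_coeff g y' \<noteq> 0} = {(x, y)}"
    proof (intro equalityI subsetI; clarify)
      fix x' y' assume eq: "x' + y' = x + y" and nz: "fracps_coeff f x' \<noteq> 0" "fracps_coeff g y' \<noteq> 0"
      have "x' i + y' i = a i + b i" using fun_cong[OF eq, of i] x y by simp
      moreover have "a i \<le> x' i" "b i \<le> y' i" using a(2) b(2) nz by blast+
      ultimately have "x' i = a i" "y' i = b i" by linarith+
      with u eq nz show "x' = x \<and> y' = y" by blast
    qed (use x y in auto)
    then have "fracps_coeff (f * g) (x + y) = fracps_coeff f x * fracps_coeff g y"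
      by (simp add: times_fracps.rep_eq exp_conv_def)
    then have "fracps_coeff (f * g) (x + y) \<noteq> 0" using x y by simp
    from le_funD[OF \<alpha>(2)[OF this], of i] have "\<alpha> i \<le> a i + b i" using x y by simp
    moreover have "\<alpha> i = \<beta> i + \<gamma> i" using bg(1) by auto
    moreover have "b i \<le> \<gamma> i" by (rule b(2)[OF bg(3)])
    ultimately have "\<beta> i \<le> a i" by linarith
    also have "a i \<le> \<nu> i" by (rule a(2)[OF that])
    finally show ?thesis .
  qed
  then have "least_exponent f \<beta>" using bg(2) by (auto simp: least_exponent_def le_fun_def)
  then show ?thesis by blast
qed

section \<open>Characters of exponent lattices\<close>

definition zmul :: "int \<Rightarrow> ('d \<Rightarrow> rat) \<Rightarrow> 'd \<Rightarrow> rat" where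
  "zmul c h = (\<lambda>l. of_int c * h l)"

lemma zmul_add: "zmul (a + b) h = zmul a h + zmul b h"
  and zmul_diff: "zmul (a - b) h = zmul a h - zmul b h"
  and zmul_mult: "zmul (a * b) h = zmul a (zmul b h)"
  and zmul_0 [simp]: "zmul 0 h = 0"
  and zmul_1 [simp]: "zmul 1 h = h"
  by (simp_all add: zmul_def fun_eq_iff distrib_right left_diff_distrib)

lemma sum_fun_apply: "(\<Sum>i\<in>A. f i) j = (\<Sum>i\<in>A. f i j)"
  for f :: "'b \<Rightarrow> 'c \<Rightarrow> 'e :: comm_monoid_add"
  by (induction A rule: infinite_finite_induct) auto

definition subgroup_add :: "('d \<Rightarrow> rat) set \<Rightarrow> bool" where
  "subgroup_add N \<longleftrightarrow> 0 \<in> N \<and> (\<forall>a\<in>N. \<forall>b\<in>N. a - b \<in> N)"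

lemma subgroup_add_0: "subgroup_add N \<Longrightarrow> 0 \<in> N"
  and subgroup_add_diff: "subgroup_add N \<Longrightarrow> a \<in> N \<Longrightarrow> b \<in> N \<Longrightarrow> a - b \<in> N"
  by (auto simp: subgroup_add_def)

lemma subgroup_add_uminus: "subgroup_add N \<Longrightarrow> a \<in> N \<Longrightarrow> - a \<in> N"
  using subgroup_add_diff[of N 0 a] subgroup_add_0[of N] by simp

lemma subgroup_add_add: "subgroup_add N \<Longrightarrow> a \<in> N \<Longrightarrow> b \<in> N \<Longrightarrow> a + b \<in> N"
  using subgroup_add_diff[of N a "- b"] subgroup_add_uminus[of N b] by simp

lemma subgroup_add_zmul:
  assumes "subgroup_add N" "a \<in> N"
  shows "zmul c a \<in> N"
proof (induction c rule: int_induct[of _ 0])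
  case base
  show ?case unfolding zmul_0 by (rule subgroup_add_0[OF assms(1)])
next
  case (step1 i)
  show ?case unfolding zmul_add zmul_1 by (rule subgroup_add_add[OF assms(1) step1(2) assms(2)])
next
  case (step2 i)
  show ?case unfolding zmul_diff zmul_1 by (rule subgroup_add_diff[OF assms(1) step2(2) assms(2)])
qed

lemma subgroup_add_sum:
  "subgroup_add N \<Longrightarrow> (\<And>i. i \<in> A \<Longrightarrow> a i \<in> N) \<Longrightarrow> (\<Sum>i\<in>A. a i) \<in> N"
  by (induction A rule: infinite_finite_induct) (auto simp: subgroup_add_0 subgroup_add_add)

definition adjoin :: "('d \<Rightarrow> rat) set \<Rightarrow> ('d \<Rightarrow> rat) \<Rightarrow> ('d \<Rightarrow> rat) set" where
  "adjoin N h = {a + zmul c h | a c. a \<in> N}"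

lemma adjoinI: "a \<in> N \<Longrightarrow> a + zmul c h \<in> adjoin N h"
  by (auto simp: adjoin_def)

lemma subgroup_add_adjoin:
  assumes "subgroup_add N"
  shows "subgroup_add (adjoin N h)"
  unfolding subgroup_add_def
proof (intro conjI ballI)
  show "0 \<in> adjoin N h" using adjoinI[OF subgroup_add_0[OF assms], of 0 h] by simp
  fix a b assume "a \<in> adjoin N h" "b \<in> adjoin N h"
  then obtain x c y d where xy: "x \<in> N" "y \<in> N" "a = x + zmul c h" "b = y + zmul d h"
    by (auto simp: adjoin_def)
  then have "a - b = (x - y) + zmul (c - d) h" by (simp add: zmul_diff)
  with adjoinI[OF subgroup_add_diff[OF assms xy(1,2)]] show "a - b \<in> adjoin N h" by metis
qed

lemma adjoin_base: "N \<subseteq> adjoin N h"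
  using adjoinI[of _ N 0 h] by auto

lemma adjoin_new: "subgroup_add N \<Longrightarrow> h \<in> adjoin N h"
  using adjoinI[OF subgroup_add_0, of N 1 h] by simp

lemma adjoin_subset: "subgroup_add M \<Longrightarrow> N \<subseteq> M \<Longrightarrow> h \<in> M \<Longrightarrow> adjoin N h \<subseteq> M"
  by (auto simp: adjoin_def intro!: subgroup_add_add subgroup_add_zmul)

definition order_mod :: "('d \<Rightarrow> rat) set \<Rightarrow> ('d \<Rightarrow> rat) \<Rightarrow> nat" where
  "order_mod N h = (LEAST n. n > 0 \<and> zmul (int n) h \<in> N)"

lemma order_mod_dvd:
  assumes N: "subgroup_add N" and m: "m > 0" "zmul (int m) h \<in> N"
  shows "order_mod N h > 0" "zmul c h \<in> N \<longleftrightarrow> int (order_mod N h) dvd c"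
proof -
  let ?n = "order_mod N h"
  have n: "?n > 0" "zmul (int ?n) h \<in> N"
    using LeastI[of "\<lambda>n. n > 0 \<and> zmul (int n) h \<in> N" m] m by (simp_all add: order_mod_def)
  then show "?n > 0" by simp
  show "zmul c h \<in> N \<longleftrightarrow> int ?n dvd c"
  proof
    assume "int ?n dvd c"
    then obtain t where "c = int ?n * t" by (rule dvdE)
    then have "zmul c h = zmul t (zmul (int ?n) h)" by (simp add: mult.commute flip: zmul_mult)
    then show "zmul c h \<in> N" using subgroup_add_zmul[OF N n(2)] by simp
  next
    assume c: "zmul c h \<in> N"
    define r where "r = c mod int ?n"
    have r_eq: "r = c - (c div int ?n) * int ?n" by (simp add: r_def minus_div_mult_eq_mod)
    have rN: "zmul r h \<in> N" unfolding r_eq zmul_diff zmul_mult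
      by (rule subgroup_add_diff[OF N c subgroup_add_zmul[OF N n(2)]])
    have r: "0 \<le> r" "r < int ?n" using n(1) by (simp_all add: r_def)
    have "r = 0"
    proof (rule ccontr)
      assume "r \<noteq> 0"
      then have "nat r > 0 \<and> zmul (int (nat r)) h \<in> N" using r rN by simp
      then have "?n \<le> nat r" unfolding order_mod_def by (rule Least_le)
      with r show False by linarith
    qed
    then show "int ?n dvd c" by (auto simp: r_def)
  qed
qed

text \<open>
  The cosets are those of \<open>0, h, \<dots>, (n - 1) h\<close>, where \<open>n\<close> is the order of \<open>h\<close> modulo \<open>N\<close>.
\<close>

lemma add_index_adjoin:
  assumes N: "subgroup_add N" and m: "m > 0" "zmul (int m) h \<in> N"
  shows "add_index (adjoin N h) N = order_mod N h"
proof -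
  let ?n = "order_mod N h" and ?M = "adjoin N h"
  let ?r = "{(x, y). x \<in> ?M \<and> y \<in> ?M \<and> x - y \<in> N}"
  note od = order_mod_dvd[OF N m]
  have M: "zmul c h \<in> ?M" for c using adjoinI[OF subgroup_add_0[OF N]] by (metis add_0)
  define cl where "cl j = ?r `` {zmul (int j) h}" for j
  have "?M // ?r = cl ` {..<?n}"
  proof (intro equalityI subsetI)
    fix X assume "X \<in> ?M // ?r"
    then obtain x where x: "x \<in> ?M" "X = ?r `` {x}" by (auto simp: quotient_def)
    then obtain a c where ac: "a \<in> N" "x = a + zmul c h" by (auto simp: adjoin_def)
    define j where "j = nat (c mod int ?n)"
    have j: "j < ?n" "int j = c mod int ?n" using od(1) by (simp_all add: j_def nat_less_iff)
    have "zmul (c - int j) h \<in> N" unfolding od(2) j(2) by simp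
    from subgroup_add_add[OF N ac(1) this] have d: "x - zmul (int j) h \<in> N"
      unfolding ac(2) zmul_diff add_diff_eq .
    have "x - y \<in> N \<longleftrightarrow> zmul (int j) h - y \<in> N" for y
    proof
      assume "x - y \<in> N"
      from subgroup_add_diff[OF N this d] show "zmul (int j) h - y \<in> N" by simp
    next
      assume "zmul (int j) h - y \<in> N"
      from subgroup_add_add[OF N this d] show "x - y \<in> N" by simp
    qed
    then have "X = cl j" using x M by (auto simp: cl_def)
    with j show "X \<in> cl ` {..<?n}" by blast
  next
    fix X assume "X \<in> cl ` {..<?n}"
    then show "X \<in> ?M // ?r" using M by (auto simp: cl_def quotient_def)
  qed
  moreover have "inj_on cl {..<?n}"
  proof (rule inj_onI)
    fix i j assume ij: "i \<in> {..<?n}" "j \<in> {..<?n}" "cl i = cl j"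
    have "zmul (int i) h \<in> cl i" using M subgroup_add_0[OF N] by (simp add: cl_def)
    then have "zmul (int j) h - zmul (int i) h \<in> N" unfolding ij(3) by (simp add: cl_def)
    then have "int ?n dvd int j - int i" unfolding od(2)[symmetric] zmul_diff .
    then have "int j mod int ?n = int i mod int ?n" by (simp only: mod_eq_dvd_iff)
    then show "i = j" using ij(1,2) by simp
  qed
  ultimately show ?thesis by (simp add: add_index_def card_image)
qed

definition character_on :: "('d \<Rightarrow> rat) set \<Rightarrow> (('d \<Rightarrow> rat) \<Rightarrow> 'k :: field) \<Rightarrow> bool" where
  "character_on N \<chi> \<longleftrightarrow> \<chi> 0 = 1 \<and> (\<forall>a\<in>N. \<forall>b\<in>N. \<chi> (a + b) = \<chi> a * \<chi> b)"

lemma character_on_zmul: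
  assumes N: "subgroup_add N" and \<chi>: "character_on N \<chi>" and a: "a \<in> N"
  shows "\<chi> a \<noteq> 0" "\<chi> (zmul c a) = \<chi> a powi c"
proof -
  have hom: "\<chi> (x + y) = \<chi> x * \<chi> y" if "x \<in> N" "y \<in> N" for x y
    using \<chi> that by (simp add: character_on_def)
  have one: "\<chi> 0 = 1" using \<chi> by (simp add: character_on_def)
  have inv: "\<chi> x * \<chi> (- x) = 1" if "x \<in> N" for x
    using hom[OF that subgroup_add_uminus[OF N that]] one by simp
  then show nz: "\<chi> a \<noteq> 0" using a by force
  show "\<chi> (zmul c a) = \<chi> a powi c"
  proof (induction c rule: int_induct[of _ 0])
    case base
    show ?case unfolding zmul_0 by (simp only: one power_int_0_right)
  next
    case (step1 i)
    have "\<chi> (zmul (i + 1) a) = \<chi> (zmul i a) * \<chi> a"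
      unfolding zmul_add zmul_1 by (rule hom[OF subgroup_add_zmul[OF N a] a])
    also have "\<dots> = \<chi> a powi (i + 1)" unfolding step1 using nz by (simp add: power_int_add)
    finally show ?case .
  next
    case (step2 i)
    have "zmul (i - 1) a + a = zmul i a" by (simp add: zmul_diff)
    then have "\<chi> (zmul (i - 1) a) * \<chi> a = \<chi> (zmul i a)"
      using hom[OF subgroup_add_zmul[OF N a, of "i - 1"] a] by (simp only:)
    also have "\<dots> = \<chi> a powi (i - 1) * \<chi> a"
      unfolding step2 using nz by (simp add: power_int_diff)
    finally show ?case using nz by simp
  qed
qed

text \<open>
  The multiples of \<open>h\<close> in \<open>N\<close> are those of \<open>n h\<close>, where \<open>n\<close> is the order of \<open>h\<close> modulo \<open>N\<close>; so the
  condition on \<open>u\<close> is all that is required for \<open>a + c h \<mapsto> \<chi>(a) u\<^sup>c\<close> to be well defined.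
\<close>

lemma character_extend:
  assumes N: "subgroup_add N" and \<chi>: "character_on N \<chi>" and m: "m > 0" "zmul (int m) h \<in> N"
    and u: "u ^ order_mod N h = \<chi> (zmul (int (order_mod N h)) h)"
  obtains \<chi>' where "character_on (adjoin N h) \<chi>'" "\<And>a. a \<in> N \<Longrightarrow> \<chi>' a = \<chi> a" "\<chi>' h = u"
proof -
  let ?n = "order_mod N h"
  note od = order_mod_dvd[OF N m]
  have nN: "zmul (int ?n) h \<in> N" by (simp add: od(2))
  have hom: "\<chi> (x + y) = \<chi> x * \<chi> y" if "x \<in> N" "y \<in> N" for x y
    using \<chi> that by (simp add: character_on_def)
  have one: "\<chi> 0 = 1" using \<chi> by (simp add: character_on_def)
  have u0: "u \<noteq> 0"
    using u character_on_zmul(1)[OF N \<chi> nN] od(1) by (auto simp: power_0_left)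
  have well: "\<chi> a * u powi c = \<chi> b * u powi d"
    if "a \<in> N" "b \<in> N" "a + zmul c h = b + zmul d h" for a b c d
  proof -
    have eq: "zmul (c - d) h = b - a" using that(3) by (simp add: zmul_diff algebra_simps)
    then have "zmul (c - d) h \<in> N" using subgroup_add_diff[OF N that(2,1)] by simp
    then obtain t where t: "c - d = int ?n * t" using od(2) by (auto elim: dvdE)
    have "\<chi> (b - a) = \<chi> (zmul t (zmul (int ?n) h))"
      unfolding eq[symmetric] t by (simp add: mult.commute flip: zmul_mult)
    also have "\<dots> = u powi (c - d)"
      unfolding character_on_zmul(2)[OF N \<chi> nN] u[symmetric] t by (simp add: power_int_mult)
    finally have "\<chi> b = u powi (c - d) * \<chi> a"
      using hom[OF subgroup_add_diff[OF N that(2,1)] that(1)] by simp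
    then show ?thesis using u0 by (simp add: power_int_diff field_simps)
  qed
  define \<chi>' where "\<chi>' x = (SOME v. \<exists>a c. a \<in> N \<and> x = a + zmul c h \<and> v = \<chi> a * u powi c)" for x
  have \<chi>': "\<chi>' (a + zmul c h) = \<chi> a * u powi c" if a: "a \<in> N" for a c
  proof -
    have "\<exists>v b d. b \<in> N \<and> a + zmul c h = b + zmul d h \<and> v = \<chi> b * u powi d" using a by blast
    from someI_ex[OF this] obtain b d where "b \<in> N" "a + zmul c h = b + zmul d h"
      "\<chi>' (a + zmul c h) = \<chi> b * u powi d" unfolding \<chi>'_def by blast
    with well[OF a this(1,2)] show ?thesis by simp
  qed
  show ?thesis
  proof (rule that)
    show base: "\<chi>' a = \<chi> a" if "a \<in> N" for a using \<chi>'[OF that, of 0] by simp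
    show "\<chi>' h = u" using \<chi>'[OF subgroup_add_0[OF N], of 1] one by simp
    show "character_on (adjoin N h) \<chi>'"
      unfolding character_on_def
    proof (intro conjI ballI)
      show "\<chi>' 0 = 1" using base[OF subgroup_add_0[OF N]] one by simp
      fix x y assume "x \<in> adjoin N h" "y \<in> adjoin N h"
      then obtain a c b d where ab: "a \<in> N" "b \<in> N" "x = a + zmul c h" "y = b + zmul d h"
        by (auto simp: adjoin_def)
      have xy: "x + y = (a + b) + zmul (c + d) h" unfolding ab zmul_add by (simp only: add_ac)
      have "\<chi>' (x + y) = (\<chi> a * \<chi> b) * (u powi c * u powi d)"
        unfolding xy \<chi>'[OF subgroup_add_add[OF N ab(1,2)]] hom[OF ab(1,2)]
        using u0 by (simp add: power_int_add)
      then show "\<chi>' (x + y) = \<chi>' x * \<chi>' y"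
        unfolding ab(3,4) \<chi>'[OF ab(1)] \<chi>'[OF ab(2)] by (simp only: mult_ac)
    qed
  qed
qed

text \<open>The group \<open>(1/k) \<int>\<^sup>d\<close>.\<close>

definition full_grid :: "nat \<Rightarrow> ('d \<Rightarrow> rat) set" where
  "full_grid k = {\<alpha>. \<forall>i. of_nat k * \<alpha> i \<in> \<int>}"

lemma subgroup_add_full_grid: "subgroup_add (full_grid k)"
  by (auto simp: subgroup_add_def full_grid_def right_diff_distrib)

lemma exp_grid_subset_full_grid: "k > 0 \<Longrightarrow> exp_grid k \<subseteq> full_grid k"
  by (auto simp: exp_grid_def full_grid_def)

lemma full_grid_multiple: "h \<in> full_grid k \<Longrightarrow> zmul (int k) h \<in> full_grid 1"
  by (simp add: full_grid_def zmul_def)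

lemma full_grid_1_subset: "full_grid 1 \<subseteq> full_grid k"
  by (auto simp: full_grid_def)

text \<open>
  The grid is generated over \<open>\<int>\<^sup>d\<close> by the unit vectors divided by \<open>k\<close>, which are adjoined one by one.
\<close>

lemma character_extend_full:
  fixes N :: "('d :: finite \<Rightarrow> rat) set" and \<chi> :: "('d \<Rightarrow> rat) \<Rightarrow> 'k :: alg_closed_field"
  assumes k: "k > 0" and N: "subgroup_add N" "full_grid 1 \<subseteq> N" "N \<subseteq> full_grid k" and \<chi>: "character_on N \<chi>"
  obtains \<chi>' where "character_on (full_grid k) \<chi>'" "\<And>a. a \<in> N \<Longrightarrow> \<chi>' a = \<chi> a"
proof -
  define e :: "'d \<Rightarrow> 'd \<Rightarrow> rat" where "e i = (\<lambda>j. if j = i then 1 / of_nat k else 0)" for i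
  have eG: "e i \<in> full_grid k" for i using k by (simp add: e_def full_grid_def)
  have "\<exists>M \<chi>'. subgroup_add M \<and> N \<subseteq> M \<and> e ` I \<subseteq> M \<and> M \<subseteq> full_grid k \<and>
      character_on M \<chi>' \<and> (\<forall>a\<in>N. \<chi>' a = \<chi> a)" if "finite I" for I
    using that
  proof (induction I)
    case empty
    then show ?case using N \<chi> by (intro exI[of _ N] exI[of _ \<chi>]) auto
  next
    case (insert i I)
    then obtain M \<chi>1 where M: "subgroup_add M" "N \<subseteq> M" "e ` I \<subseteq> M" "M \<subseteq> full_grid k"
      "character_on M \<chi>1" "\<forall>a\<in>N. \<chi>1 a = \<chi> a" by blast
    have mult: "zmul (int k) (e i) \<in> M"
      using full_grid_multiple[OF eG] N(2) M(2) by blast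
    have "order_mod M (e i) > 0" by (rule order_mod_dvd(1)[OF M(1) k mult])
    from nth_root_exists[OF this] obtain u where
      "u ^ order_mod M (e i) = \<chi>1 (zmul (int (order_mod M (e i))) (e i))" by blast
    from character_extend[OF M(1,5) k mult this] obtain \<chi>2 where
      \<chi>2: "character_on (adjoin M (e i)) \<chi>2" "\<And>a. a \<in> M \<Longrightarrow> \<chi>2 a = \<chi>1 a" by blast
    show ?case
      using M \<chi>2 adjoin_base[of M "e i"] adjoin_new[OF M(1), of "e i"] eG
        adjoin_subset[OF subgroup_add_full_grid M(4) eG, of i] subgroup_add_adjoin[OF M(1), of "e i"]
      by (intro exI[of _ "adjoin M (e i)"] exI[of _ \<chi>2]) auto
  qed
  from this[OF finite[of UNIV]] obtain M \<chi>' where M: "subgroup_add M" "N \<subseteq> M" "range e \<subseteq> M" "M \<subseteq> full_grid k"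
      "character_on M \<chi>'" "\<forall>a\<in>N. \<chi>' a = \<chi> a" by blast
  have "full_grid k \<subseteq> M"
  proof
    fix \<alpha> :: "'d \<Rightarrow> rat" assume "\<alpha> \<in> full_grid k"
    then have "\<forall>i. \<exists>c. of_nat k * \<alpha> i = of_int c" by (auto simp: full_grid_def elim: Ints_cases)
    then obtain c where c: "\<And>i. of_nat k * \<alpha> i = of_int (c i)" by metis
    have "\<alpha> = (\<Sum>i\<in>UNIV. zmul (c i) (e i))"
    proof
      fix j
      have "(\<Sum>i\<in>UNIV. zmul (c i) (e i)) j = (\<Sum>i\<in>UNIV. zmul (c i) (e i) j)"
        by (rule sum_fun_apply)
      also have "\<dots> = (\<Sum>i\<in>UNIV. if i = j then of_int (c j) / of_nat k else 0)"
        by (rule sum.cong) (auto simp: zmul_def e_def)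
      also have "\<dots> = \<alpha> j" using c[of j] k by (simp add: field_simps)
      finally show "\<alpha> j = (\<Sum>i\<in>UNIV. zmul (c i) (e i)) j" ..
    qed
    moreover have "(\<Sum>i\<in>UNIV. zmul (c i) (e i)) \<in> M"
      using M(3) by (intro subgroup_add_sum subgroup_add_zmul M(1)) blast
    ultimately show "\<alpha> \<in> M" by (simp only:)
  qed
  with M(4) have "M = full_grid k" by blast
  with M(5,6) show ?thesis by (intro that[of \<chi>']) auto
qed

lemma character_with_value:
  fixes N :: "('d :: finite \<Rightarrow> rat) set" and u :: "'k :: alg_closed_field"
  assumes k: "k > 0" and N: "subgroup_add N" "full_grid 1 \<subseteq> N" "N \<subseteq> full_grid k"
    and h: "h \<in> full_grid k" and u: "u ^ order_mod N h = 1"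
  obtains \<chi> :: "('d \<Rightarrow> rat) \<Rightarrow> 'k" where "character_on (full_grid k) \<chi>" "\<And>a. a \<in> N \<Longrightarrow> \<chi> a = 1" "\<chi> h = u"
proof -
  have triv: "character_on N (\<lambda>_. 1 :: 'k)" by (simp add: character_on_def)
  have mult: "zmul (int k) h \<in> N" using full_grid_multiple[OF h] N(2) by blast
  from character_extend[OF N(1) triv k mult, of u] u obtain \<chi>1 where
    \<chi>1: "character_on (adjoin N h) \<chi>1" "\<And>a. a \<in> N \<Longrightarrow> \<chi>1 a = 1" "\<chi>1 h = u" by auto
  have "full_grid 1 \<subseteq> adjoin N h" using N(2) adjoin_base[of N h] by blast
  from character_extend_full[OF k subgroup_add_adjoin[OF N(1)] this
      adjoin_subset[OF subgroup_add_full_grid N(3) h] \<chi>1(1)]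
  obtain \<chi> where \<chi>: "character_on (full_grid k) \<chi>" "\<And>a. a \<in> adjoin N h \<Longrightarrow> \<chi> a = \<chi>1 a" by blast
  show ?thesis
    by (rule that[OF \<chi>(1)]) (use \<chi>(2) \<chi>1(2,3) adjoin_base[of N h] adjoin_new[OF N(1), of h] in auto)
qed

lemma card_roots_of_unity:
  assumes "n > 0"
  shows "card {u :: 'k :: {alg_closed_field, field_char_0}. u ^ n = 1} = n"
proof -
  define p :: "'k poly" where "p = monom 1 n - 1"
  have c: "coeff p i = (if i = n then 1 else if i = 0 then - 1 else 0)" for i
    using assms by (auto simp: p_def coeff_monom)
  have "degree p \<le> n" by (rule degree_le) (auto simp: c)
  moreover have "degree p \<ge> n" by (rule le_degree) (simp add: c)
  ultimately have d: "degree p = n" by simp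
  have r: "poly p u = u ^ n - 1" for u by (simp add: p_def poly_monom)
  have "poly (pderiv p) u \<noteq> 0" if "poly p u = 0" for u
  proof -
    have "u \<noteq> 0" using that assms by (auto simp: r power_0_left)
    then show ?thesis using assms by (simp add: p_def pderiv_diff pderiv_monom poly_monom)
  qed
  from monic_separable_splits(1)[of p, OF _ this] d c show ?thesis by (simp add: r)
qed

text \<open>
  Outside \<open>N\<close> the order of \<open>h\<close> modulo \<open>N\<close> is at least two, so there is a nontrivial root of unity to
  prescribe as the value at \<open>h\<close>.
\<close>

lemma character_separates:
  fixes N :: "('d :: finite \<Rightarrow> rat) set"
  assumes k: "k > 0" and N: "subgroup_add N" "full_grid 1 \<subseteq> N" "N \<subseteq> full_grid k"
    and h: "h \<in> full_grid k" "h \<notin> N"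
  obtains \<chi> :: "('d \<Rightarrow> rat) \<Rightarrow> 'k :: {alg_closed_field, field_char_0}"
  where "character_on (full_grid k) \<chi>" "\<And>a. a \<in> N \<Longrightarrow> \<chi> a = 1" "\<chi> h \<noteq> 1"
proof -
  let ?n = "order_mod N h"
  have mult: "zmul (int k) h \<in> N" using full_grid_multiple[OF h(1)] N(2) by blast
  note od = order_mod_dvd[OF N(1) k mult]
  have "?n \<noteq> 1" using od(2)[of 1] h(2) by auto
  with od(1) have "?n \<ge> 2" by simp
  then have "{u :: 'k. u ^ ?n = 1} \<noteq> {1}" using card_roots_of_unity[OF od(1), where 'k = 'k] by auto
  then obtain u :: 'k where u: "u ^ ?n = 1" "u \<noteq> 1" by auto
  from character_with_value[OF k N h(1) u(1)] u(2) that show ?thesis by metis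
qed

section \<open>Contacts in a set of roots\<close>

lemma least_exponent_minus_commute: "least_exponent (y - z) \<mu> \<Longrightarrow> least_exponent (z - y) \<mu>"
  for y z :: "('a :: comm_ring_1, 'd :: finite) fracps"
proof -
  have "fracps_coeff (z - y) \<alpha> = - fracps_coeff (y - z) \<alpha>" for \<alpha>
    by (simp only: fracps_coeff_diff minus_diff_eq)
  then show "least_exponent (y - z) \<mu> \<Longrightarrow> least_exponent (z - y) \<mu>"
    by (simp add: least_exponent_def)
qed

locale contact_set =
  fixes Z :: "('a :: idom, 'd :: finite) fracps set"
  assumes fin: "finite Z"
    and comparable: "\<And>y z. y \<in> Z \<Longrightarrow> z \<in> Z \<Longrightarrow> y \<noteq> z \<Longrightarrow> \<exists>\<mu>. least_exponent (y - z) \<mu>"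
begin

text \<open>
  Lower bounds for contacts are expressed by coefficients; the ultrametric inequality for the partially
  ordered contacts then becomes the transitivity of this relation.
\<close>

definition agree_below :: "('d \<Rightarrow> rat) \<Rightarrow> ('a, 'd) fracps \<Rightarrow> ('a, 'd) fracps \<Rightarrow> bool" where
  "agree_below h y z \<longleftrightarrow> (\<forall>\<alpha>. \<not> h \<le> \<alpha> \<longrightarrow> fracps_coeff y \<alpha> = fracps_coeff z \<alpha>)"

lemma contact_refl: "contact y y = Pinf"
  by (simp add: contact_def)

lemma contact_cases:
  assumes "y \<in> Z" "z \<in> Z"
  obtains "y = z" "contact y z = Pinf"
  | \<mu> where "y \<noteq> z" "least_exponent (y - z) \<mu>" "contact y z = Fin \<mu>"
  using comparable[OF assms] contact_eq_least_exponent contact_refl that by metis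

lemma contact_eq_Pinf: "y \<in> Z \<Longrightarrow> z \<in> Z \<Longrightarrow> contact y z = Pinf \<longleftrightarrow> y = z"
  using contact_cases[of y z] contact_refl by (metis extended.distinct(1))

lemma contact_commute: "y \<in> Z \<Longrightarrow> z \<in> Z \<Longrightarrow> contact y z = contact z y"
  using contact_cases[of y z] contact_eq_least_exponent least_exponent_minus_commute by metis

lemma least_exponent_diffD:
  fixes y z :: "('a, 'd) fracps"
  assumes "least_exponent (y - z) \<mu>"
  shows "\<not> \<mu> \<le> \<alpha> \<Longrightarrow> fracps_coeff y \<alpha> = fracps_coeff z \<alpha>" "fracps_coeff y \<mu> \<noteq> fracps_coeff z \<mu>"
proof -
  show "fracps_coeff y \<alpha> = fracps_coeff z \<alpha>" if "\<not> \<mu> \<le> \<alpha>"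
    using assms that unfolding least_exponent_def fracps_coeff_diff by (metis right_minus_eq)
  show "fracps_coeff y \<mu> \<noteq> fracps_coeff z \<mu>"
    using assms unfolding least_exponent_def fracps_coeff_diff by auto
qed

lemma contact_ge_iff:
  assumes "y \<in> Z" "z \<in> Z"
  shows "Fin h \<le> contact y z \<longleftrightarrow> agree_below h y z"
proof (cases rule: contact_cases[OF assms])
  case (2 \<mu>)
  note dm = least_exponent_diffD[OF 2(2)]
  show ?thesis
    unfolding 2(3) less_eq_extended.simps agree_below_def using dm order.trans by blast
qed (simp add: agree_below_def)

lemma contact_gt_iff:
  assumes "y \<in> Z" "z \<in> Z"
  shows "Fin h < contact y z \<longleftrightarrow> agree_below h y z \<and> fracps_coeff y h = fracps_coeff z h"
proof (cases rule: contact_cases[OF assms])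
  case (2 \<mu>)
  note dm = least_exponent_diffD[OF 2(2)]
  have "Fin h < contact y z \<longleftrightarrow> Fin h \<le> contact y z \<and> h \<noteq> \<mu>"
    unfolding 2(3) by (auto simp: less_le)
  also have "\<dots> \<longleftrightarrow> agree_below h y z \<and> fracps_coeff y h = fracps_coeff z h"
  proof -
    have "Fin h \<le> contact y z \<longleftrightarrow> h \<le> \<mu>" unfolding 2(3) by simp
    then show ?thesis unfolding contact_ge_iff[OF assms, symmetric] using dm(1)[of h] dm(2) by (metis antisym)
  qed
  finally show ?thesis .
qed (simp add: agree_below_def)

text \<open>
  If \<open>\<mu>\<close> and \<open>\<nu>\<close> were incomparable, both would survive as minimal exponents of \<open>y - z\<close>, which has a
  least exponent.
\<close>

lemma contact_total:
  assumes "x \<in> Z" "y \<in> Z" "z \<in> Z"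
  shows "contact x y \<le> contact x z \<or> contact x z \<le> contact x y"
proof (cases rule: contact_cases[OF assms(1,2)])
  case (2 \<mu>)
  note xy = 2
  show ?thesis
  proof (cases rule: contact_cases[OF assms(1,3)])
    case (2 \<nu>)
    note xz = 2
    show ?thesis
    proof (rule ccontr)
      assume "\<not> ?thesis"
      then have inc: "\<not> \<mu> \<le> \<nu>" "\<not> \<nu> \<le> \<mu>" by (simp_all add: xy(3) xz(3))
      have A: "fracps_coeff (x - y) \<mu> \<noteq> 0" "\<And>\<alpha>. fracps_coeff (x - y) \<alpha> \<noteq> 0 \<Longrightarrow> \<mu> \<le> \<alpha>"
        and B: "fracps_coeff (x - z) \<nu> \<noteq> 0" "\<And>\<alpha>. fracps_coeff (x - z) \<alpha> \<noteq> 0 \<Longrightarrow> \<nu> \<le> \<alpha>"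
        using xy(2) xz(2) by (auto simp: least_exponent_def)
      have diff: "fracps_coeff (y - z) \<alpha> = fracps_coeff (x - z) \<alpha> - fracps_coeff (x - y) \<alpha>" for \<alpha>
        by (simp add: fracps_coeff_diff)
      have m: "fracps_coeff (y - z) \<mu> \<noteq> 0" using A(1) B(2)[of \<mu>] inc diff[of \<mu>] by auto
      then have "y \<noteq> z" by (auto simp: fracps_coeff_diff)
      from comparable[OF assms(2,3) this] obtain \<kappa> where
        k: "fracps_coeff (y - z) \<kappa> \<noteq> 0" "\<And>\<alpha>. fracps_coeff (y - z) \<alpha> \<noteq> 0 \<Longrightarrow> \<kappa> \<le> \<alpha>"
        by (auto simp: least_exponent_def)
      have n: "fracps_coeff (y - z) \<nu> \<noteq> 0" using B(1) A(2)[of \<nu>] inc diff[of \<nu>] by auto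
      have "\<kappa> \<le> \<mu>" "\<kappa> \<le> \<nu>" using k(2) m n by auto
      moreover have "\<nu> \<le> \<kappa> \<or> \<mu> \<le> \<kappa>"
        using A(2)[of \<kappa>] B(2)[of \<kappa>] k(1) unfolding diff[of \<kappa>]
        by (cases "fracps_coeff (x - y) \<kappa> = 0") simp_all
      ultimately show False using inc order.trans by blast
    qed
  qed simp
qed simp

lemma agree_below_trans: "agree_below h x y \<Longrightarrow> agree_below h y z \<Longrightarrow> agree_below h x z"
  and agree_below_sym: "agree_below h x y \<Longrightarrow> agree_below h y x"
  by (auto simp: agree_below_def)

text \<open>
  The contacts with one fixed element \<open>y\<close> form a finite chain, and by the ultrametric inequality the
  least of them bounds all other contacts.
\<close>

lemma bar_height_least:
  assumes B: "B \<subseteq> Z" "B \<noteq> {}"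
  shows "\<exists>y\<in>B. \<exists>z\<in>B. bar_height B = contact y z"
    and "\<And>y z. y \<in> B \<Longrightarrow> z \<in> B \<Longrightarrow> bar_height B \<le> contact y z"
proof -
  from B(2) obtain y where y: "y \<in> B" by blast
  let ?C = "contact y ` B"
  have C: "finite ?C" "?C \<noteq> {}" using B finite_subset[OF B(1) fin] by auto
  from finite_has_minimal[OF C] obtain m where m: "m \<in> ?C" "\<forall>b\<in>?C. b \<le> m \<longrightarrow> m = b" by blast
  then obtain z where z: "z \<in> B" "m = contact y z" by blast
  have min1: "m \<le> contact y v" if "v \<in> B" for v
    using contact_total[of y z v] m(2) that y z B(1) by (metis image_eqI order.refl subsetD)
  have min: "m \<le> contact u v" if "u \<in> B" "v \<in> B" for u v
  proof -
    have yZ: "y \<in> Z" "u \<in> Z" "v \<in> Z" "z \<in> Z" using that y z B(1) by auto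
    show ?thesis
    proof (cases rule: contact_cases[OF yZ(1,4)])
      case 1
      then have "m = Pinf" using z(2) by simp
      then have "u = y" "v = y"
        using min1[OF that(1)] min1[OF that(2)] contact_eq_Pinf yZ by auto
      then show ?thesis by (simp add: contact_refl)
    next
      case (2 h)
      then have m: "m = Fin h" using z(2) by simp
      have "agree_below h y u" "agree_below h y v"
        using min1[OF that(1)] min1[OF that(2)] yZ by (simp_all add: m contact_ge_iff)
      then have "agree_below h u v" using agree_below_trans agree_below_sym by blast
      then show ?thesis using yZ by (simp add: m contact_ge_iff)
    qed
  qed
  have "bar_height B = m"
    unfolding bar_height_def by (rule Least_equality) (use y z min in auto)
  with y z min show "\<exists>y\<in>B. \<exists>z\<in>B. bar_height B = contact y z"
    "\<And>y z. y \<in> B \<Longrightarrow> z \<in> B \<Longrightarrow> bar_height B \<le> contact y z" by auto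
qed

lemma bar_height_Pinf:
  assumes "B \<subseteq> Z" "B \<noteq> {}" "bar_height B = Pinf" "y \<in> B" "z \<in> B"
  shows "y = z"
proof -
  have "contact y z = Pinf" using bar_height_least(2)[OF assms(1,2,4,5)] assms(3) by simp
  then show ?thesis using contact_eq_Pinf[of y z] assms by blast
qed

lemma mem_postbars_iff:
  assumes "bar_height B = Fin h"
  shows "P \<in> postbars B \<longleftrightarrow> (\<exists>y\<in>B. P = {z \<in> B. Fin h < contact y z})"
  unfolding postbars_def using assms by (auto simp: quotient_def)

lemma bar_agree_below:
  assumes "B \<subseteq> Z" "B \<noteq> {}" "bar_height B = Fin h" "y \<in> B" "z \<in> B"
  shows "agree_below h y z"
  using bar_height_least(2)[OF assms(1,2,4,5)] assms by (metis contact_ge_iff subsetD)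

lemma contact_gt_in_bar:
  assumes "B \<subseteq> Z" "B \<noteq> {}" "bar_height B = Fin h" "y \<in> B" "z \<in> B"
  shows "Fin h < contact y z \<longleftrightarrow> fracps_coeff y h = fracps_coeff z h"
  using bar_agree_below[OF assms] contact_gt_iff[of y z h] assms by blast

text \<open>
  Within a bar, a contact exceeds the height exactly when the coefficients at the height agree, so these
  coefficients label the postbars. Two elements whose contact is the height give two labels.
\<close>

lemma card_postbars:
  assumes B: "B \<subseteq> Z" "B \<noteq> {}" "bar_height B = Fin h"
  shows "card (postbars B) = card ((\<lambda>y. fracps_coeff y h) ` B)"
    and "card ((\<lambda>y. fracps_coeff y h) ` B) \<ge> 2"
proof -
  let ?c = "\<lambda>y. fracps_coeff y h"
  define P where "P v = {z \<in> B. v = ?c z}" for v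
  have "postbars B = P ` ?c ` B"
    using contact_gt_in_bar[OF B] by (auto simp: mem_postbars_iff[OF B(3)] P_def set_eq_iff image_iff)
  moreover have "inj_on P (?c ` B)" by (rule inj_onI) (auto simp: P_def)
  ultimately show "card (postbars B) = card (?c ` B)" by (simp add: card_image)
  from bar_height_least(1)[OF B(1,2)] obtain y z where yz: "y \<in> B" "z \<in> B" "bar_height B = contact y z" by blast
  then have "?c y \<noteq> ?c z" using contact_gt_in_bar[OF B yz(1,2)] B(3) by auto
  then have "card {?c y, ?c z} = 2" by simp
  moreover have "card {?c y, ?c z} \<le> card (?c ` B)"
    using yz finite_subset[OF B(1) fin] by (intro card_mono) auto
  ultimately show "card (?c ` B) \<ge> 2" by simp
qed

lemma postbar_props:
  assumes B: "B \<subseteq> Z" "B \<noteq> {}" "bar_height B = Fin h" and P: "P \<in> postbars B"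
  shows "P \<subseteq> B" "P \<noteq> {}" "bar_height B < bar_height P"
proof -
  from P obtain y where y: "y \<in> B" "P = {z \<in> B. Fin h < contact y z}"
    unfolding mem_postbars_iff[OF B(3)] by blast
  then show sub: "P \<subseteq> B" by blast
  have "y \<in> P" using y by (simp add: contact_refl)
  then show ne: "P \<noteq> {}" by blast
  from sub B(1) have "P \<subseteq> Z" by blast
  from bar_height_least(1)[OF this ne] obtain u v where uv: "u \<in> P" "v \<in> P" "bar_height P = contact u v" by blast
  have "fracps_coeff u h = fracps_coeff v h"
    using uv(1,2) y contact_gt_in_bar[OF B y(1)] by (metis (no_types, lifting) mem_Collect_eq)
  then show "bar_height B < bar_height P"
    using uv sub contact_gt_in_bar[OF B, of u v] by (auto simp: B(3))
qed

end

section \<open>The action of characters on fractional power series\<close>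

abbreviation on_grid :: "nat \<Rightarrow> ('a :: zero, 'd) fracps \<Rightarrow> bool" where
  "on_grid k f \<equiv> {\<alpha>. fracps_coeff f \<alpha> \<noteq> 0} \<subseteq> exp_grid k"

text \<open>
  The action \<open>X\<^sup>\<alpha> \<mapsto> \<chi>(\<alpha>) X\<^sup>\<alpha>\<close>. Characters are only multiplicative on a fixed grid, so this is a ring
  homomorphism on the series supported there.
\<close>

lift_definition twist :: "(('d \<Rightarrow> rat) \<Rightarrow> 'a) \<Rightarrow> ('a :: mult_zero, 'd) fracps \<Rightarrow> ('a, 'd) fracps"
  is "\<lambda>\<chi> f \<alpha>. \<chi> \<alpha> * f \<alpha>"
  by (elim exE conjE) (rule exI, rule conjI, assumption, auto)

lemma fracps_coeff_twist: "fracps_coeff (twist \<chi> f) \<alpha> = \<chi> \<alpha> * fracps_coeff f \<alpha>"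
  by (simp add: twist.rep_eq)

lemma twist_mult:
  fixes f g :: "('a :: field, 'd :: finite) fracps"
  assumes k: "k > 0" and \<chi>: "character_on (full_grid k) \<chi>" and f: "on_grid k f" and g: "on_grid k g"
  shows "twist \<chi> (f * g) = twist \<chi> f * twist \<chi> g"
proof (rule fracps_eqI)
  fix \<alpha>
  have f': "on_grid k (twist \<chi> f)" and g': "on_grid k (twist \<chi> g)"
    using f g by (auto simp: fracps_coeff_twist)
  have "fracps_coeff (twist \<chi> f * twist \<chi> g) \<alpha> =
      (\<Sum>(\<beta>, \<gamma>)\<in>exp_decomps k \<alpha>. fracps_coeff (twist \<chi> f) \<beta> * fracps_coeff (twist \<chi> g) \<gamma>)"
    unfolding times_fracps.rep_eq by (rule exp_conv_grid[OF k f' g'])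
  also have "\<dots> = (\<Sum>(\<beta>, \<gamma>)\<in>exp_decomps k \<alpha>. \<chi> \<alpha> * (fracps_coeff f \<beta> * fracps_coeff g \<gamma>))"
  proof (rule sum.cong[OF refl], clarify)
    fix \<beta> \<gamma> assume "(\<beta>, \<gamma>) \<in> exp_decomps k \<alpha>"
    then have "\<beta> \<in> full_grid k" "\<gamma> \<in> full_grid k" "\<alpha> = \<beta> + \<gamma>"
      using exp_grid_subset_full_grid[OF k] by (auto simp: exp_decomps_def)
    then have "\<chi> \<alpha> = \<chi> \<beta> * \<chi> \<gamma>" using \<chi> by (simp add: character_on_def)
    then show "fracps_coeff (twist \<chi> f) \<beta> * fracps_coeff (twist \<chi> g) \<gamma> = \<chi> \<alpha> * (fracps_coeff f \<beta> * fracps_coeff g \<gamma>)"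
      by (simp add: fracps_coeff_twist)
  qed
  also have "\<dots> = fracps_coeff (twist \<chi> (f * g)) \<alpha>"
    unfolding fracps_coeff_twist times_fracps.rep_eq exp_conv_grid[OF k f g]
    by (simp add: sum_distrib_left case_prod_unfold)
  finally show "fracps_coeff (twist \<chi> (f * g)) \<alpha> = fracps_coeff (twist \<chi> f * twist \<chi> g) \<alpha>" ..
qed

lemma twist_add: "twist \<chi> (f + g) = twist \<chi> f + twist \<chi> g"
  for f g :: "('a :: field, 'd :: finite) fracps"
  by (rule fracps_eqI) (simp add: fracps_coeff_twist plus_fracps.rep_eq distrib_left)

lemma twist_zero: "twist \<chi> 0 = (0 :: ('a :: field, 'd :: finite) fracps)"
  by (rule fracps_eqI) (simp add: fracps_coeff_twist zero_fracps.rep_eq)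

lemma twist_of_mps:
  fixes a :: "('a :: field, 'd :: finite) mps"
  assumes "\<And>\<alpha>. \<alpha> \<in> full_grid 1 \<Longrightarrow> \<chi> \<alpha> = 1"
  shows "twist \<chi> (of_mps a) = of_mps a"
proof (rule fracps_eqI)
  fix \<alpha>
  show "fracps_coeff (twist \<chi> (of_mps a)) \<alpha> = fracps_coeff (of_mps a) \<alpha>"
    using of_mps[of a] assms[of \<alpha>] exp_grid_subset_full_grid[of 1]
    by (cases "fracps_coeff (of_mps a) \<alpha> = 0") (auto simp: fracps_coeff_twist)
qed

lemma twist_poly:
  fixes p :: "('a :: field, 'd :: finite) mps poly"
  assumes k: "k > 0" and \<chi>: "character_on (full_grid k) \<chi>" "\<And>\<alpha>. \<alpha> \<in> full_grid 1 \<Longrightarrow> \<chi> \<alpha> = 1"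
    and y: "on_grid k y"
  shows "poly (map_poly of_mps p) (twist \<chi> y) = twist \<chi> (poly (map_poly of_mps p) y)"
proof -
  have grid: "on_grid k (poly (map_poly of_mps q) y)" for q :: "('a, 'd) mps poly"
  proof (induction q)
    case (pCons a q)
    have "on_grid k (of_mps a)" using of_mps[of a] exp_grid_mono[of 1 k] k by auto
    with pCons.IH y show ?case
      by (simp add: hom_distribs plus_fracps.rep_eq times_fracps.rep_eq exp_add_support exp_conv_support)
  qed (simp add: zero_fracps.rep_eq)
  have const: "twist \<chi> (of_mps a) = of_mps a" for a :: "('a, 'd) mps"
    by (rule twist_of_mps) (rule \<chi>(2))
  show ?thesis
  proof (induction p)
    case (pCons a p)
    then show ?case
      by (simp add: hom_distribs twist_add twist_mult[OF k \<chi>(1) y grid] const)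
  qed (simp add: twist_zero)
qed

section \<open>Tree models of a given type\<close>

text \<open>
  What the tree argument uses of \<open>f\<close>: the conclusion of the Abhyankar--Jung theorem, the existence of
  contacts, and the type of the tree. The list \<open>hs\<close> starts with index \<open>0\<close>, so \<open>H i\<close> is \<open>h\<^sub>i\<^sub>+\<^sub>1\<close> and
  \<open>L i\<close> is \<open>N\<^sub>i\<close>.
\<close>

locale typed_tree =
  fixes f :: "('k :: {alg_closed_field, field_char_0}, 'd :: finite) mps poly"
    and hs :: "('d \<Rightarrow> rat) list"
  assumes monic: "lead_coeff f = 1" and deg: "degree f > 0"
    and card_Zer: "card (Zer f) = degree f"
    and differences: "\<And>y z. y \<in> Zer f \<Longrightarrow> z \<in> Zer f \<Longrightarrow> y \<noteq> z \<Longrightarrow> \<exists>\<mu>. least_exponent (y - z) \<mu>"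
    and type: "tree_of_type (tree_model f) hs"
begin

sublocale contact_set "Zer f"
proof
  show "finite (Zer f)" using card_Zer deg by (intro card_ge_0_finite) simp
qed (rule differences)

abbreviation H :: "nat \<Rightarrow> ('d \<Rightarrow> rat) extended" where "H \<equiv> ext_height hs"
abbreviation L :: "nat \<Rightarrow> ('d \<Rightarrow> rat) set" where "L \<equiv> exp_lattice hs"

lemma H_Fin: "i < length hs \<Longrightarrow> H i = Fin (hs ! i)"
  and H_Pinf: "H (length hs) = Pinf"
  by (simp_all add: ext_height_def)

lemma Zer_nonempty: "Zer f \<noteq> {}"
  using card_Zer deg by auto

lemma bar_subset: "B \<in> tree_model f \<Longrightarrow> B \<subseteq> Zer f \<and> B \<noteq> {}"
proof (induction rule: tree_model.induct)
  case root
  then show ?case using Zer_nonempty by simp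
next
  case (postbar B P)
  have "bar_height B \<noteq> Pinf" using postbar by (auto simp: postbars_def)
  moreover from bar_height_least(1)[of B] postbar.IH obtain y z where
    yz: "y \<in> Zer f" "z \<in> Zer f" "bar_height B = contact y z" by blast
  ultimately obtain h where "bar_height B = Fin h" using contact_cases[OF yz(1,2)] by metis
  then show ?case using postbar_props[of B h P] postbar by blast
qed

lemma heights: "bar_height ` tree_model f = H ` {..length hs}"
  using type by (simp add: tree_of_type_def)

lemma bar_of_height:
  assumes "B \<in> tree_model f" "i < length hs" "bar_height B = H i"
  shows "card (postbars B) = add_index (L (Suc i)) (L i)" "\<And>P. P \<in> postbars B \<Longrightarrow> bar_height P = H (Suc i)"
  using type assms by (simp_all add: tree_of_type_def)

lemma H_Suc:
  assumes i: "i < length hs"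
  shows "H i < H (Suc i)"
proof -
  have "H i \<in> bar_height ` tree_model f" using heights i by auto
  then obtain B where B: "B \<in> tree_model f" "bar_height B = H i" by force
  have sub: "B \<subseteq> Zer f" "B \<noteq> {}" using bar_subset[OF B(1)] by auto
  have h: "bar_height B = Fin (hs ! i)" using B(2) i by (simp add: H_Fin)
  from sub(2) obtain y where "y \<in> B" by blast
  then obtain P where P: "P \<in> postbars B" using mem_postbars_iff[OF h] by blast
  from postbar_props(3)[OF sub h P] bar_of_height(2)[OF B(1) i B(2) P] B(2) show ?thesis by simp
qed

lemma H_mono: "i < j \<Longrightarrow> j \<le> length hs \<Longrightarrow> H i < H j"
proof (induction j)
  case (Suc j)
  then show ?case using H_Suc[of j] by (cases "i = j") (auto intro: less_trans)
qed simp

lemma hs_less: "i < j \<Longrightarrow> j < length hs \<Longrightarrow> hs ! i < hs ! j"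
  using H_mono[of i j] by (simp add: H_Fin)

text \<open>
  The bar of height \<open>H i\<close> that contains \<open>y\<close> (\<open>bar_in_tree\<close>). A closed form replaces following the chain
  of postbars from the root.
\<close>

definition bar :: "nat \<Rightarrow> ('k, 'd) fracps \<Rightarrow> ('k, 'd) fracps set" where
  "bar i y = {z \<in> Zer f. \<forall>j<i. H j < contact y z}"

text \<open>
  The root of the tree has the least height among all bars, and \<open>H 0\<close> occurs as a height.
\<close>

lemma root_height: "bar_height (Zer f) = H 0"
proof -
  have "bar_height (Zer f) \<in> H ` {..length hs}" using heights tree_model.root by blast
  then obtain r where r: "r \<le> length hs" "bar_height (Zer f) = H r" by blast
  have "H 0 \<in> bar_height ` tree_model f" using heights by auto
  then obtain B where B: "B \<in> tree_model f" "bar_height B = H 0" by force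
  have sub: "B \<subseteq> Zer f" "B \<noteq> {}" using bar_subset[OF B(1)] by auto
  from bar_height_least(1)[OF sub] obtain y z where "y \<in> B" "z \<in> B" "H 0 = contact y z" using B(2) by auto
  then have "H r \<le> H 0" using bar_height_least(2)[of "Zer f" y z] sub r by auto
  then have "r = 0" using H_mono[of 0 r] r(1) by (cases "r = 0") auto
  with r show ?thesis by simp
qed

lemma bar_in_tree:
  assumes y: "y \<in> Zer f"
  shows "i \<le> length hs \<Longrightarrow> bar i y \<in> tree_model f \<and> bar_height (bar i y) = H i"
proof (induction i)
  case 0
  have "bar 0 y = Zer f" by (auto simp: bar_def)
  then show ?case using tree_model.root root_height by simp
next
  case (Suc i)
  then have i: "i < length hs" and IH: "bar i y \<in> tree_model f" "bar_height (bar i y) = H i" by auto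
  have h: "bar_height (bar i y) = Fin (hs ! i)" using IH(2) i by (simp add: H_Fin)
  have ybar: "y \<in> bar i y"
    using y H_Fin i by (auto simp: bar_def contact_refl)
  have "bar (Suc i) y = {z \<in> bar i y. Fin (hs ! i) < contact y z}"
    using i by (auto simp: bar_def less_Suc_eq H_Fin)
  then have P: "bar (Suc i) y \<in> postbars (bar i y)"
    unfolding mem_postbars_iff[OF h] using ybar by blast
  then show ?case
    using tree_model.postbar[OF IH(1) P] bar_of_height(2)[OF IH(1) i IH(2) P] by simp
qed

lemma bar_props:
  assumes "y \<in> Zer f" "i \<le> length hs"
  shows "bar i y \<subseteq> Zer f" "bar i y \<noteq> {}" "y \<in> bar i y" "bar_height (bar i y) = H i"
  using bar_in_tree[OF assms] assms
  by (auto simp: bar_def contact_refl H_Fin)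

lemma mem_bar_iff:
  assumes "y \<in> Zer f" "i \<le> length hs"
  shows "z \<in> bar i y \<longleftrightarrow> z \<in> Zer f \<and> (\<forall>j<i. agree_below (hs ! j) y z \<and> fracps_coeff y (hs ! j) = fracps_coeff z (hs ! j))"
  using assms by (auto simp: bar_def H_Fin contact_gt_iff)

lemma bar_eq:
  assumes "y \<in> Zer f" "i \<le> length hs" "z \<in> bar i y"
  shows "bar i z = bar i y"
proof -
  have z: "z \<in> Zer f" using bar_props(1)[OF assms(1,2)] assms(3) by blast
  have yz: "agree_below (hs ! j) y z" "fracps_coeff y (hs ! j) = fracps_coeff z (hs ! j)" if "j < i" for j
    using assms that by (simp_all add: mem_bar_iff)
  show ?thesis
  proof (rule Set.set_eqI)
    fix x
    show "x \<in> bar i z \<longleftrightarrow> x \<in> bar i y"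
      unfolding mem_bar_iff[OF z assms(2)] mem_bar_iff[OF assms(1,2)]
      using yz agree_below_trans agree_below_sym by metis
  qed
qed

lemma bar_last:
  assumes "y \<in> Zer f"
  shows "bar (length hs) y = {y}"
proof -
  note b = bar_props[OF assms order.refl]
  have "z = y" if "z \<in> bar (length hs) y" for z
    using bar_height_Pinf[OF b(1,2) _ that b(3)] b(4) H_Pinf by simp
  with b(3) show ?thesis by blast
qed

lemma contact_at_height:
  assumes y: "y \<in> Zer f" and i: "i < length hs" and z: "z \<in> bar i y" "z \<notin> bar (Suc i) y"
  shows "contact y z = Fin (hs ! i)"
proof -
  note b = bar_props[OF y less_imp_le[OF i]]
  have "H i \<le> contact y z" using bar_height_least(2)[OF b(1,2,3) z(1)] b(4) by simp
  moreover have "\<not> H i < contact y z" using z by (auto simp: bar_def less_Suc_eq)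
  ultimately show ?thesis using i by (simp add: H_Fin order_le_less)
qed

text \<open>
  An element leaves the chain of bars around \<open>y\<close> at the height that is its contact with \<open>y\<close>, and at each
  finite height some element leaves, because there are at least two postbars.
\<close>

lemma char_exponents: "char_exponents f hs"
  unfolding char_exponents_def
proof (intro conjI ballI)
  show "sorted_wrt (<) hs" using hs_less by (simp add: sorted_wrt_iff_nth_less)
next
  fix y assume y: "y \<in> Zer f"
  show "{contact z y |z. z \<in> Zer f \<and> z \<noteq> y} = Fin ` set hs"
  proof (intro equalityI subsetI)
    fix c assume "c \<in> {contact z y |z. z \<in> Zer f \<and> z \<noteq> y}"
    then obtain z where z: "z \<in> Zer f" "z \<noteq> y" "c = contact z y" by blast
    have "z \<in> bar 0 y" using z by (simp add: bar_def)
    moreover have "z \<notin> bar (length hs) y" using bar_last[OF y] z by simp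
    ultimately obtain i where i: "i < length hs" "z \<in> bar i y" "z \<notin> bar (Suc i) y"
      using dec_induct[of 0 "length hs" "\<lambda>i. z \<in> bar i y"] by auto
    from contact_at_height[OF y i] contact_commute[OF z(1) y] z i show "c \<in> Fin ` set hs" by auto
  next
    fix c assume "c \<in> Fin ` set hs"
    then obtain i where i: "i < length hs" "c = Fin (hs ! i)" by (auto simp: in_set_conv_nth)
    note b = bar_props[OF y less_imp_le[OF i(1)]]
    have h: "bar_height (bar i y) = Fin (hs ! i)" using b(4) i by (simp add: H_Fin)
    let ?V = "(\<lambda>z. fracps_coeff z (hs ! i)) ` bar i y"
    have "card ?V \<ge> 2" by (rule card_postbars(2)[OF b(1,2) h])
    then have "?V \<noteq> {fracps_coeff y (hs ! i)}" by auto
    then obtain z where z: "z \<in> bar i y" "fracps_coeff z (hs ! i) \<noteq> fracps_coeff y (hs ! i)"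
      using b(3) by auto
    have "z \<notin> bar (Suc i) y" using z mem_bar_iff[OF y, of "Suc i"] i by auto
    from contact_at_height[OF y i(1) z(1) this] have "contact y z = c" using i by simp
    moreover have zZ: "z \<in> Zer f" "z \<noteq> y" using z b(1) by auto
    ultimately have "c = contact z y" using contact_commute[OF zZ(1) y] by simp
    with zZ show "c \<in> {contact z y |z. z \<in> Zer f \<and> z \<noteq> y}" by blast
  qed
qed

lemma L_0: "L 0 = full_grid 1"
proof (intro equalityI subsetI)
  fix \<alpha> :: "'d \<Rightarrow> rat" assume "\<alpha> \<in> full_grid 1"
  then have "\<forall>i. \<exists>c. \<alpha> i = of_int c" by (auto simp: full_grid_def elim: Ints_cases)
  then obtain z where "\<And>i. \<alpha> i = of_int (z i)" by metis
  then show "\<alpha> \<in> L 0" by (auto simp: exp_lattice_def)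
qed (auto simp: exp_lattice_def full_grid_def)

lemma L_Suc: "L (Suc i) = adjoin (L i) (hs ! i)"
proof (intro equalityI subsetI)
  fix \<alpha> assume "\<alpha> \<in> L (Suc i)"
  then obtain z c where \<alpha>: "\<alpha> = (\<lambda>l. of_int (z l) + (\<Sum>j<Suc i. of_int (c j) * (hs ! j) l))"
    unfolding exp_lattice_def by blast
  define a where "a = (\<lambda>l. of_int (z l) + (\<Sum>j<i. of_int (c j) * (hs ! j) l))"
  have "a \<in> L i" unfolding exp_lattice_def a_def by blast
  moreover have "\<alpha> = a + zmul (c i) (hs ! i)" unfolding \<alpha> a_def zmul_def by (rule ext) simp
  ultimately show "\<alpha> \<in> adjoin (L i) (hs ! i)" by (simp only: adjoinI)
next
  fix \<alpha> assume "\<alpha> \<in> adjoin (L i) (hs ! i)"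
  then obtain a d where a: "a \<in> L i" "\<alpha> = a + zmul d (hs ! i)" by (auto simp: adjoin_def)
  then obtain z c where zc: "a = (\<lambda>l. of_int (z l) + (\<Sum>j<i. of_int (c j) * (hs ! j) l))"
    unfolding exp_lattice_def by blast
  have "\<alpha> = (\<lambda>l. of_int (z l) + (\<Sum>j<Suc i. of_int ((c(i := d)) j) * (hs ! j) l))"
    unfolding a(2) zc zmul_def by (rule ext) simp
  then show "\<alpha> \<in> L (Suc i)" unfolding exp_lattice_def by blast
qed

definition grid :: nat where
  "grid = (SOME k. k > 0 \<and> (\<forall>y\<in>Zer f. on_grid k y))"

lemma grid: "grid > 0" "y \<in> Zer f \<Longrightarrow> on_grid grid y"
proof -
  have "\<exists>k>0. \<forall>y\<in>S. on_grid k y" if "finite S" for S :: "('k, 'd) fracps set"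
    using that
  proof (induction S)
    case empty
    show ?case by (intro exI[of _ 1]) simp
  next
    case (insert y S)
    then obtain k where k: "k > 0" "\<forall>y\<in>S. on_grid k y" by blast
    obtain l where l: "l > 0" "on_grid l y" by (rule fracps_supportE)
    have "(exp_grid k :: ('d \<Rightarrow> rat) set) \<subseteq> exp_grid (k * l)" "(exp_grid l :: ('d \<Rightarrow> rat) set) \<subseteq> exp_grid (k * l)"
      using exp_grid_mono[of k "k * l"] exp_grid_mono[of l "k * l"] k l by simp_all
    with k l show ?case by (intro exI[of _ "k * l"]) auto
  qed
  from someI_ex[OF this[OF fin]] show "grid > 0" "y \<in> Zer f \<Longrightarrow> on_grid grid y"
    unfolding grid_def by blast+
qed

lemma hs_in_grid:
  assumes i: "i < length hs"
  shows "hs ! i \<in> full_grid grid"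
proof -
  from Zer_nonempty obtain y where y: "y \<in> Zer f" by blast
  have "Fin (hs ! i) \<in> {contact z y |z. z \<in> Zer f \<and> z \<noteq> y}"
    using char_exponents y i unfolding char_exponents_def by auto
  then obtain z where z: "z \<in> Zer f" "z \<noteq> y" "contact z y = Fin (hs ! i)" by auto
  then have "least_exponent (z - y) (hs ! i)" using contact_cases[OF z(1) y] by (metis extended.inject)
  then have "fracps_coeff z (hs ! i) \<noteq> 0 \<or> fracps_coeff y (hs ! i) \<noteq> 0"
    by (auto simp: least_exponent_def fracps_coeff_diff)
  then show ?thesis using grid(2)[OF y] grid(2)[OF z(1)] exp_grid_subset_full_grid[OF grid(1)] by blast
qed

lemma L_props:
  "i \<le> length hs \<Longrightarrow> subgroup_add (L i) \<and> full_grid 1 \<subseteq> L i \<and> L i \<subseteq> full_grid grid"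
proof (induction i)
  case 0
  show ?case unfolding L_0 using subgroup_add_full_grid full_grid_1_subset by blast
next
  case (Suc i)
  then show ?case
    unfolding L_Suc using adjoin_base[of "L i" "hs ! i"] hs_in_grid[of i]
    by (auto intro!: subgroup_add_adjoin dest!: adjoin_subset[OF subgroup_add_full_grid, THEN subsetD, rotated 2])
qed

lemma L_mono: "i \<le> j \<Longrightarrow> L i \<subseteq> L j"
  by (induction rule: dec_induct) (auto simp: L_Suc dest: subsetD[OF adjoin_base])

lemma hs_in_L: "j < i \<Longrightarrow> i \<le> length hs \<Longrightarrow> hs ! j \<in> L i"
  using L_mono[of "Suc j" i] adjoin_new[of "L j" "hs ! j"] L_props[of j] by (auto simp: L_Suc)

lemma index_L:
  assumes i: "i < length hs"
  shows "add_index (L (Suc i)) (L i) = order_mod (L i) (hs ! i)" "order_mod (L i) (hs ! i) > 0"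
proof -
  have N: "subgroup_add (L i)" "full_grid 1 \<subseteq> L i" using L_props[of i] i by auto
  have m: "zmul (int grid) (hs ! i) \<in> L i" using full_grid_multiple[OF hs_in_grid[OF i]] N by blast
  show "add_index (L (Suc i)) (L i) = order_mod (L i) (hs ! i)"
    unfolding L_Suc by (rule add_index_adjoin[OF N(1) grid(1) m])
  show "order_mod (L i) (hs ! i) > 0" by (rule order_mod_dvd(1)[OF N(1) grid(1) m])
qed

text \<open>
  The characters whose twists fix the power series; they stand for the Galois group.
\<close>

definition galois :: "(('d \<Rightarrow> rat) \<Rightarrow> 'k) \<Rightarrow> bool" where
  "galois \<chi> \<longleftrightarrow> character_on (full_grid grid) \<chi> \<and> (\<forall>a\<in>full_grid 1. \<chi> a = 1)"

lemma twist_root: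
  assumes "galois \<chi>" "y \<in> Zer f" "poly (map_poly of_mps p) y = 0"
  shows "poly (map_poly of_mps p) (twist \<chi> y) = 0"
  using twist_poly[OF grid(1), of \<chi> y p] assms grid(2)[OF assms(2)]
  by (simp add: galois_def twist_zero)

lemma twist_Zer: "galois \<chi> \<Longrightarrow> y \<in> Zer f \<Longrightarrow> twist \<chi> y \<in> Zer f"
  using twist_root[of \<chi> y f] by (simp add: Zer_def)

lemma twist_in_bar_if_support:
  assumes i: "i \<le> length hs" and y: "y \<in> Zer f" and \<chi>: "galois \<chi>" "\<And>a. a \<in> L i \<Longrightarrow> \<chi> a = 1"
    and supp: "\<And>j \<beta>. j < i \<Longrightarrow> fracps_coeff y \<beta> \<noteq> 0 \<Longrightarrow> \<not> hs ! j \<le> \<beta> \<Longrightarrow> \<beta> \<in> L j"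
  shows "twist \<chi> y \<in> bar i y"
  unfolding mem_bar_iff[OF y i]
proof (intro conjI allI impI twist_Zer[OF \<chi>(1) y])
  fix j assume j: "j < i"
  have "fracps_coeff y \<beta> = fracps_coeff (twist \<chi> y) \<beta>" if "\<not> hs ! j \<le> \<beta>" for \<beta>
    using supp[OF j _ that] \<chi>(2)[of \<beta>] L_mono[of j i] j
    by (cases "fracps_coeff y \<beta> = 0") (auto simp: fracps_coeff_twist)
  then show "agree_below (hs ! j) y (twist \<chi> y)" by (simp add: agree_below_def)
  show "fracps_coeff y (hs ! j) = fracps_coeff (twist \<chi> y) (hs ! j)"
    using \<chi>(2)[OF hs_in_L[OF j i]] by (simp add: fracps_coeff_twist)
qed

text \<open>
  Exponents of a root that are not above the height \<open>H i\<close> lie in \<open>L i\<close>: a character that is trivial on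
  \<open>L i\<close> does not move the root out of its bar of height \<open>H i\<close>, hence fixes these terms, and characters
  separate points.
\<close>

lemma support_below:
  assumes "i \<le> length hs" "y \<in> Zer f" "fracps_coeff y \<alpha> \<noteq> 0" "\<not> H i \<le> Fin \<alpha>"
  shows "\<alpha> \<in> L i"
  using assms
proof (induction i arbitrary: \<alpha> rule: less_induct)
  case (less i)
  note N = L_props[OF less.prems(1)]
  have \<alpha>: "\<alpha> \<in> full_grid grid"
    using grid(2)[OF less.prems(2)] less.prems(3) exp_grid_subset_full_grid[OF grid(1)] by blast
  show ?case
  proof (rule ccontr)
    assume "\<alpha> \<notin> L i"
    with N \<alpha> obtain \<chi> :: "('d \<Rightarrow> rat) \<Rightarrow> 'k" where
      \<chi>: "character_on (full_grid grid) \<chi>" "\<And>a. a \<in> L i \<Longrightarrow> \<chi> a = 1" "\<chi> \<alpha> \<noteq> 1"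
      using character_separates[OF grid(1)] by metis
    then have g: "galois \<chi>" using N by (auto simp: galois_def)
    let ?z = "twist \<chi> y"
    have z: "?z \<in> Zer f" by (rule twist_Zer[OF g less.prems(2)])
    have "?z \<in> bar i y"
      by (rule twist_in_bar_if_support[OF less.prems(1,2) g \<chi>(2)])
        (use less.IH less.prems(1,2) in \<open>auto simp: H_Fin\<close>)
    note b = bar_props[OF less.prems(2,1)]
    have ge: "H i \<le> contact y ?z"
      using bar_height_least(2)[OF b(1,2,3) \<open>?z \<in> bar i y\<close>] b(4) by simp
    have "fracps_coeff y \<alpha> = fracps_coeff ?z \<alpha>"
    proof (cases "i < length hs")
      case True
      then have "agree_below (hs ! i) y ?z" using ge contact_ge_iff[OF less.prems(2) z] by (simp add: H_Fin)
      then show ?thesis using less.prems(4) True by (auto simp: agree_below_def H_Fin)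
    next
      case False
      then have "H i = Pinf" using less.prems(1) H_Pinf by (simp add: ext_height_def)
      then have "y = ?z" using ge contact_eq_Pinf[OF less.prems(2) z] by simp
      then show ?thesis by simp
    qed
    then show False using \<chi>(3) less.prems(3) by (simp add: fracps_coeff_twist)
  qed
qed

lemma galois_with_value:
  assumes i: "i < length hs" and z: "z \<in> Zer f" and y: "y \<in> bar i z"
    and u: "u ^ order_mod (L i) (hs ! i) = 1"
  obtains \<chi> where "galois \<chi>" "twist \<chi> y \<in> bar i z"
    "fracps_coeff (twist \<chi> y) (hs ! i) = u * fracps_coeff y (hs ! i)"
proof -
  note i' = less_imp_le[OF i]
  note N = L_props[OF i']
  have yZ: "y \<in> Zer f" using y bar_props(1)[OF z i'] by blast
  obtain \<chi> where \<chi>: "character_on (full_grid grid) \<chi>" "\<And>a. a \<in> L i \<Longrightarrow> \<chi> a = 1" "\<chi> (hs ! i) = u"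
    using character_with_value[OF grid(1) _ _ _ hs_in_grid[OF i] u] N by blast
  have g: "galois \<chi>" using \<chi> N by (auto simp: galois_def)
  have "twist \<chi> y \<in> bar i y"
    by (rule twist_in_bar_if_support[OF i' yZ g \<chi>(2)]) (use support_below yZ i in \<open>auto simp: H_Fin\<close>)
  then have "twist \<chi> y \<in> bar i z" using bar_eq[OF z i' y] by simp
  then show ?thesis by (rule that[OF g]) (simp add: fracps_coeff_twist \<chi>(3))
qed

text \<open>
  The set \<open>V\<close> of coefficients at the height has as many elements as there are \<open>n\<close>-th roots of unity,
  and it is closed under multiplication by them. It contains some \<open>v \<noteq> 0\<close>, as it has at least two
  elements, so the multiples of \<open>v\<close> exhaust it.
\<close>

lemma coefficients_in_bar:
  assumes i: "i < length hs" and z: "z \<in> Zer f" and xy: "x \<in> bar i z" "y \<in> bar i z"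
  obtains u where "u ^ order_mod (L i) (hs ! i) = 1" "fracps_coeff y (hs ! i) = u * fracps_coeff x (hs ! i)"
proof -
  let ?h = "hs ! i" and ?n = "order_mod (L i) (hs ! i)" and ?B = "bar i z"
  let ?V = "(\<lambda>y. fracps_coeff y ?h) ` ?B" and ?U = "{u :: 'k. u ^ ?n = 1}"
  note b = bar_props[OF z less_imp_le[OF i]]
  have h: "bar_height ?B = Fin ?h" using b(4) i by (simp add: H_Fin)
  have V: "card ?V = ?n" "card ?V \<ge> 2"
    using card_postbars[OF b(1,2) h] bar_in_tree[OF z less_imp_le[OF i]]
      bar_of_height(1)[of ?B i] i index_L(1)[OF i] by simp_all
  have finV: "finite ?V" using V(2) by (intro card_ge_0_finite) simp
  have closed: "u * v \<in> ?V" if "u \<in> ?U" "v \<in> ?V" for u v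
  proof -
    from that obtain y where y: "y \<in> ?B" "v = fracps_coeff y ?h" by blast
    from that have "u ^ ?n = 1" by simp
    from galois_with_value[OF i z y(1) this] obtain \<chi> where
      "twist \<chi> y \<in> ?B" "fracps_coeff (twist \<chi> y) ?h = u * v" using y(2) by metis
    then show ?thesis by force
  qed
  have "\<not> ?V \<subseteq> {0}"
  proof
    assume "?V \<subseteq> {0}"
    then have "card ?V \<le> card {0 :: 'k}" by (intro card_mono) simp_all
    with V(2) show False by simp
  qed
  then obtain v where v: "v \<in> ?V" "v \<noteq> 0" by blast
  have "(\<lambda>u. u * v) ` ?U \<subseteq> ?V" using closed v(1) by blast
  moreover have "card ((\<lambda>u. u * v) ` ?U) = ?n"
    using v(2) card_roots_of_unity[OF index_L(2)[OF i], where 'k = 'k]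
    by (subst card_image) (auto intro!: inj_onI)
  ultimately have UV: "(\<lambda>u. u * v) ` ?U = ?V" using V(1) finV by (intro card_subset_eq) auto
  have "fracps_coeff x ?h \<in> ?V" "fracps_coeff y ?h \<in> ?V" using xy by auto
  then obtain a c where ac: "a ^ ?n = 1" "fracps_coeff x ?h = a * v" "c ^ ?n = 1" "fracps_coeff y ?h = c * v"
    unfolding UV[symmetric] by auto
  have "a \<noteq> 0" using ac(1) index_L(2)[OF i] by (auto simp: power_0_left)
  then show ?thesis
    using ac by (intro that[of "c / a"]) (simp_all add: power_divide)
qed

text \<open>
  An invariant set meets the bar of every root \<open>z\<close> at each height: inside a bar, a suitable character
  moves an element of the set into the postbar of \<open>z\<close>. At infinite height the bar is \<open>{z}\<close>.
\<close>

lemma galois_transitive: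
  assumes A: "A \<subseteq> Zer f" "A \<noteq> {}" "\<And>\<chi> y. galois \<chi> \<Longrightarrow> y \<in> A \<Longrightarrow> twist \<chi> y \<in> A"
  shows "A = Zer f"
proof -
  have meets: "A \<inter> bar i z \<noteq> {}" if zZ: "z \<in> Zer f" and i: "i \<le> length hs" for i z
    using i
  proof (induction i)
    case 0
    then show ?case using A by (auto simp: bar_def)
  next
    case (Suc i)
    then have i: "i < length hs" and "A \<inter> bar i z \<noteq> {}" by auto
    then obtain y where y: "y \<in> A" "y \<in> bar i z" by blast
    note b = bar_props[OF zZ less_imp_le[OF i]]
    let ?h = "hs ! i"
    obtain u where u: "u ^ order_mod (L i) ?h = 1" "fracps_coeff z ?h = u * fracps_coeff y ?h"
      using coefficients_in_bar[OF i zZ y(2) b(3)] by blast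
    from galois_with_value[OF i zZ y(2) u(1)] obtain \<chi> where
      g: "galois \<chi>" and t: "twist \<chi> y \<in> bar i z" and "fracps_coeff (twist \<chi> y) ?h = fracps_coeff z ?h"
      using u(2) by metis
    moreover have h: "bar_height (bar i z) = Fin ?h" using b(4) i by (simp add: H_Fin)
    ultimately have "H i < contact z (twist \<chi> y)"
      using contact_gt_in_bar[OF b(1,2) h b(3) t] i by (simp add: H_Fin)
    with t have "twist \<chi> y \<in> bar (Suc i) z" by (auto simp: bar_def less_Suc_eq)
    with A(3)[OF g y(1)] show ?case by blast
  qed
  have "z \<in> A" if "z \<in> Zer f" for z
    using meets[OF that order.refl] unfolding bar_last[OF that] by simp
  with A(1) show ?thesis by blast
qed

lemma card_Zer_le: "p \<noteq> 0 \<Longrightarrow> card (Zer p) \<le> degree p"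
  for p :: "('k, 'd) mps poly"
proof -
  interpret P: map_poly_inj_comm_ring_hom "of_mps :: ('k, 'd) mps \<Rightarrow> _" ..
  assume "p \<noteq> 0"
  then have "map_poly of_mps p \<noteq> 0" by simp
  from card_poly_roots_bound[OF this] show ?thesis by (simp add: Zer_def)
qed

text \<open>
  The roots of a factor form an invariant set, so a factor with a root has as many roots as \<open>f\<close>; this is
  too many for a factor of smaller degree.
\<close>

lemma irreducible: "irreducible f"
proof (rule irreducibleI)
  show f0: "f \<noteq> 0" using deg by auto
  show "\<not> f dvd 1"
  proof
    assume "f dvd 1"
    then obtain q where q: "1 = f * q" by (rule dvdE)
    then have "q \<noteq> 0" by auto
    then have "degree (f * q) = degree f + degree q" using f0 by (intro degree_mult_eq)
    then show False using q deg by (metis add_is_0 degree_1 less_irrefl)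
  qed
  fix a b assume ab: "f = a * b"
  interpret P: map_poly_inj_comm_ring_hom "of_mps :: ('k, 'd) mps \<Rightarrow> _" ..
  have nz: "a \<noteq> 0" "b \<noteq> 0" using ab f0 by auto
  have dab: "degree f = degree a + degree b" unfolding ab by (rule degree_mult_eq[OF nz])
  have lab: "lead_coeff a * lead_coeff b = 1" using monic unfolding ab by (simp add: lead_coeff_mult)
  have Z: "Zer f = Zer a \<union> Zer b" unfolding ab by (auto simp: Zer_def hom_distribs)
  have full: "Zer p = Zer f" if "Zer p \<subseteq> Zer f" "Zer p \<noteq> {}" for p
  proof (rule galois_transitive[OF that])
    fix \<chi> y assume g: "galois \<chi>" and y: "y \<in> Zer p"
    from y that(1) have "y \<in> Zer f" by blast
    moreover from y have "poly (map_poly of_mps p) y = 0" by (simp add: Zer_def)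
    ultimately have "poly (map_poly of_mps p) (twist \<chi> y) = 0" by (rule twist_root[OF g])
    then show "twist \<chi> y \<in> Zer p" by (simp add: Zer_def)
  qed
  have unit: "p dvd 1" if "degree p = 0" "lead_coeff p * q = 1" for p and q :: "('k, 'd) mps"
  proof -
    from that(1) obtain c where p: "p = [:c:]" by (rule degree_eq_zeroE)
    have "c * q = 1" using that(2) by (simp add: p)
    then have "p * [:q:] = [:1:]" by (simp add: p mult.commute)
    then have "1 = p * [:q:]" by (simp only: pCons_one)
    then show ?thesis by (rule dvdI)
  qed
  have "degree a = 0 \<or> degree b = 0"
  proof (rule ccontr)
    assume "\<not> ?thesis"
    then have pos: "degree a < degree f" "degree b < degree f" using dab by auto
    then have "Zer a \<noteq> Zer f" "Zer b \<noteq> Zer f"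
      using card_Zer_le[OF nz(1)] card_Zer_le[OF nz(2)] card_Zer by auto
    with full[of a] full[of b] Z have "Zer a = {}" "Zer b = {}" by blast+
    with Z Zer_nonempty show False by blast
  qed
  then show "a dvd 1 \<or> b dvd 1"
    using unit[of a "lead_coeff b"] unit[of b "lead_coeff a"] lab by (auto simp: mult.commute)
qed

end

theorem theorem6p3:
  fixes f :: "('k :: {alg_closed_field, field_char_0}, 'd :: finite) mps poly"
    and hs :: "('d \<Rightarrow> rat) list"
  assumes "weierstrass_poly f"
    and "quasi_ordinary f"
    and "tree_of_type (tree_model f) hs"
  shows "irreducible f \<and> char_exponents f hs"
proof -
  from assms(1) have monic: "lead_coeff f = 1" and deg: "degree f > 0"
    by (auto simp: weierstrass_poly_def)
  from assms(2) obtain \<mu> u where disc: "monic_discriminant f = mps_X_pow \<mu> * u" and u: "mps_coeff u 0 \<noteq> 0"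
    by (auto simp: quasi_ordinary_def)
  define s :: "('k, 'd) mps" where "s = (- 1) ^ (degree f * (degree f - 1) div 2)"
  have s: "s * s = 1" by (simp add: s_def flip: power_mult_distrib)
  have "degree f + degree (pderiv f) > 0" using deg by simp
  from resultant_in_ideal[OF this] obtain e c where
    ec: "[:resultant f (pderiv f):] = e * f + c * pderiv f" by blast
  have "[:mps_X_pow \<mu> * u:] = [:s:] * [:resultant f (pderiv f):]"
    by (simp add: disc[symmetric] monic_discriminant_def s_def)
  then have bez: "[:mps_X_pow \<mu> * u:] = ([:s:] * c) * pderiv f + ([:s:] * e) * f"
    unfolding ec by (simp add: algebra_simps)
  interpret S: monomial_bezout f "[:s:] * c" "[:s:] * e" "mps_X_pow \<mu> * u" u \<mu>
    using monic deg bez u by unfold_locales auto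
  interpret P: map_poly_inj_comm_ring_hom "of_mps :: ('k, 'd) mps \<Rightarrow> _" ..
  let ?p = "map_poly of_mps f"
  have card: "card (Zer f) = degree f" by (rule S.card_Zer)
  have fin: "finite (Zer f)" using card deg by (intro card_ge_0_finite) simp
  have split: "?p = (\<Prod>y\<in>Zer f. [:-y, 1:])"
    using monic_eq_prod_roots[of ?p] monic card by (simp add: Zer_def)
  interpret typed_tree f hs
  proof
    fix y z assume yz: "y \<in> Zer f" "z \<in> Zer f" "y \<noteq> z"
    have const: "poly (map_poly of_mps [:a:]) y = of_mps a" for a :: "('k, 'd) mps"
      by (simp add: hom_distribs)
    have root: "poly ?p y = 0" using yz(1) by (simp add: Zer_def)
    have "of_mps (mps_X_pow \<mu> * u) = poly (map_poly of_mps [:mps_X_pow \<mu> * u:]) y" by (rule const[symmetric])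
    also have "\<dots> = poly (map_poly of_mps ([:s:] * c)) y * poly (map_poly of_mps (pderiv f)) y"
      unfolding bez P.hom_add P.hom_mult[of _ f] P.hom_mult[of _ "pderiv f"] poly_add poly_mult root
      by (simp only: mult_zero_right add_0_right)
    also have "map_poly of_mps (pderiv f) = pderiv ?p"
      by (rule map_poly_pderiv_hom[OF of_mps.comm_ring_hom_axioms])
    also have "poly (pderiv ?p) y = (\<Prod>t\<in>Zer f - {y}. y - t)"
      unfolding split by (rule pderiv_at_root[OF fin yz(1)])
    also have "\<dots> = (y - z) * (\<Prod>t\<in>Zer f - {y} - {z}. y - t)"
      using fin yz by (intro prod.remove) auto
    finally have eq: "of_mps (mps_X_pow \<mu> * u) = (y - z) *
        ((\<Prod>t\<in>Zer f - {y} - {z}. y - t) * poly (map_poly of_mps ([:s:] * c)) y)"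
      by (simp add: mult_ac)
    have "least_exponent (of_mps (mps_X_pow \<mu> * u)) (\<lambda>i. of_nat (\<mu> i))"
      unfolding least_exponent_iff
    proof (intro conjI exI)
      show "(0 :: 'd \<Rightarrow> rat) \<le> (\<lambda>i. of_nat (\<mu> i))" by (simp add: le_fun_def)
      show "of_mps (mps_X_pow \<mu> * u) = fracps_X_pow (\<lambda>i. of_nat (\<mu> i)) * of_mps u"
        by (simp only: of_mps.hom_mult mps_X_pow.rep_eq)
      have "(\<lambda>i. of_nat ((0 :: 'd \<Rightarrow> nat) i)) = (0 :: 'd \<Rightarrow> rat)" by auto
      then show "fracps_coeff (of_mps u) 0 \<noteq> 0" using u unfolding mps_coeff_def by (simp only: not_False_eq_True)
    qed
    then show "\<exists>\<mu>. least_exponent (y - z) \<mu>" unfolding eq by (rule least_exponent_factor)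
  qed (use monic deg card assms(3) in auto)
  show ?thesis using irreducible char_exponents by blast
qed

end
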